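(* Let $L\ge3$, $\operatorname{Im}\tau>0$, let $\check R_1=\check R_A^{\mathrm{ell}}(z)$ be the restricted elliptic Yang--Baxter operator on $V^{\pi_A}$, $\pi_A$ the Dynkin diagram $A_{2L-3}$, and let $\widetilde C\in\Gamma(\pi\times\pi,\overline{\operatorname{Hom}}(V^{\pi_A},V^{\pi_D}))$, $\pi_D$ the Dynkin diagram $D_L$, be the transfer operator with the coefficients listed in the context. Then $\widetilde C$ is a cell twist. Consequently the formula $$\sum_{\beta:\,t_\pi(\beta)=c'}j^{-1}(\beta,\beta_c)\,\check R_A^{\mathrm{ell}}(z)\,j(\beta_c,\beta)\quad\text{on }(V^{\pi_D})^{\otimes2}[c,c'],\qquad j=\widetilde C^{-1}*_\otimes\widetilde C^{-1},\quad j^{-1}=\widetilde C*_\otimes\widetilde C,$$ defines a Yang--Baxter operator $\check R^{\mathrm{ell}}_D(z)$ on $V^{\pi_D}$.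
   Context: Let $\theta(z,\tau)=-\sum_{n\in\mathbb Z}e^{i\pi(n+\frac12)^2\tau+2\pi i(n+\frac12)(z+\frac12)}$ and $[z]=\theta(\tfrac{z}{2L-2},\tau)\big/\big(\theta'(0,\tau)/(2L-2)\big)$; $\sqrt{\ }$ is a fixed branch of the square root. Graphs. $A_{2L-3}$ has vertices $1,\dots,2L-3$ with edges $\{a,a+1\}$. $D_L$ has vertices $1,\dots,L$ with edges $\{i,i+1\}$ for $1\le i\le L-3$, $\{L-2,L-1\}$ and $\{L-2,L\}$. For $X\in\{A,D\}$, each oriented edge $x\to y$ carries a one dimensional space $\mathbb Ce_{x,y}$; these are the components of $V^{\pi_X}$. $(V^{\pi_X})^{\otimes m}[x,y]$ is the space with basis $e_{x_0,x_1}\otimes\cdots\otimes e_{x_{m-1},x_m}$ indexed by the walks of length $m$ from $x_0=x$ to $x_m=y$, and $(V^{\pi_X})^{\otimes m}$ is the direct sum of these over $x,y$. A Yang--Baxter operator on $V^{\pi_X}$ is a meromorphic family $\check R(z)$ of endomorphisms of $(V^{\pi_X})^{\otimes2}$ preserving each $(V^{\pi_X})^{\otimes 2}[x,y]$ with $\check R(z-w)^{(23)}\check R(z)^{(12)}\check R(w)^{(23)}=\check R(w)^{(12)}\check R(z)^{(23)}\check R(z-w)^{(12)}$ on $(V^{\pi_X})^{\otimes3}$ and $\check R(z)\check R(-z)=\mathrm{id}$. The operator $\check R_A^{\mathrm{ell}}(z)$ (a Yang--Baxter operator on $V^{\pi_A}$, known result): $e_{a,a\pm1}\otimes e_{a\pm1,a\pm2}\mapsto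 e_{a,a\pm1}\otimes e_{a\pm1,a\pm2}$, and $$e_{a,a\pm1}\otimes e_{a\pm1,a}\mapsto\frac{[a\pm z][1]}{[a][1-z]}\,e_{a,a\pm1}\otimes e_{a\pm1,a}+\frac{\sqrt{[a-1][a+1]}\,[z]}{[a][1-z]}\,e_{a,a\mp1}\otimes e_{a\mp1,a},$$ where terms involving vertices outside $\{1,\dots,2L-3\}$ are omitted. Connecting set $\pi$ (arrows from vertices of $A_{2L-3}$ to vertices of $D_L$): $i_A\to i_D$ and $(2L-2-i)_A\to i_D$ for $1\le i\le L-2$; $(L-1)_A\to(L-1)_D$ and $(L-1)_A\to L_D$. Sources and targets are denoted $s_\pi,t_\pi$. Transfer operators. Elements $f\in\Gamma(\pi\times\pi,\overline{\operatorname{Hom}}((V^{\pi_A})^{\otimes m},(V^{\pi_D})^{\otimes m}))$ are families of linear maps $f(\beta_1,\beta_2):(V^{\pi_A})^{\otimes m}[s_\pi(\beta_2),s_\pi(\beta_1)]\to(V^{\pi_D})^{\otimes m}[t_\pi(\beta_2),t_\pi(\beta_1)]$; elements $g\in\Gamma(\pi\times\pi,\overline{\operatorname{Hom}}((V^{\pi_D})^{\otimes m},(V^{\pi_A})^{\otimes m}))$ are families $g(\beta_1,\beta_2):(V^{\pi_D})^{\otimes m}[t_\pi(\beta_1),t_\pi(\beta_2)]\to(V^{\pi_A})^{\otimes m}[s_\pi(\beta_1),s_\pi(\beta_2)]$. Fusion: $(f*_\otimes f')(\beta_1,\beta_2)=\sum_\beta f(\beta,\beta_2)\otimes f'(\beta_1,\beta)$,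 $(g*_\otimes g')(\beta_1,\beta_2)=\sum_\beta g(\beta_1,\beta)\otimes g'(\beta,\beta_2)$. $f$ is invertible with inverse $g=f^{-1}$ if: for all $\beta_1,\beta_2$ with $t_\pi(\beta_1)=t_\pi(\beta_2)$ and all $x$, $\sum_{\beta:\,s_\pi(\beta)=x}g(\beta,\beta_2)f(\beta_1,\beta)=\delta_{\beta_1,\beta_2}\mathrm{id}$ on $(V^{\pi_A})^{\otimes m}[x,s_\pi(\beta_1)]$; and for all $\beta_1,\beta_2$ with $s_\pi(\beta_1)=s_\pi(\beta_2)$ and all $c'$, $\sum_{\beta:\,t_\pi(\beta)=c'}f(\beta,\beta_2)g(\beta_1,\beta)=\delta_{\beta_1,\beta_2}\mathrm{id}$ on $(V^{\pi_D})^{\otimes m}[t_\pi(\beta_1),c']$. The operator $\widetilde C$: for connecting arrows $\beta_2:a_1\to d_1$ and $\beta_1:a_2\to d_2$ with $\{a_1,a_2\}$ an edge of $A_{2L-3}$ and $\{d_1,d_2\}$ an edge of $D_L$, $\widetilde C(\beta_1,\beta_2)e_{a_1,a_2}=\widetilde C(a_1,a_2;d_1,d_2)\,e_{d_1,d_2}$ where - for $1\le i\le L-3$: $\widetilde C(i+1,i;i+1,i)=\widetilde C(i,i+1;i,i+1)=\widetilde C(2L-3-i,2L-2-i;i+1,i)=\widetilde C(2L-2-i,2L-3-i;i,i+1)=1$; - $\widetilde C(L-1,L-2;L-1,L-2)=\tfrac1{\sqrt2}$, $\widetilde C(L-1,L-2;L,L-2)=-\tfrac1{\sqrt2}$, $\widetilde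 C(L-1,L;L-1,L-2)=\tfrac1{\sqrt2}$, $\widetilde C(L-1,L;L,L-2)=\tfrac1{\sqrt2}$; - $\widetilde C(L-2,L-1;L-2,L-1)=1$, $\widetilde C(L-2,L-1;L-2,L)=-1$, $\widetilde C(L,L-1;L-2,L-1)=1$, $\widetilde C(L,L-1;L-2,L)=1$. Its inverse $\widetilde C^{-1}$ has the same coefficients: $\widetilde C^{-1}(\beta_2,\beta_1)e_{d_1,d_2}=\widetilde C(a_1,a_2;d_1,d_2)e_{a_1,a_2}$ for $\beta_2:a_1\to d_1$ (initial), $\beta_1:a_2\to d_2$ (final). Cell twist. For $s_\pi(\beta_1)=s_\pi(\beta_2)$ let $\check R_2(\beta_1,\beta_2)$ be the map which on $(V^{\pi_D})^{\otimes2}[t_\pi(\beta_1),c']$ is $\sum_{\beta:\,t_\pi(\beta)=c'}j^{-1}(\beta,\beta_2)\check R_1(z)j(\beta_1,\beta)$, with $j=\widetilde C^{-1}*_\otimes\widetilde C^{-1}$, $j^{-1}=\widetilde C*_\otimes\widetilde C$. $\widetilde C$ is a cell twist if it is invertible, $\check R_2(\beta_1,\beta_1)=\check R_2(\beta_1',\beta_1')$ whenever $t_\pi(\beta_1)=t_\pi(\beta_1')$, and $\check R_2(\beta_1,\beta_2)=0$ whenever $\beta_2\neq\beta_1$ and $s_\pi(\beta_2)=s_\pi(\beta_1)$. Connecting system: a choice of one $\beta_c\in\pi$ with $t_\pi(\beta_c)=c$ for each vertex $c$ of $D_L$, with $\beta_{1_D}$ the arrow $1_A\to1_D$ (which is the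 only arrow of $\pi$ with source $1_A$). *)

theory Defs
  imports "HOL-Complex_Analysis.Complex_Analysis" "Graph_Theory.Pair_Digraph"
begin

section \<open>Theta function\<close>

definition theta :: "complex \<Rightarrow> complex \<Rightarrow> complex" where
  "theta z \<tau> = - (\<Sum>\<^sub>\<infinity>n\<in>(UNIV :: int set).
      exp (\<i> * of_real pi * (of_int n + 1/2)^2 * \<tau>
           + 2 * of_real pi * \<i> * (of_int n + 1/2) * (z + 1/2)))"

definition bracket :: "nat \<Rightarrow> complex \<Rightarrow> complex \<Rightarrow> complex" where
  "bracket L \<tau> z = theta (z / (2 * of_nat L - 2)) \<tau>
      / (deriv (\<lambda>u. theta u \<tau>) 0 / (2 * of_nat L - 2))"

section \<open>Walk spaces and linear maps between them\<close>

text \<open>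
  A graph is a symmetric digraph; its arcs \<open>(x, y)\<close> index the one dimensional spaces
  spanned by \<open>e\<^bsub>x,y\<^esub>\<close>. The basis vector
  \<open>e\<^bsub>x0,x1\<^esub> \<otimes> \<dots> \<otimes> e\<^bsub>xm-1,xm\<^esub>\<close> is the arc list
  \<open>[(x0, x1), \<dots>, (xm-1, xm)]\<close>, and the tensor product of basis vectors is concatenation.
\<close>

definition walks :: "nat pair_pre_digraph \<Rightarrow> nat \<Rightarrow> nat \<Rightarrow> nat \<Rightarrow> (nat \<times> nat) list set" where
  "walks G m x y = {p. pre_digraph.awalk (with_proj G) x p y \<and> length p = m}"

definition all_walks :: "nat pair_pre_digraph \<Rightarrow> nat \<Rightarrow> (nat \<times> nat) list set" where
  "all_walks G m = (\<Union>x\<in>pverts G. \<Union>y\<in>pverts G. walks G m x y)"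

text \<open>
  A linear map is given by its matrix in the bases of walks: \<open>M q p\<close> is the coefficient of
  the walk \<open>q\<close> in the image of the walk \<open>p\<close>. Only indices that are basis vectors of
  the source and the target are meaningful.
\<close>

type_synonym linmap = "(nat \<times> nat) list \<Rightarrow> (nat \<times> nat) list \<Rightarrow> complex"

definition id_map :: linmap where
  "id_map = (\<lambda>q p. if q = p then 1 else 0)"

text \<open>The composition \<open>M \<circ> N\<close> through the space with basis \<open>B\<close>.\<close>

definition comp_map :: "(nat \<times> nat) list set \<Rightarrow> linmap \<Rightarrow> linmap \<Rightarrow> linmap" where
  "comp_map B M N = (\<lambda>q p. \<Sum>r\<in>B. M q r * N r p)"

text \<open>\<open>M \<otimes> N\<close>, where \<open>M\<close> acts between spaces of walks of length \<open>k\<close>.\<close>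

definition tensor_map :: "nat \<Rightarrow> linmap \<Rightarrow> linmap \<Rightarrow> linmap" where
  "tensor_map k M N = (\<lambda>q p. M (take k q) (take k p) * N (drop k q) (drop k p))"

section \<open>Yang--Baxter operators\<close>

text \<open>
  The value of a meromorphic family at a pole carries no information (division by zero is zero
  in HOL), so identities between meromorphic families are required at the points where
  all matrix entries involved are analytic.
\<close>

definition regular_at :: "nat pair_pre_digraph \<Rightarrow> (complex \<Rightarrow> linmap) \<Rightarrow> complex \<Rightarrow> bool" where
  "regular_at G R z \<longleftrightarrow>
     (\<forall>p\<in>all_walks G 2. \<forall>q\<in>all_walks G 2. (\<lambda>u. R u q p) analytic_on {z})"

definition map12 :: "linmap \<Rightarrow> linmap" where
  "map12 M = tensor_map 2 M id_map"

definition map23 :: "linmap \<Rightarrow> linmap" where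
  "map23 M = tensor_map 1 id_map M"

definition yang_baxter_operator :: "nat pair_pre_digraph \<Rightarrow> (complex \<Rightarrow> linmap) \<Rightarrow> bool" where
  "yang_baxter_operator G R \<longleftrightarrow>
     (\<forall>p\<in>all_walks G 2. \<forall>q\<in>all_walks G 2. (\<lambda>z. R z q p) meromorphic_on UNIV)
   \<and> (\<forall>z x y x' y'. regular_at G R z \<longrightarrow> (x, y) \<noteq> (x', y') \<longrightarrow>
        (\<forall>p\<in>walks G 2 x y. \<forall>q\<in>walks G 2 x' y'. R z q p = 0))
   \<and> (\<forall>z w. regular_at G R z \<longrightarrow> regular_at G R w \<longrightarrow> regular_at G R (z - w) \<longrightarrow>
        (\<forall>p\<in>all_walks G 3. \<forall>q\<in>all_walks G 3.
           comp_map (all_walks G 3) (map23 (R (z - w)))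
             (comp_map (all_walks G 3) (map12 (R z)) (map23 (R w))) q p
         = comp_map (all_walks G 3) (map12 (R w))
             (comp_map (all_walks G 3) (map23 (R z)) (map12 (R (z - w)))) q p))
   \<and> (\<forall>z. regular_at G R z \<longrightarrow> regular_at G R (- z) \<longrightarrow>
        (\<forall>p\<in>all_walks G 2. \<forall>q\<in>all_walks G 2.
           comp_map (all_walks G 2) (R z) (R (- z)) q p = id_map q p))"

section \<open>Transfer operators and cell twists\<close>

text \<open>
  A connecting set \<open>P\<close> from \<open>G\<close> to \<open>H\<close> consists of arrows \<open>(a, d)\<close> with source
  \<open>a\<close> in \<open>G\<close> and target \<open>d\<close> in \<open>H\<close>. The maps \<open>f \<beta>1 \<beta>2\<close> of a section are extended by
  zero outside their source and target spaces, so that sums and compositions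
  over all walks only see the composable blocks.
\<close>

type_synonym arrow = "nat \<times> nat"
type_synonym transfer = "arrow \<Rightarrow> arrow \<Rightarrow> linmap"

abbreviation src :: "arrow \<Rightarrow> nat" where "src \<equiv> fst"
abbreviation tgt :: "arrow \<Rightarrow> nat" where "tgt \<equiv> snd"

definition transfer_sections ::
  "nat pair_pre_digraph \<Rightarrow> nat pair_pre_digraph \<Rightarrow> arrow set \<Rightarrow> nat \<Rightarrow> transfer set" where
  "transfer_sections G H P m = {f. \<forall>\<beta>1\<in>P. \<forall>\<beta>2\<in>P. \<forall>q p. f \<beta>1 \<beta>2 q p \<noteq> 0 \<longrightarrow>
      p \<in> walks G m (src \<beta>2) (src \<beta>1) \<and> q \<in> walks H m (tgt \<beta>2) (tgt \<beta>1)}"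

definition cotransfer_sections ::
  "nat pair_pre_digraph \<Rightarrow> nat pair_pre_digraph \<Rightarrow> arrow set \<Rightarrow> nat \<Rightarrow> transfer set" where
  "cotransfer_sections G H P m = {g. \<forall>\<beta>1\<in>P. \<forall>\<beta>2\<in>P. \<forall>q p. g \<beta>1 \<beta>2 q p \<noteq> 0 \<longrightarrow>
      p \<in> walks H m (tgt \<beta>1) (tgt \<beta>2) \<and> q \<in> walks G m (src \<beta>1) (src \<beta>2)}"

text \<open>Fusion; \<open>k\<close> is the tensor degree of the first factor.\<close>

definition fuse :: "arrow set \<Rightarrow> nat \<Rightarrow> transfer \<Rightarrow> transfer \<Rightarrow> transfer" where
  "fuse P k f f' \<beta>1 \<beta>2 = (\<lambda>q p. \<Sum>\<beta>\<in>P. tensor_map k (f \<beta> \<beta>2) (f' \<beta>1 \<beta>) q p)"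

definition cofuse :: "arrow set \<Rightarrow> nat \<Rightarrow> transfer \<Rightarrow> transfer \<Rightarrow> transfer" where
  "cofuse P k g g' \<beta>1 \<beta>2 = (\<lambda>q p. \<Sum>\<beta>\<in>P. tensor_map k (g \<beta>1 \<beta>) (g' \<beta> \<beta>2) q p)"

definition is_transfer_inverse ::
  "nat pair_pre_digraph \<Rightarrow> nat pair_pre_digraph \<Rightarrow> arrow set \<Rightarrow> nat \<Rightarrow> transfer \<Rightarrow> transfer \<Rightarrow> bool"
  where
  "is_transfer_inverse G H P m f g \<longleftrightarrow>
     f \<in> transfer_sections G H P m \<and> g \<in> cotransfer_sections G H P m
   \<and> (\<forall>\<beta>1\<in>P. \<forall>\<beta>2\<in>P. tgt \<beta>1 = tgt \<beta>2 \<longrightarrow> (\<forall>x\<in>pverts G.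
        \<forall>p\<in>walks G m x (src \<beta>1). \<forall>q\<in>walks G m x (src \<beta>2).
          (\<Sum>\<beta> | \<beta> \<in> P \<and> src \<beta> = x. comp_map (all_walks H m) (g \<beta> \<beta>2) (f \<beta>1 \<beta>) q p)
          = (if \<beta>1 = \<beta>2 then id_map q p else 0)))
   \<and> (\<forall>\<beta>1\<in>P. \<forall>\<beta>2\<in>P. src \<beta>1 = src \<beta>2 \<longrightarrow> (\<forall>c'\<in>pverts H.
        \<forall>p\<in>walks H m (tgt \<beta>1) c'. \<forall>q\<in>walks H m (tgt \<beta>2) c'.
          (\<Sum>\<beta> | \<beta> \<in> P \<and> tgt \<beta> = c'. comp_map (all_walks G m) (f \<beta> \<beta>2) (g \<beta>1 \<beta>) q p)
          = (if \<beta>1 = \<beta>2 then id_map q p else 0)))"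

text \<open>
  The map \<open>\<Sum>\<^bsub>t(\<beta>) = c'\<^esub> j\<^sup>-\<^sup>1(\<beta>, \<beta>2) R\<^sub>1(z) j(\<beta>1, \<beta>)\<close> from
  \<open>V\<^sub>H\<^sup>2[t(\<beta>1), c']\<close> to \<open>V\<^sub>H\<^sup>2[t(\<beta>2), c']\<close>, where \<open>g\<close> is the inverse of the
  degree one transfer operator \<open>f\<close>, \<open>j = g * g\<close> and \<open>j\<^sup>-\<^sup>1 = f * f\<close>.
\<close>

definition twist ::
  "nat pair_pre_digraph \<Rightarrow> arrow set \<Rightarrow> transfer \<Rightarrow> transfer \<Rightarrow> (complex \<Rightarrow> linmap)
     \<Rightarrow> arrow \<Rightarrow> arrow \<Rightarrow> nat \<Rightarrow> complex \<Rightarrow> linmap" where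
  "twist G P f g R1 \<beta>1 \<beta>2 c' z = (\<lambda>q p. \<Sum>\<beta> | \<beta> \<in> P \<and> tgt \<beta> = c'.
     comp_map (all_walks G 2) (fuse P 1 f f \<beta> \<beta>2)
       (comp_map (all_walks G 2) (R1 z) (cofuse P 1 g g \<beta>1 \<beta>)) q p)"

definition cell_twist ::
  "nat pair_pre_digraph \<Rightarrow> nat pair_pre_digraph \<Rightarrow> arrow set \<Rightarrow> (complex \<Rightarrow> linmap)
     \<Rightarrow> transfer \<Rightarrow> bool" where
  "cell_twist G H P R1 f \<longleftrightarrow> (\<exists>g. is_transfer_inverse G H P 1 f g
   \<and> (\<forall>z. regular_at G R1 z \<longrightarrow>
        (\<forall>\<beta>1\<in>P. \<forall>\<beta>1'\<in>P. tgt \<beta>1 = tgt \<beta>1' \<longrightarrow> (\<forall>c'\<in>pverts H.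
           \<forall>p\<in>walks H 2 (tgt \<beta>1) c'. \<forall>q\<in>walks H 2 (tgt \<beta>1) c'.
             twist G P f g R1 \<beta>1 \<beta>1 c' z q p = twist G P f g R1 \<beta>1' \<beta>1' c' z q p))
      \<and> (\<forall>\<beta>1\<in>P. \<forall>\<beta>2\<in>P. \<beta>2 \<noteq> \<beta>1 \<longrightarrow> src \<beta>2 = src \<beta>1 \<longrightarrow> (\<forall>c'\<in>pverts H.
           \<forall>p\<in>walks H 2 (tgt \<beta>1) c'. \<forall>q\<in>walks H 2 (tgt \<beta>2) c'.
             twist G P f g R1 \<beta>1 \<beta>2 c' z q p = 0))))"

text \<open>
  The operator acting on \<open>V\<^sub>H\<^sup>2[c, c']\<close> by the twist at the arrow \<open>\<beta>s c\<close>;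
  here \<open>c\<close> and \<open>c'\<close> are read off as the initial and final vertex of the walk \<open>p\<close>.
\<close>

definition twisted_operator ::
  "nat pair_pre_digraph \<Rightarrow> arrow set \<Rightarrow> transfer \<Rightarrow> transfer \<Rightarrow> (complex \<Rightarrow> linmap)
     \<Rightarrow> (nat \<Rightarrow> arrow) \<Rightarrow> complex \<Rightarrow> linmap" where
  "twisted_operator G P f g R1 \<beta>s z = (\<lambda>q p.
     let c = fst (hd p); c' = snd (last p)
     in twist G P f g R1 (\<beta>s c) (\<beta>s c) c' z q p)"

section \<open>The Dynkin diagrams and the elliptic operators\<close>

definition symmetric_arcs :: "(nat \<times> nat) set \<Rightarrow> (nat \<times> nat) set" where
  "symmetric_arcs E = E \<union> E\<inverse>"

definition A_graph :: "nat \<Rightarrow> nat pair_pre_digraph" where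
  "A_graph n = \<lparr> pverts = {1..n}, parcs = symmetric_arcs {(a, a + 1) | a. 1 \<le> a \<and> a + 1 \<le> n} \<rparr>"

definition D_graph :: "nat \<Rightarrow> nat pair_pre_digraph" where
  "D_graph L = \<lparr> pverts = {1..L}, parcs = symmetric_arcs
     ({(i, i + 1) | i. 1 \<le> i \<and> i \<le> L - 3} \<union> {(L - 2, L - 1), (L - 2, L)}) \<rparr>"

definition conn_AD :: "nat \<Rightarrow> arrow set" where
  "conn_AD L = {(i, i) | i. 1 \<le> i \<and> i \<le> L - 2} \<union> {(2 * L - 2 - i, i) | i. 1 \<le> i \<and> i \<le> L - 2}
     \<union> {(L - 1, L - 1), (L - 1, L)}"

definition connecting_system :: "nat \<Rightarrow> (nat \<Rightarrow> arrow) \<Rightarrow> bool" where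
  "connecting_system L \<beta>s \<longleftrightarrow>
     (\<forall>c\<in>pverts (D_graph L). \<beta>s c \<in> conn_AD L \<and> tgt (\<beta>s c) = c) \<and> \<beta>s 1 = (1, 1)"

text \<open>
  The argument \<open>sq\<close> is the branch of the square root. Walks with a vertex outside
  \<open>{1..2 * L - 3}\<close> are never used as indices, which accounts for the omitted terms.
\<close>

definition RA_ell ::
  "(complex \<Rightarrow> complex) \<Rightarrow> nat \<Rightarrow> complex \<Rightarrow> complex \<Rightarrow> linmap" where
  "RA_ell sq L \<tau> z = (\<lambda>q p. case p of
     [(a, b), (b', c)] \<Rightarrow>
       if c \<noteq> a then (if q = p then 1 else 0)
       else if q = p then
         bracket L \<tau> (if b = a + 1 then of_nat a + z else of_nat a - z) * bracket L \<tau> 1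
           / (bracket L \<tau> (of_nat a) * bracket L \<tau> (1 - z))
       else if (b = a + 1 \<and> q = [(a, a - 1), (a - 1, a)]) \<or> (a = b + 1 \<and> q = [(a, a + 1), (a + 1, a)]) then
         sq (bracket L \<tau> (of_nat a - 1) * bracket L \<tau> (of_nat a + 1)) * bracket L \<tau> z
           / (bracket L \<tau> (of_nat a) * bracket L \<tau> (1 - z))
       else 0
   | _ \<Rightarrow> 0)"

definition C_coeff ::
  "(complex \<Rightarrow> complex) \<Rightarrow> nat \<Rightarrow> nat \<Rightarrow> nat \<Rightarrow> nat \<Rightarrow> nat \<Rightarrow> complex" where
  "C_coeff sq L a1 a2 d1 d2 =
     (let t = (a1, a2, d1, d2) in
      if \<exists>i. 1 \<le> i \<and> i \<le> L - 3 \<and>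
           t \<in> {(i + 1, i, i + 1, i), (i, i + 1, i, i + 1),
                (2 * L - 3 - i, 2 * L - 2 - i, i + 1, i),
                (2 * L - 2 - i, 2 * L - 3 - i, i, i + 1)} then 1
      else if t = (L - 1, L - 2, L - 1, L - 2) then 1 / sq 2
      else if t = (L - 1, L - 2, L, L - 2) then - 1 / sq 2
      else if t = (L - 1, L, L - 1, L - 2) then 1 / sq 2
      else if t = (L - 1, L, L, L - 2) then 1 / sq 2
      else if t = (L - 2, L - 1, L - 2, L - 1) then 1
      else if t = (L - 2, L - 1, L - 2, L) then - 1
      else if t = (L, L - 1, L - 2, L - 1) then 1
      else if t = (L, L - 1, L - 2, L) then 1
      else 0)"

text \<open>
  In \<open>C_tilde \<beta>1 \<beta>2\<close> the arrow \<open>\<beta>2\<close> is the initial and \<open>\<beta>1\<close> the final one, in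
  \<open>C_tilde_inv \<beta>2 \<beta>1\<close> the order is reversed.
\<close>

definition C_tilde :: "(complex \<Rightarrow> complex) \<Rightarrow> nat \<Rightarrow> transfer" where
  "C_tilde sq L \<beta>1 \<beta>2 = (\<lambda>q p.
     if p = [(src \<beta>2, src \<beta>1)] \<and> q = [(tgt \<beta>2, tgt \<beta>1)]
     then C_coeff sq L (src \<beta>2) (src \<beta>1) (tgt \<beta>2) (tgt \<beta>1) else 0)"

definition C_tilde_inv :: "(complex \<Rightarrow> complex) \<Rightarrow> nat \<Rightarrow> transfer" where
  "C_tilde_inv sq L \<beta>2 \<beta>1 = (\<lambda>q p.
     if p = [(tgt \<beta>2, tgt \<beta>1)] \<and> q = [(src \<beta>2, src \<beta>1)]
     then C_coeff sq L (src \<beta>2) (src \<beta>1) (tgt \<beta>2) (tgt \<beta>1) else 0)"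

definition RD_ell ::
  "(complex \<Rightarrow> complex) \<Rightarrow> nat \<Rightarrow> complex \<Rightarrow> (nat \<Rightarrow> arrow) \<Rightarrow> complex \<Rightarrow> linmap" where
  "RD_ell sq L \<tau> \<beta>s = twisted_operator (A_graph (2 * L - 3)) (conn_AD L)
     (C_tilde sq L) (C_tilde_inv sq L) (RA_ell sq L \<tau>) \<beta>s"

end

theory Submission
  imports Defs
begin

text \<open>
  Write \<open>L = n + 3\<close>.  The vertex \<open>d \<le> n + 1\<close> of the D diagram lies below the two vertices \<open>d\<close> and
  \<open>2 n + 4 - d\<close> of the A diagram, and the centre \<open>n + 2\<close> of the A diagram lies above both leaves
  \<open>n + 2\<close> and \<open>n + 3\<close>: the A diagram is folded along its reflection.  The cells, which are the
  coefficients of \<open>C_tilde\<close>, are \<open>1\<close> over the line and signs or \<open>\<plusminus> 1 / sqrt 2\<close> at the leaves.  They are unitary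
  in both directions (\<open>cell_unitary_target\<close>, \<open>cell_unitary_source\<close>) because \<open>(1, 1) / sqrt 2\<close> and
  \<open>(- 1, 1) / sqrt 2\<close> are orthonormal.

  The heart of the matter is one linear identity, \<open>face_cell_commute\<close>: for fixed vertical
  arrows at both ends of a walk of length two, the cells intertwine the elliptic A operator with
  an explicit operator \<open>weightD\<close> on walks in the D diagram.  It holds because the A operator
  commutes with the reflection of the diagram.  At the centre the reflection swaps the two
  middle vertices of a loop, so the A operator is diagonal on \<open>(1, 1)\<close> and \<open>(- 1, 1)\<close>; at the
  branch vertex the symmetric combination of the two leaves behaves like the upper neighbour in
  the A diagram, and the antisymmetric combination corresponds to a straight walk through the
  centre, on which the A operator is the identity.

  Everything else is formal.  By unitarity, the twist of the A operator at a pair of arrows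
  \<open>\<beta>1\<close>, \<open>\<beta>2\<close> with the same source is \<open>weightD\<close> if \<open>\<beta>1 = \<beta>2\<close> and zero otherwise
  (\<open>twisted_face\<close>), which is the cell twist property and shows that the operator on the D diagram
  does not depend on the connecting system.  Products of three cells intertwine both sides of the
  Yang--Baxter equation, and since they have a left inverse the equation descends from A to D
  (\<open>star_triangle_transfer\<close>); the same happens for \<open>R(z) R(- z) = id\<close> (\<open>unitarity_transfer\<close>).

  The equation on the A side is proved from scratch.  On walks from \<open>a\<close> to \<open>a + 1\<close> it is an
  equation of three by three matrices whose entries reduce to the three-term relation of the
  theta function.  This relation in turn is the Pluecker relation of two by two minors, because
  \<open>\<theta>(x + y) \<theta>(x - y)\<close> has the form \<open>A(x) B(y) - B(x) A(y)\<close> (\<open>theta_mult_theta\<close>).  The same relation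
  locates the zeros of the theta function (\<open>theta_eq_0_imp_lattice\<close>), which ensures that the
  denominators do not vanish and that the operator on the D diagram has a pole wherever the
  A operator has one (\<open>regular_at_RD\<close>).
\<close>

section \<open>Theta series\<close>

text \<open>
  Characteristic \<open>1/2\<close> gives the theta function of the operators up to sign and a shift of \<open>z\<close>.
  Characteristic \<open>0\<close> is needed as well, since both occur in products of two such series.
\<close>

definition theta_term :: "real \<Rightarrow> complex \<Rightarrow> complex \<Rightarrow> int \<Rightarrow> complex" where
  "theta_term c z t n =
     exp (\<i> * of_real pi * (of_int n + of_real c)\<^sup>2 * t + 2 * of_real pi * \<i> * (of_int n + of_real c) * z)"

definition theta_char :: "real \<Rightarrow> complex \<Rightarrow> complex \<Rightarrow> complex" where
  "theta_char c z t = (\<Sum>\<^sub>\<infinity>n. theta_term c z t n)"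

lemma summable_exp_neg_abs_int: "(\<lambda>n::int. exp (- \<bar>real_of_int n\<bar>)) summable_on UNIV"
proof -
  have geo: "(\<lambda>n::nat. exp (- real n)) summable_on UNIV"
  proof (rule norm_summable_imp_summable_on)
    have "summable (\<lambda>n. exp (-1::real) ^ n)"
      by (rule summable_geometric) simp
    moreover have "exp (-1::real) ^ n = norm (exp (- real n))" for n
      by (simp add: exp_of_nat_mult [symmetric])
    ultimately show "summable (\<lambda>n. norm (exp (- real n)))" by simp
  qed
  have "(\<lambda>n::int. exp (- \<bar>real_of_int n\<bar>)) summable_on (range int)"
    by (subst summable_on_reindex) (use geo in \<open>auto simp: o_def\<close>)
  moreover have "(\<lambda>n::int. exp (- \<bar>real_of_int n\<bar>)) summable_on (range (\<lambda>n. - int n))"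
    by (subst summable_on_reindex) (use geo in \<open>auto simp: o_def inj_on_def\<close>)
  moreover have "UNIV = range int \<union> range (\<lambda>n. - int n)"
  proof -
    have "n \<in> range int \<union> range (\<lambda>n. - int n)" for n
      by (cases n rule: int_cases2) auto
    thus ?thesis by auto
  qed
  ultimately show ?thesis by (metis summable_on_union)
qed

text \<open>
  The majorant of \<open>norm_theta_term_le\<close>, uniform for \<open>norm z \<le> r\<close>.  Its constant comes from completing
  the square: \<open>b \<bar>y\<bar> - a y\<^sup>2 \<le> b\<^sup>2 / (4 a)\<close> with \<open>a = \<pi> Im t\<close> and \<open>b = 2 \<pi> r + 1\<close>, so that the Gaussian
  decay leaves \<open>exp (- \<bar>y\<bar>)\<close>.
\<close>

definition theta_bound :: "real \<Rightarrow> real \<Rightarrow> complex \<Rightarrow> int \<Rightarrow> real" where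
  "theta_bound c r t n =
     exp ((2 * pi * r + 1)\<^sup>2 / (4 * pi * Im t) + \<bar>c\<bar>) * exp (- \<bar>real_of_int n\<bar>)"

lemma norm_theta_term_le:
  assumes "Im t > 0" and z: "norm z \<le> r"
  shows "norm (theta_term c z t n) \<le> theta_bound c r t n"
proof -
  define y where "y = real_of_int n + c"
  define a where "a = pi * Im t"
  define b where "b = 2 * pi * r + 1"
  have a: "a > 0" using assms by (simp add: a_def)
  have Y: "of_int n + complex_of_real c = of_real y" by (simp add: y_def)
  have n: "norm (theta_term c z t n) = exp (- (a * y\<^sup>2) - 2 * pi * (y * Im z))"
    unfolding theta_term_def Y norm_exp_eq_Re
    by (simp add: power2_eq_square a_def algebra_simps)
  have "\<bar>Im z\<bar> \<le> r" using z abs_Im_le_cmod order_trans by blast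
  hence "- (y * Im z) \<le> \<bar>y\<bar> * r"
    by (metis abs_ge_minus_self abs_ge_zero abs_mult mult_left_mono order_trans)
  hence 1: "- 2 * pi * (y * Im z) \<le> 2 * pi * (\<bar>y\<bar> * r)"
    by (metis (no_types, opaque_lifting) mult.assoc mult_left_mono mult_minus_left mult_minus_right pi_ge_zero zero_le_mult_iff zero_le_numeral)
  have "0 \<le> (2 * a * \<bar>y\<bar> - b)\<^sup>2" by simp
  hence "4 * a * (b * \<bar>y\<bar> - a * y\<^sup>2) \<le> b\<^sup>2"
    by (simp add: power2_eq_square algebra_simps)
  hence 2: "b * \<bar>y\<bar> - a * y\<^sup>2 \<le> b\<^sup>2 / (4 * a)"
    using a by (simp add: pos_le_divide_eq mult.commute)
  have 3: "- \<bar>y\<bar> \<le> \<bar>c\<bar> - \<bar>real_of_int n\<bar>" unfolding y_def by linarith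
  have "- (a * y\<^sup>2) - 2 * pi * (y * Im z) \<le> b\<^sup>2 / (4 * a) + \<bar>c\<bar> - \<bar>real_of_int n\<bar>"
    using 1 2 3 unfolding b_def by (simp add: algebra_simps)
  also have "\<dots> = ((2 * pi * r + 1)\<^sup>2 / (4 * pi * Im t) + \<bar>c\<bar>) + - \<bar>real_of_int n\<bar>"
    by (simp add: a_def b_def)
  finally show ?thesis
    unfolding n theta_bound_def exp_add [symmetric] by simp
qed

lemma summable_theta_bound: "theta_bound c r t summable_on UNIV"
  unfolding theta_bound_def by (intro summable_on_cmult_right summable_exp_neg_abs_int)

lemma theta_term_abs_summable:
  assumes "Im t > 0"
  shows "(\<lambda>n. norm (theta_term c z t n)) summable_on UNIV"
  by (rule Infinite_Sum.abs_summable_on_comparison_test' [OF summable_theta_bound [of c "norm z" t]])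
    (use norm_theta_term_le [OF assms] in auto)

lemma theta_term_summable: "Im t > 0 \<Longrightarrow> theta_term c z t summable_on UNIV"
  using theta_term_abs_summable abs_summable_summable by blast

lemma uniform_limit_theta_char:
  assumes "Im t > 0"
  shows "uniform_limit (cball 0 r) (\<lambda>N z. \<Sum>n\<in>N. theta_term c z t n) (\<lambda>z. theta_char c z t)
           (finite_subsets_at_top UNIV)"
  unfolding theta_char_def
  by (rule Weierstrass_m_test_general [OF _ summable_theta_bound [of c r t]])
    (use norm_theta_term_le [OF assms] in auto)

lemma holomorphic_theta_char:
  assumes "Im t > 0"
  shows "(\<lambda>z. theta_char c z t) holomorphic_on UNIV"
proof -
  have "(\<lambda>z. theta_char c z t) field_differentiable at z" for z
  proof -
    have "(\<lambda>z. theta_char c z t) holomorphic_on ball 0 (norm z + 1)"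
      by (rule holomorphic_uniform_limit [OF _ uniform_limit_theta_char [OF assms]])
        (auto simp: theta_term_def intro!: always_eventually holomorphic_intros continuous_intros)
    thus ?thesis by (auto simp: holomorphic_on_open field_differentiable_def)
  qed
  thus ?thesis by (simp add: holomorphic_on_def field_differentiable_at_within)
qed

lemma theta_char_add_1:
  assumes "Im t > 0" 
  shows "theta_char c (z + 1) t = exp (2 * of_real pi * \<i> * of_real c) * theta_char c z t"
proof -
  have "theta_term c (z + 1) t n = exp (2 * of_real pi * \<i> * of_real c) * theta_term c z t n" for n
  proof -
    have "theta_term c (z + 1) t n = exp (2 * of_real pi * \<i> * of_real c) * theta_term c z t n * exp (2 * of_real pi * \<i> * of_int n)"
      unfolding theta_term_def mult_exp_exp by (rule arg_cong [where f = exp]) (simp add: algebra_simps)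
    moreover have "exp (2 * of_real pi * \<i> * of_int n) = 1"
      using exp_integer_2pi [of "of_int n"] by (simp add: mult_ac)
    ultimately show ?thesis by simp
  qed
  thus ?thesis by (simp add: theta_char_def infsum_cmult_right theta_term_summable assms)
qed

lemma theta_char_add_tau:
  assumes "Im t > 0" 
  shows "theta_char c (z + t) t = exp (- \<i> * of_real pi * (2 * z + t)) * theta_char c z t"
proof -
  have "theta_term c (z + t) t n = exp (- \<i> * of_real pi * (2 * z + t)) * theta_term c z t (n + 1)" for n
    unfolding theta_term_def by (simp add: exp_add [symmetric] algebra_simps power2_eq_square)
  hence "theta_char c (z + t) t = exp (- \<i> * of_real pi * (2 * z + t)) * (\<Sum>\<^sub>\<infinity>n. theta_term c z t (n + 1))"
    using summable_on_reindex_bij_betw [of "\<lambda>n::int. n + 1" UNIV UNIV "theta_term c z t"]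
      theta_term_summable [OF assms, of c z]
    by (simp add: theta_char_def infsum_cmult_right bij_plus_right)
  also have "(\<Sum>\<^sub>\<infinity>n. theta_term c z t (n + 1)) = theta_char c z t"
    unfolding theta_char_def by (rule infsum_reindex_bij_betw) (simp add: bij_plus_right)
  finally show ?thesis .
qed

lemma theta_char_minus: 
  "theta_char (1/2) (- z) t = theta_char (1/2) z t"
proof -
  have "theta_term (1/2) (- z) t n = theta_term (1/2) z t (- 1 - n)" for n
    unfolding theta_term_def by (simp add: algebra_simps power2_eq_square)
  moreover have "bij (\<lambda>n::int. - 1 - n)"
    by (rule bij_betw_byWitness [where f' = "\<lambda>n. - 1 - n"]) auto
  ultimately show ?thesis
    using infsum_reindex_bij_betw [of "\<lambda>n::int. - 1 - n" UNIV UNIV "theta_term (1/2) z t"]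
    by (simp add: theta_char_def)
qed

lemma infsum_mult_infsum:
  fixes f :: "'a \<Rightarrow> complex" and g :: "'b \<Rightarrow> complex"
  assumes f: "(\<lambda>x. norm (f x)) summable_on A" and g: "(\<lambda>y. norm (g y)) summable_on B"
  shows "(\<lambda>(x, y). f x * g y) summable_on A \<times> B"
    and "infsum f A * infsum g B = (\<Sum>\<^sub>\<infinity>(x, y)\<in>A \<times> B. f x * g y)"
proof -
  have "(\<lambda>z. norm ((\<lambda>(x, y). f x * g y) z)) summable_on A \<times> B"
    unfolding Infinite_Sum.abs_summable_on_Sigma_iff
    using f g by (auto simp: norm_mult infsum_cmult_right' abs_mult infsum_nonneg intro!: summable_on_cmult_right summable_on_cmult_left)
  thus s: "(\<lambda>(x, y). f x * g y) summable_on A \<times> B"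
    by (rule abs_summable_summable)
  show "infsum f A * infsum g B = (\<Sum>\<^sub>\<infinity>(x, y)\<in>A \<times> B. f x * g y)"
    by (subst infsum_Sigma_banach [OF s, symmetric]) (simp add: infsum_cmult_right' infsum_cmult_left')
qed

text \<open>
  The exponents \<open>(m + 1/2)\<^sup>2 + (n + 1/2)\<^sup>2\<close> become sums of squares of \<open>m + n + 1\<close> and \<open>m - n\<close>.  These two
  integers have opposite parity; the two possible parities yield the two products on the right.
\<close>

lemma theta_char_half_mult:
  assumes "Im t > 0"
  shows "theta_char (1/2) u t * theta_char (1/2) v t =
      theta_char 0 (u + v) (2 * t) * theta_char (1/2) (u - v) (2 * t)
    + theta_char (1/2) (u + v) (2 * t) * theta_char 0 (u - v) (2 * t)"
proof -
  define F where "F = (\<lambda>(m, n). theta_term (1/2) u t m * theta_term (1/2) v t n)"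
  define h1 where "h1 = (\<lambda>(k::int, l::int). (k + l, k - l - 1))"
  define h2 where "h2 = (\<lambda>(k::int, l::int). (k + l, k - l))"
  have t2: "Im (2 * t) > 0" using assms by simp
  note sm = theta_term_abs_summable [OF assms] theta_term_abs_summable [OF t2]
  have inj: "inj h1" "inj h2" by (auto simp: h1_def h2_def inj_on_def)
  have disj: "range h1 \<inter> range h2 = {}"
  proof -
    have "h1 p \<noteq> h2 q" for p q
      by (cases p; cases q; simp add: h1_def h2_def; presburger)
    thus ?thesis by (metis (no_types, opaque_lifting) disjoint_iff imageE)
  qed
  have cover: "range h1 \<union> range h2 = UNIV"
  proof -
    have "(m, n) \<in> range h1 \<union> range h2" for m n
    proof (cases "even (m + n)")
      case True
      hence "(m, n) = h2 ((m + n) div 2, (m - n) div 2)" unfolding h2_def by simp presburger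
      thus ?thesis by blast
    next
      case False
      hence "(m, n) = h1 ((m + n + 1) div 2, (m - n) div 2)" unfolding h1_def by simp presburger
      thus ?thesis by blast
    qed
    thus ?thesis by auto
  qed
  have sF: "F summable_on UNIV"
    using infsum_mult_infsum(1) [OF sm(1) sm(1), of "1/2" u "1/2" v] by (simp add: F_def)
  have e1: "F (h1 (k, l)) = theta_term 0 (u + v) (2 * t) k * theta_term (1/2) (u - v) (2 * t) l" for k l
    unfolding F_def h1_def theta_term_def prod.case mult_exp_exp
    by (rule arg_cong [where f = exp]) (simp add: field_simps power2_eq_square)
  have e2: "F (h2 (k, l)) = theta_term (1/2) (u + v) (2 * t) k * theta_term 0 (u - v) (2 * t) l" for k l
    unfolding F_def h2_def theta_term_def prod.case mult_exp_exp
    by (rule arg_cong [where f = exp]) (simp add: field_simps power2_eq_square)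
  have "theta_char (1/2) u t * theta_char (1/2) v t = infsum F UNIV"
    unfolding theta_char_def infsum_mult_infsum(2) [OF sm(1) sm(1)] F_def by simp
  also have "\<dots> = infsum F (range h1 \<union> range h2)"
    by (simp only: cover)
  also have "\<dots> = infsum F (range h1) + infsum F (range h2)"
    by (rule infsum_Un_disjoint) (use disj in \<open>auto intro: summable_on_subset_banach [OF sF]\<close>)
  also have "infsum F (range h1) = theta_char 0 (u + v) (2 * t) * theta_char (1/2) (u - v) (2 * t)"
    unfolding theta_char_def infsum_mult_infsum(2) [OF sm(2) sm(2)] infsum_reindex [OF inj(1)]
    by (auto simp: o_def e1 intro!: infsum_cong)
  also have "infsum F (range h2) = theta_char (1/2) (u + v) (2 * t) * theta_char 0 (u - v) (2 * t)"
    unfolding theta_char_def infsum_mult_infsum(2) [OF sm(2) sm(2)] infsum_reindex [OF inj(2)]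
    by (auto simp: o_def e2 intro!: infsum_cong)
  finally show ?thesis .
qed

lemma theta_eq_theta_char: "theta z t = - theta_char (1/2) (z + 1/2) t"
  by (simp add: theta_def theta_char_def theta_term_def)

lemma theta_mult_theta:
  assumes "Im t > 0"
  shows "theta (x + y) t * theta (x - y) t =
      theta_char 0 (2 * x) (2 * t) * theta_char (1/2) (2 * y) (2 * t)
    - theta_char (1/2) (2 * x) (2 * t) * theta_char 0 (2 * y) (2 * t)"
proof -
  have t2: "Im (2 * t) > 0" using assms by simp
  have "theta_char 0 (2 * x + 1) (2 * t) = theta_char 0 (2 * x) (2 * t)"
    using theta_char_add_1 [OF t2, of 0] by simp
  moreover have "theta_char (1/2) (2 * x + 1) (2 * t) = - theta_char (1/2) (2 * x) (2 * t)"
    using theta_char_add_1 [OF t2, of "1/2"] by simp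
  ultimately show ?thesis
    using theta_char_half_mult [OF assms, of "x + y + 1/2" "x - y + 1/2"]
    by (simp add: theta_eq_theta_char algebra_simps)
qed

lemma theta_minus: 
  assumes "Im t > 0"
  shows "theta (- z) t = - theta z t"
proof -
  have "theta_char (1/2) (- z + 1/2) t = theta_char (1/2) (z - 1/2) t"
    using theta_char_minus [of "z - 1/2" t] by simp
  also have "\<dots> = - theta_char (1/2) (z + 1/2) t"
    using theta_char_add_1 [OF assms, of "1/2" "z - 1/2"] by (simp add: algebra_simps)
  finally show ?thesis by (simp add: theta_eq_theta_char)
qed

lemma theta_add_1: "Im t > 0 \<Longrightarrow> theta (z + 1) t = - theta z t"
  using theta_char_add_1 [of t "1/2" "z + 1/2"] by (simp add: theta_eq_theta_char add_ac)

lemma theta_add_tau: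
  "Im t > 0 \<Longrightarrow> theta (z + t) t = - exp (- \<i> * of_real pi * (2 * z + t)) * theta z t"
proof -
  assume t: "Im t > 0"
  have "exp (- \<i> * of_real pi * (2 * (z + 1/2) + t)) = exp (- \<i> * of_real pi * (2 * z + t)) * exp (- (\<i> * of_real pi))"
    unfolding mult_exp_exp by (rule arg_cong [where f = exp]) (simp add: algebra_simps)
  also have "exp (- (\<i> * of_real pi)) = - 1"
    using exp_minus [of "\<i> * of_real pi"] by (simp add: exp_pi_i')
  finally show ?thesis
    using theta_char_add_tau [OF t, of "1/2" "z + 1/2"] by (simp add: theta_eq_theta_char add_ac)
qed

text \<open>
  The Pluecker relation between the minors \<open>A(x) B(y) - B(x) A(y)\<close> of \<open>theta_mult_theta\<close>.
\<close>

lemma theta_three_term: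
  assumes "Im t > 0"
  shows "theta (x + y) t * theta (x - y) t * theta (u + v) t * theta (u - v) t
    = theta (x + u) t * theta (x - u) t * theta (y + v) t * theta (y - v) t
    - theta (x + v) t * theta (x - v) t * theta (y + u) t * theta (y - u) t"
proof -
  have "theta (x + y) t * theta (x - y) t * (theta (u + v) t * theta (u - v) t)
    = theta (x + u) t * theta (x - u) t * (theta (y + v) t * theta (y - v) t)
    - theta (x + v) t * theta (x - v) t * (theta (y + u) t * theta (y - u) t)"
    unfolding theta_mult_theta [OF assms] by algebra
  thus ?thesis by (simp add: mult_ac)
qed

lemma holomorphic_theta:
  assumes "Im t > 0"
  shows "(\<lambda>z. theta z t) holomorphic_on UNIV"
proof -
  have "(\<lambda>z. theta_char (1/2) z t) \<circ> (\<lambda>z. z + 1/2) holomorphic_on UNIV"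
    by (rule holomorphic_on_compose_gen [OF _ holomorphic_theta_char [OF assms]])
      (auto intro!: holomorphic_intros)
  thus ?thesis by (simp add: theta_eq_theta_char o_def holomorphic_on_minus)
qed

text \<open>
  The integral over the period \<open>[0, 1]\<close> extracts the term of index \<open>0\<close>, which is \<open>1\<close>.
\<close>

lemma theta_char_0_not_identically_zero:
  assumes "Im t > 0"
  shows "\<exists>z. theta_char 0 z t \<noteq> 0"
proof (rule ccontr)
  assume *: "\<not> ?thesis"
  let ?g = "linepath (0::complex) 1"
  define f where "f = (\<lambda>N z. \<Sum>n\<in>N. theta_term 0 z t n)"
  define c where "c = (\<lambda>n::int. exp (\<i> * of_real pi * (of_int n)\<^sup>2 * t))"
  have t_eq: "theta_term 0 z t n = c n * exp (2 * of_real pi * \<i> * of_int n * z)" for n z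
    by (simp add: theta_term_def c_def mult_exp_exp algebra_simps)
  have int_n: "((\<lambda>z. theta_term 0 z t n) has_contour_integral (if n = 0 then 1 else 0)) ?g" for n
  proof (cases "n = 0")
    case True
    thus ?thesis using has_contour_integral_const_linepath [of 1 1 0]
      by (simp add: t_eq c_def)
  next
    case False
    define P where "P = (\<lambda>z. c n * exp (2 * of_real pi * \<i> * of_int n * z) / (2 * of_real pi * \<i> * of_int n))"
    have "(P has_field_derivative theta_term 0 z t n) (at z within UNIV)" for z
      unfolding P_def t_eq using False by (auto intro!: derivative_eq_intros)
    hence "((\<lambda>z. theta_term 0 z t n) has_contour_integral (P (pathfinish ?g) - P (pathstart ?g))) ?g"
      by (intro contour_integral_primitive [of UNIV] valid_path_linepath) auto
    moreover have "P 1 = P 0"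
      using exp_integer_2pi [of "of_int n"] by (simp add: P_def mult_ac)
    ultimately show ?thesis using False by simp
  qed
  have int_f: "(f N has_contour_integral (\<Sum>n\<in>N. if n = 0 then 1 else 0)) ?g" if "finite N" for N
    unfolding f_def by (intro has_contour_integral_sum that int_n)
  have "uniform_limit (path_image ?g) f (\<lambda>z. theta_char 0 z t) (finite_subsets_at_top UNIV)"
    unfolding f_def
    by (rule uniform_limit_on_subset [OF uniform_limit_theta_char [OF assms, where r = 1]])
      (auto simp: closed_segment_def norm_mult)
  hence "((\<lambda>N. contour_integral ?g (f N)) \<longlongrightarrow> contour_integral ?g (\<lambda>z. theta_char 0 z t))
            (finite_subsets_at_top UNIV)"
  proof (rule contour_integral_uniform_limit(2) [where B = 1, rotated])
    show "\<forall>\<^sub>F N in finite_subsets_at_top UNIV. f N contour_integrable_on ?g"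
      by (rule eventually_finite_subsets_at_top_weakI) (use int_f contour_integrable_on_def in blast)
  qed auto
  moreover have "contour_integral ?g (\<lambda>z. theta_char 0 z t) = 0"
    using * by simp
  moreover have "\<forall>\<^sub>F N in finite_subsets_at_top UNIV. contour_integral ?g (f N) = 1"
    unfolding eventually_finite_subsets_at_top
    using contour_integral_unique [OF int_f] by (intro exI [of _ "{0}"]) auto
  ultimately have "((\<lambda>_. 1::complex) \<longlongrightarrow> 0) (finite_subsets_at_top (UNIV :: int set))"
    using tendsto_cong by fastforce
  thus False by (simp add: tendsto_const_iff)
qed

text \<open>
  Moving \<open>z\<close> by the half period \<open>t / 2\<close> changes the characteristic from \<open>1/2\<close> to \<open>0\<close>.
\<close>

lemma theta_not_identically_zero:
  assumes "Im t > 0"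
  shows "\<exists>z. theta z t \<noteq> 0"
proof -
  obtain z where z: "theta_char 0 z t \<noteq> 0"
    using theta_char_0_not_identically_zero [OF assms] by blast
  have "theta_term (1/2) (z - t / 2) t n = exp (\<i> * of_real pi * (z - t / 4)) * theta_term 0 z t n" for n
    unfolding theta_term_def mult_exp_exp
    by (rule arg_cong [where f = exp]) (simp add: field_simps power2_eq_square)
  hence "theta_char (1/2) (z - t / 2) t = exp (\<i> * of_real pi * (z - t / 4)) * theta_char 0 z t"
    by (simp add: theta_char_def infsum_cmult_right')
  hence "theta ((z - t / 2) - 1/2) t \<noteq> 0" using z by (simp add: theta_eq_theta_char)
  thus ?thesis by blast
qed

text \<open>
  Where \<open>f\<close> does not vanish, the hypothesis says that \<open>g / f\<close> has the constant logarithmic derivative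
  \<open>\<kappa>\<close>.  The resulting identity extends from a small disc to the plane.
\<close>

lemma proportional_to_exp_multiple:
  fixes f g :: "complex \<Rightarrow> complex"
  assumes f: "f holomorphic_on UNIV" and g: "g holomorphic_on UNIV"
    and s0: "f s0 \<noteq> 0"
    and ode: "\<And>s. f s * deriv g s - deriv f s * g s = \<kappa> * f s * g s"
  obtains K where "\<And>s. g s = K * exp (\<kappa> * s) * f s"
proof -
  obtain r where r: "r > 0" "\<And>s. s \<in> ball s0 r \<Longrightarrow> f s \<noteq> 0"
  proof -
    have "continuous (at s0) f"
      using holomorphic_on_imp_continuous_on [OF f] by (simp add: continuous_on_eq_continuous_at)
    hence "\<forall>\<^sub>F s in nhds s0. f s \<noteq> 0"
      using s0 by (simp add: continuous_within tendsto_nhds_iff tendsto_imp_eventually_ne)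
    thus ?thesis using that unfolding eventually_nhds_metric
      by (metis dist_commute mem_ball)
  qed
  define q where "q = (\<lambda>s. g s * exp (- \<kappa> * s) / f s)"
  have "(q has_field_derivative 0) (at s within ball s0 r)" if "s \<in> ball s0 r" for s
  proof -
    have df: "(f has_field_derivative deriv f s) (at s)" and dg: "(g has_field_derivative deriv g s) (at s)"
      using f g by (auto intro!: holomorphic_derivI [of _ UNIV])
    have "(q has_field_derivative
       ((deriv g s * exp (- \<kappa> * s) + g s * (- \<kappa> * exp (- \<kappa> * s))) * f s - g s * exp (- \<kappa> * s) * deriv f s)
         / (f s * f s)) (at s)"
      unfolding q_def using r(2) [OF that] by (auto intro!: derivative_eq_intros df dg)
    moreover have "(deriv g s * exp (- \<kappa> * s) + g s * (- \<kappa> * exp (- \<kappa> * s))) * f s - g s * exp (- \<kappa> * s) * deriv f s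
       = exp (- \<kappa> * s) * (f s * deriv g s - deriv f s * g s - \<kappa> * f s * g s)"
      by (simp add: algebra_simps)
    ultimately show ?thesis by (simp add: ode has_field_derivative_at_within)
  qed
  then obtain K where K: "\<And>s. s \<in> ball s0 r \<Longrightarrow> q s = K"
    using has_field_derivative_zero_constant [of "ball s0 r" q] by auto
  have "g s = K * exp (\<kappa> * s) * f s" for s
  proof (rule analytic_continuation_open
      [where f = g and g = "\<lambda>s. K * exp (\<kappa> * s) * f s" and s = "ball s0 r" and s' = UNIV])
    fix z assume "z \<in> ball s0 r"
    thus "g z = K * exp (\<kappa> * z) * f z"
      using K [of z] r(2) [of z] by (auto simp: q_def field_simps exp_minus)
  qed (use r(1) in \<open>auto intro!: holomorphic_intros f g\<close>)
  thus ?thesis by (rule that)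
qed

lemma holomorphic_theta_compose [holomorphic_intros]:
  assumes "Im t > 0" "f holomorphic_on S"
  shows "(\<lambda>z. theta (f z) t) holomorphic_on S"
  using holomorphic_on_compose_gen [OF assms(2) holomorphic_theta [OF assms(1)]] by (simp add: o_def)

lemma has_field_derivative_theta [derivative_intros]:
  assumes "Im t > 0" "(f has_field_derivative f') (at z within S)"
  shows "((\<lambda>z. theta (f z) t) has_field_derivative (deriv (\<lambda>u. theta u t) (f z) * f')) (at z within S)"
  by (rule DERIV_chain2 [OF holomorphic_derivI [OF holomorphic_theta [OF assms(1)]] assms(2)]) auto

lemma theta_0: "Im t > 0 \<Longrightarrow> theta 0 t = 0"
  using theta_minus [of t 0] by simp

text \<open>
  If the derivative vanished, differentiating the three-term relation in \<open>v\<close> at \<open>v = u\<close> would show that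
  the functions \<open>\<theta>(y + s) \<theta>(y - s)\<close> of \<open>s\<close> are proportional for all \<open>y\<close>.  The one with \<open>y = s0\<close>
  vanishes at \<open>s = s0\<close>, so all would; but for \<open>y = 0\<close> the value there is \<open>- \<theta>(s0)\<^sup>2\<close>.
\<close>

lemma deriv_theta_0_nonzero:
  assumes t: "Im t > 0"
  shows "deriv (\<lambda>u. theta u t) 0 \<noteq> 0"
proof
  assume d0: "deriv (\<lambda>u. theta u t) 0 = 0"
  obtain s0 where s0: "theta s0 t \<noteq> 0" using theta_not_identically_zero [OF t] by blast
  define f where "f = (\<lambda>s. theta (s0 + s) t * theta (s0 - s) t)"
  define g where "g = (\<lambda>y s. theta (y + s) t * theta (y - s) t)"
  have f: "f holomorphic_on UNIV" and g: "g y holomorphic_on UNIV" for y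
    unfolding f_def g_def using t by (auto intro!: holomorphic_intros)
  \<comment> \<open>the derivative in \<open>v\<close> of the three-term relation, at \<open>v = s\<close>\<close>
  have w: "f s * deriv (g y) s - deriv f s * g y s = 0 * f s * g y s" for y s
  proof -
    have 1: "((\<lambda>v. f s * g y v - f v * g y s) has_field_derivative
        (f s * deriv (g y) s - deriv f s * g y s)) (at s)"
      by (auto intro!: derivative_eq_intros holomorphic_derivI [OF f] holomorphic_derivI [OF g])
    have "((\<lambda>v. theta (s0 + y) t * theta (s0 - y) t * (theta (s + v) t * theta (s - v) t))
        has_field_derivative 0) (at s)"
      using t d0 by (auto intro!: derivative_eq_intros simp: theta_0)
    also have "(\<lambda>v. theta (s0 + y) t * theta (s0 - y) t * (theta (s + v) t * theta (s - v) t))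
       = (\<lambda>v. f s * g y v - f v * g y s)"
      unfolding f_def g_def using theta_three_term [OF t, of s0 y s] by (auto simp: mult_ac)
    finally show ?thesis using DERIV_unique [OF 1] by simp
  qed
  have f0: "f 0 \<noteq> 0" using s0 by (simp add: f_def)
  have "g y s0 = 0" for y
  proof -
    obtain K where K: "\<And>s. g y s = K * exp (0 * s) * f s"
      using proportional_to_exp_multiple [OF f g f0 w] by blast
    show ?thesis using K [of s0] by (simp add: f_def theta_0 [OF t])
  qed
  from this [of 0] show False using s0 theta_minus [OF t, of s0] by (simp add: g_def)
qed

text \<open>
  A zero \<open>c\<close> kills one term of a three-term relation.  The remaining two say that the quotient
  \<open>\<theta>(c - s) / \<theta>(s)\<close> has products \<open>h(s) h(t)\<close> depending on \<open>s + t\<close> only, so it is an exponential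
  \<open>K exp (\<kappa> s)\<close>.  Comparing the quasi-periods \<open>1\<close> and \<open>\<tau>\<close> of both sides determines \<open>\<kappa>\<close> and then \<open>c\<close>
  modulo the lattice; no counting of zeros is involved.
\<close>

lemma theta_eq_0_imp_lattice:
  assumes t: "Im t > 0" and c: "theta c t = 0"
  obtains m n :: int where "c = of_int m + of_int n * t"
proof -
  obtain s1 where s1: "theta s1 t \<noteq> 0" using theta_not_identically_zero [OF t] by blast
  obtain s0 where s0: "theta s0 t \<noteq> 0" "theta (c - s0) t \<noteq> 0"
  proof -
    have "\<forall>\<^sub>F s in at 0. theta s t \<noteq> 0 \<and> s \<in> UNIV"
      by (rule non_zero_neighbour_alt [of _ _ _ s1]) (use s1 t in \<open>auto intro!: holomorphic_intros\<close>)
    moreover have "\<forall>\<^sub>F s in at 0. theta (c - s) t \<noteq> 0 \<and> s \<in> UNIV"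
      by (rule non_zero_neighbour_alt [of _ _ _ "c - s1"]) (use s1 t in \<open>auto intro!: holomorphic_intros\<close>)
    ultimately have "\<forall>\<^sub>F s in at 0. theta s t \<noteq> 0 \<and> theta (c - s) t \<noteq> 0"
      by eventually_elim auto
    from eventually_happens' [OF _ this] show ?thesis using that by auto
  qed
  define f where "f = (\<lambda>s. theta s t)"
  define g where "g = (\<lambda>s. theta (c - s) t)"
  have f: "f holomorphic_on UNIV" and g: "g holomorphic_on UNIV"
    unfolding f_def g_def using t by (auto intro!: holomorphic_intros)
  have fg0: "f s0 \<noteq> 0" "g s0 \<noteq> 0" using s0 by (simp_all add: f_def g_def)
  \<comment> \<open>\<open>g / f\<close> turns sums into products\<close>
  have fe: "f s * f s0 * (g (s + u) * g (s0 - u)) = f (s + u) * f (s0 - u) * (g s * g s0)" for s u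
  proof -
    \<comment> \<open>chosen such that \<open>x + (c - x) = c\<close> is a zero and the other arguments are those of the claim\<close>
    define x where "x = (s + s0) / 2"
    have "0 = theta (x + (c - x)) t * theta (x - (c - x)) t * theta ((s - s0) / 2 + (s + 2 * u - s0) / 2) t * theta ((s - s0) / 2 - (s + 2 * u - s0) / 2) t"
      using c by simp
    also have "\<dots> = theta (x + (s - s0) / 2) t * theta (x - (s - s0) / 2) t * theta ((c - x) + (s + 2 * u - s0) / 2) t * theta ((c - x) - (s + 2 * u - s0) / 2) t
       - theta (x + (s + 2 * u - s0) / 2) t * theta (x - (s + 2 * u - s0) / 2) t * theta ((c - x) + (s - s0) / 2) t * theta ((c - x) - (s - s0) / 2) t"
      by (rule theta_three_term [OF t])
    also have "x + (s - s0) / 2 = s" by (simp add: x_def field_simps)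
    also have "x - (s - s0) / 2 = s0" by (simp add: x_def field_simps)
    also have "(c - x) + (s + 2 * u - s0) / 2 = c - (s0 - u)" by (simp add: x_def field_simps)
    also have "(c - x) - (s + 2 * u - s0) / 2 = c - (s + u)" by (simp add: x_def field_simps)
    also have "x + (s + 2 * u - s0) / 2 = s + u" by (simp add: x_def field_simps)
    also have "x - (s + 2 * u - s0) / 2 = s0 - u" by (simp add: x_def field_simps)
    also have "(c - x) + (s - s0) / 2 = c - s0" by (simp add: x_def field_simps)
    also have "(c - x) - (s - s0) / 2 = c - s" by (simp add: x_def field_simps)
    finally show ?thesis by (simp add: f_def g_def mult_ac)
  qed
  define \<kappa> where "\<kappa> = deriv g s0 / g s0 - deriv f s0 / f s0"
  have ode: "f s * deriv g s - deriv f s * g s = \<kappa> * f s * g s" for s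
  proof -
    have d: "((\<lambda>u. h (s + u)) has_field_derivative deriv h s) (at 0)"
      "((\<lambda>u. h (s - u)) has_field_derivative - deriv h s) (at 0)" if "h holomorphic_on UNIV" for h s
    proof -
      have h: "(h has_field_derivative deriv h s) (at s)"
        by (simp add: holomorphic_derivI [OF that])
      have "((\<lambda>u. s + u) has_field_derivative 1) (at 0)"
        by (auto intro!: derivative_eq_intros)
      thus "((\<lambda>u. h (s + u)) has_field_derivative deriv h s) (at 0)"
        using DERIV_chain2 [where f = h and g = "\<lambda>u. s + u" and Db = 1] h by fastforce
      have "((\<lambda>u. s - u) has_field_derivative - 1) (at 0)"
        by (auto intro!: derivative_eq_intros)
      thus "((\<lambda>u. h (s - u)) has_field_derivative - deriv h s) (at 0)"
        using DERIV_chain2 [where f = h and g = "\<lambda>u. s - u" and Db = "- 1"] h by fastforce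
    qed
    have "((\<lambda>u. f s * f s0 * (g (s + u) * g (s0 - u))) has_field_derivative
        f s * f s0 * (deriv g s * g s0 - g s * deriv g s0)) (at 0)"
      by (auto intro!: derivative_eq_intros d [OF g])
    moreover have "((\<lambda>u. f (s + u) * f (s0 - u) * (g s * g s0)) has_field_derivative
        (deriv f s * f s0 - f s * deriv f s0) * (g s * g s0)) (at 0)"
      by (auto intro!: derivative_eq_intros d [OF f])
    ultimately have "f s * f s0 * (deriv g s * g s0 - g s * deriv g s0)
        = (deriv f s * f s0 - f s * deriv f s0) * (g s * g s0)"
      unfolding fe by (rule DERIV_unique)
    thus ?thesis using fg0 unfolding \<kappa>_def by (simp add: field_simps)
  qed
  obtain K where K: "\<And>s. g s = K * exp (\<kappa> * s) * f s"
    using proportional_to_exp_multiple [OF f g fg0(1) ode] by blast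
  have "g (s0 + 1) = - g s0"
    using theta_add_1 [OF t, of "c - s0 - 1"] by (simp add: g_def algebra_simps)
  moreover have "g (s0 + 1) = - exp \<kappa> * g s0"
    unfolding K using theta_add_1 [OF t, of s0] by (simp add: f_def exp_add algebra_simps)
  ultimately have "exp \<kappa> = 1" using fg0 by simp
  then obtain n :: int where n: "\<kappa> = of_int (2 * n) * of_real pi * \<i>"
    using exp_eq [of \<kappa> 0] by auto
  have "g s0 = - exp (- \<i> * of_real pi * (2 * (c - (s0 + t)) + t)) * g (s0 + t)"
    using theta_add_tau [OF t, of "c - (s0 + t)"] by (simp add: g_def algebra_simps)
  moreover have "g (s0 + t) = - exp (\<kappa> * t) * exp (- \<i> * of_real pi * (2 * s0 + t)) * g s0"
    unfolding K using theta_add_tau [OF t, of s0] by (simp add: f_def exp_add algebra_simps)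
  ultimately have "exp (- \<i> * of_real pi * (2 * (c - (s0 + t)) + t)) * exp (\<kappa> * t) * exp (- \<i> * of_real pi * (2 * s0 + t)) = 1"
    using fg0 by (simp add: algebra_simps)
  hence "exp (\<kappa> * t - \<i> * of_real pi * 2 * c) = 1"
    unfolding mult_exp_exp by (simp add: algebra_simps)
  hence "exp (2 * of_real pi * \<i> * (of_int n * t - c)) = 1"
    by (simp add: n algebra_simps)
  hence "exp (2 * of_real pi * \<i> * (of_int n * t - c)) = exp 0" by simp
  then obtain m :: int where "2 * of_real pi * \<i> * (of_int n * t - c) = of_int (2 * m) * of_real pi * \<i>"
    unfolding exp_eq by auto
  hence "of_int n * t - c = of_int m" by simp
  hence "c = of_int (- m) + of_int n * t" by (simp add: algebra_simps)
  thus ?thesis by (rule that)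
qed

section \<open>Three-term relation and the star-triangle equation on the A diagram\<close>

lemma sum_supported_on_pair:
  fixes f :: "nat \<Rightarrow> complex"
  assumes "finite V" "u \<noteq> v" "\<And>b. b \<in> V \<Longrightarrow> f b \<noteq> 0 \<Longrightarrow> b = u \<or> b = v"
    and "u \<notin> V \<Longrightarrow> f u = 0" "v \<notin> V \<Longrightarrow> f v = 0"
  shows "sum f V = f u + f v"
proof -
  have "sum f V = sum f (V \<union> {u, v})"
    using assms by (intro sum.mono_neutral_left) auto
  also have "\<dots> = sum f {u, v}"
    using assms by (intro sum.mono_neutral_right) auto
  finally show ?thesis using assms(2) by simp
qed

text \<open>
  The properties of the bracket that make the restricted weights on the diagram with vertices
  \<open>1, \<dots>, N - 1\<close> satisfy the star-triangle equation.  The square root is an arbitrary choice of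
  roots: a sign change at a vertex would only rescale the basis of walks.
\<close>

locale sos_bracket =
  fixes br :: "complex \<Rightarrow> complex" and N :: nat and sq :: "complex \<Rightarrow> complex"
  assumes br_minus: "br (- z) = - br z"
    and three_term: "br (x + y) * br (x - y) * br (u + v) * br (u - v)
      = br (x + u) * br (x - u) * br (y + v) * br (y - v) - br (x + v) * br (x - v) * br (y + u) * br (y - u)"
    and br_reflect: "br (of_nat N - z) = br z"
    and br_nonzero: "0 < a \<Longrightarrow> a < N \<Longrightarrow> br (of_nat a) \<noteq> 0"
    and N_ge: "4 \<le> N"
    and sq_power2: "(sq z)\<^sup>2 = z"
begin

lemma br_0 [simp]: "br 0 = 0"
  using br_minus [of 0] by simp

lemma br_1 [simp]: "br 1 \<noteq> 0"
  using br_nonzero [of 1] N_ge by simp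

lemma sq_mult_self: "sq z * sq z = z"
  using sq_power2 [of z] by (simp add: power2_eq_square)

lemma sq_0 [simp]: "sq 0 = 0"
  using sq_mult_self [of 0] by simp

text \<open>
  The three-term relation with prescribed arguments.  The substitution is recovered from a wanted
  identity by halving sums and differences of its arguments.
\<close>

lemma three_term_args:
  assumes "x + y = a1" "x - y = a2" "u + v = a3" "u - v = a4"
    and "x + u = b1" "x - u = b2" "y + v = b3" "y - v = b4"
    and "x + v = c1" "x - v = c2" "y + u = c3" "y - u = c4"
  shows "br a1 * br a2 * br a3 * br a4 = br b1 * br b2 * br b3 * br b4 - br c1 * br c2 * br c3 * br c4"
  using three_term [of x y u v] unfolding assms .

text \<open>
  This and the next two identities are the entries of the Yang--Baxter equation on walks from \<open>b - 1\<close>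
  to \<open>b\<close>, cleared of denominators.
\<close>

lemma identity_11:
  "br (b + x) * br (b + y) * br 1 * br (1 - (x + y)) + br (b + 1) * br x * br y * br (b - 1 + (x + y))
   = br (b + (x + y)) * br b * br (1 - x) * br (1 - y)"
proof -
  let ?z = "x + y"
  have "br (b + x) * br (b + y) * br 1 * br (1 - ?z)
      = br (b + 1) * br (b - 1 + ?z) * br x * br (- y) - br (b + ?z) * br b * br (1 - y) * br (- (1 - x))"
    by (rule three_term_args [where x = "b + ?z / 2" and y = "(x - y) / 2" and u = "1 - ?z / 2" and v = "?z / 2"])
      (simp_all add: field_simps)
  thus ?thesis unfolding br_minus by (simp add: algebra_simps)
qed

lemma identity_12:
  "br (b + x) * br y * br (b - 1) * br (1 - (x + y)) + br x * br (b - 1 + (x + y)) * br (b - y) * br 1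
   = br (x + y) * br (b - 1 + x) * br b * br (1 - y)"
proof -
  have "br (b + x) * br (b - 1) * br (1 - (x + y)) * br y
      = br b * br (b - 1 + x) * br (1 - y) * br (x + y) - br (b - y) * br (b - 1 + (x + y)) * br 1 * br x"
    by (rule three_term_args [where x = "b + (x - 1) / 2" and y = "(x + 1) / 2" and u = "(1 - x) / 2" and v = "(1 - x) / 2 - y"])
      (simp_all add: field_simps)
  thus ?thesis by (simp add: algebra_simps)
qed

text \<open>
  The terms containing \<open>[x] [y] [1 - (x + y)]\<close> combine to \<open>[2 b - 1] [1]\<^sup>3\<close> by one three-term relation, and
  the remaining identity is a second one.
\<close>

lemma identity_22:
  "br (b - 1) ^ 3 * br (b + 1) * br x * br y * br (1 - (x + y))
     + br (b - x) * br (b - y) * br (b - 1 + (x + y)) * br (b - 1) * br 1 ^ 3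
   = br (b - 1 + x) * br (b - 1 + y) * br (b - (x + y)) * br b * br 1 ^ 3
     + br (b - 2) * br b ^ 3 * br x * br y * br (1 - (x + y))"
proof -
  let ?z = "x + y"
  have "br (b + 1) * br (b - 1) * br (b - 1) * br (b - 1)
      = br (2 * b - 1) * br 1 * br 1 * br 1 - br b * br b * br b * br (- (b - 2))"
    using three_term [of b 1 "b - 1" 0] by (simp add: field_simps)
  hence 1: "br (b - 1) ^ 3 * br (b + 1) = br (2 * b - 1) * br 1 ^ 3 + br (b - 2) * br b ^ 3"
    unfolding br_minus by (simp add: power3_eq_cube algebra_simps)
  have "br (b - 1 + x) * br (b - 1 + y) * br b * br (b - ?z)
      = br (2 * b - 1) * br (- (1 - ?z)) * br x * br (- y) - br (b - 1 + ?z) * br (b - 1) * br (b - y) * br (- (b - x))"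
    by (rule three_term_args [where x = "b - 1 + ?z / 2" and y = "(x - y) / 2" and u = "b - ?z / 2" and v = "?z / 2"])
      (simp_all add: field_simps)
  hence 2: "br (b - 1 + x) * br (b - 1 + y) * br b * br (b - ?z)
      = br (2 * b - 1) * br (1 - ?z) * br x * br y + br (b - 1 + ?z) * br (b - 1) * br (b - y) * br (b - x)"
    unfolding br_minus by simp
  have "br (b - 1 + x) * br (b - 1 + y) * br (b - ?z) * br b * br 1 ^ 3
      = (br (b - 1 + x) * br (b - 1 + y) * br b * br (b - ?z)) * br 1 ^ 3" by simp
  thus ?thesis unfolding 1 2 by (simp add: algebra_simps)
qed

text \<open>
  The determinant of the two by two block at \<open>a\<close>, which turns out not to depend on \<open>a\<close> after division
  by \<open>[a]\<^sup>2\<close>.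
\<close>

lemma determinant_identity:
  "br (a + z) * br (a - z) * br 1 ^ 2 - br (a - 1) * br (a + 1) * br z ^ 2 = br a ^ 2 * br (1 + z) * br (1 - z)"
proof -
  have "br (a + z) * br (a - z) * br 1 * br 1 = br (a + 1) * br (a - 1) * br z * br z - br a * br a * br (z + 1) * br (- (1 - z))"
    using three_term [of a z 1 0] by simp
  thus ?thesis unfolding br_minus by (simp add: power2_eq_square algebra_simps)
qed

definition diag_up :: "complex \<Rightarrow> complex \<Rightarrow> complex" where
  "diag_up z a = br (a + z) * br 1 / (br a * br (1 - z))"

definition diag_down :: "complex \<Rightarrow> complex \<Rightarrow> complex" where
  "diag_down z a = br (a - z) * br 1 / (br a * br (1 - z))"

definition off_diag :: "complex \<Rightarrow> complex \<Rightarrow> complex" where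
  "off_diag z a = sq (br (a - 1) * br (a + 1)) * br z / (br a * br (1 - z))"

text \<open>
  The coefficient of the walk \<open>a, b', c\<close> in the image of the walk \<open>a, b, c\<close> under the A operator, extended
  by zero to vertices that do not form walks, so that sums may range over all vertices.
\<close>

definition weight :: "complex \<Rightarrow> nat \<Rightarrow> nat \<Rightarrow> nat \<Rightarrow> nat \<Rightarrow> complex" where
  "weight z a b' b c =
     (if c = a then
        if b' = b then
          if b = Suc a then diag_up z (of_nat a) else if a = Suc b then diag_down z (of_nat a) else 0
        else if (b = Suc a \<and> a = Suc b') \<or> (a = Suc b \<and> b' = Suc a) then off_diag z (of_nat a) else 0
      else if b' = b \<and> ((b = Suc a \<and> c = Suc b) \<or> (a = Suc b \<and> b = Suc c)) then 1 else 0)"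

lemma off_diag_mult:
  "off_diag x a * off_diag y a = br (a - 1) * br (a + 1) * br x * br y / (br a * br (1 - x) * (br a * br (1 - y)))"
proof -
  have "off_diag x a * off_diag y a = (sq (br (a - 1) * br (a + 1)) * sq (br (a - 1) * br (a + 1))) * br x * br y / (br a * br (1 - x) * (br a * br (1 - y)))"
    by (simp add: off_diag_def)
  thus ?thesis by (simp add: sq_mult_self)
qed

context
  fixes x y b :: complex
  assumes nz: "br (1 - x) \<noteq> 0" "br (1 - y) \<noteq> 0" "br (1 - (x + y)) \<noteq> 0" "br b \<noteq> 0" "br (b - 1) \<noteq> 0"
begin

text \<open>
  The walks of length three from \<open>a = b - 1\<close> to \<open>b\<close> have inner vertices \<open>(a + 1, a + 2)\<close>, \<open>(a + 1, a)\<close>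
  or \<open>(a - 1, a)\<close>, in this order.  In this basis the operator on the last two steps is the block at \<open>b\<close>
  followed by \<open>1\<close>, and the operator on the first two steps is \<open>1\<close> followed by the block at \<open>a\<close>.  The lemmas
  \<open>entry_ij\<close> are the entries of the Yang--Baxter equation.
\<close>

lemma entry_11:
  "diag_up x b * diag_up y b + off_diag x b * diag_up (x + y) (b - 1) * off_diag y b = diag_up (x + y) b"
proof -
  have "diag_up x b * diag_up y b + off_diag x b * off_diag y b * diag_up (x + y) (b - 1)
    = (br (b + x) * br (b + y) * br 1 * br (1 - (x + y)) + br (b + 1) * br x * br y * br (b - 1 + (x + y)))
      * br 1 / (br b ^ 2 * br (1 - x) * br (1 - y) * br (1 - (x + y)))"
    unfolding off_diag_mult diag_up_def using nz by (simp add: divide_simps) (simp add: algebra_simps power2_eq_square)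
  also have "\<dots> = diag_up (x + y) b"
    unfolding identity_11 diag_up_def using nz by (simp add: divide_simps power2_eq_square)
  finally show ?thesis by (simp add: mult_ac)
qed

lemma entry_12:
  "diag_up x b * off_diag y b + off_diag x b * diag_up (x + y) (b - 1) * diag_down y b
   = off_diag (x + y) b * diag_up x (b - 1)"
proof -
  let ?s = "sq (br (b - 1) * br (b + 1))"
  have "diag_up x b * off_diag y b + off_diag x b * diag_up (x + y) (b - 1) * diag_down y b
    = (br (b + x) * br y * br (b - 1) * br (1 - (x + y)) + br x * br (b - 1 + (x + y)) * br (b - y) * br 1)
      * (?s * br 1 / (br b ^ 2 * br (b - 1) * br (1 - x) * br (1 - y) * br (1 - (x + y))))"
    unfolding diag_up_def diag_down_def off_diag_def using nz 
    by (simp add: divide_simps) (simp add: algebra_simps power2_eq_square)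
  also have "\<dots> = off_diag (x + y) b * diag_up x (b - 1)"
    unfolding identity_12 diag_up_def off_diag_def using nz by (simp add: divide_simps power2_eq_square)
  finally show ?thesis .
qed

lemma entry_22:
  "off_diag x b * off_diag y b + diag_down x b * diag_up (x + y) (b - 1) * diag_down y b
   = diag_up y (b - 1) * diag_down (x + y) b * diag_up x (b - 1) + off_diag y (b - 1) * off_diag x (b - 1)"
proof -
  let ?D = "br b ^ 3 * br (b - 1) ^ 3 * br (1 - x) * br (1 - y) * br (1 - (x + y))"
  have bb: "b - 1 - 1 = b - 2" "b - 1 + 1 = b" by auto
  have "off_diag x b * off_diag y b + diag_down x b * diag_up (x + y) (b - 1) * diag_down y b
    = (br (b - 1) ^ 3 * br (b + 1) * br x * br y * br (1 - (x + y))
     + br (b - x) * br (b - y) * br (b - 1 + (x + y)) * br (b - 1) * br 1 ^ 3) * br b * br (b - 1) / ?D"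
    unfolding diag_up_def diag_down_def off_diag_mult using nz 
    by (simp add: divide_simps) (simp add: algebra_simps power2_eq_square power3_eq_cube)
  moreover have "diag_up y (b - 1) * diag_down (x + y) b * diag_up x (b - 1) + off_diag y (b - 1) * off_diag x (b - 1)
    = (br (b - 1 + x) * br (b - 1 + y) * br (b - (x + y)) * br b * br 1 ^ 3
     + br (b - 2) * br b ^ 3 * br x * br y * br (1 - (x + y))) * br b * br (b - 1) / ?D"
    unfolding diag_up_def diag_down_def off_diag_mult bb using nz 
    by (simp add: divide_simps) (simp add: algebra_simps power2_eq_square power3_eq_cube)
  ultimately show ?thesis unfolding identity_22 by simp
qed

end

lemma diag_up_minus: "diag_up z (- a) = diag_down z a"
  using br_minus [of "a - z"] by (simp add: diag_up_def diag_down_def br_minus)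

lemma diag_down_minus: "diag_down z (- a) = diag_up z a"
  using diag_up_minus [of z "- a"] by simp

lemma off_diag_minus: "off_diag z (- a) = - off_diag z a"
proof -
  have "br (- a - 1) * br (- a + 1) = br (a - 1) * br (a + 1)"
    using br_minus [of "a + 1"] br_minus [of "a - 1"] by simp
  thus ?thesis by (simp add: off_diag_def br_minus)
qed

context
  fixes x y :: complex
  assumes nz: "br (1 - x) \<noteq> 0" "br (1 - y) \<noteq> 0" "br (1 - (x + y)) \<noteq> 0"
begin

text \<open>
  Negating the vertex exchanges up and down, so the entries in the lower right corner follow from
  those in the upper left corner at \<open>b = - a\<close>.
\<close>

lemma entry_33:
  assumes "br a \<noteq> 0" "br (a + 1) \<noteq> 0"
  shows "off_diag y a * diag_down (x + y) (a + 1) * off_diag x a + diag_down y a * diag_down x a = diag_down (x + y) a"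
proof -
  have "br (- a - 1) \<noteq> 0" using assms br_minus [of "a + 1"] by simp
  hence "diag_up x (- a) * diag_up y (- a) + off_diag x (- a) * diag_up (x + y) (- (a + 1)) * off_diag y (- a)
    = diag_up (x + y) (- a)"
    using entry_11 [of x y "- a"] nz assms by (simp add: br_minus)
  thus ?thesis unfolding diag_up_minus off_diag_minus by (simp add: mult_ac add_ac)
qed

lemma entry_23:
  assumes "br a \<noteq> 0" "br (a + 1) \<noteq> 0"
  shows "diag_down x a * off_diag y a + off_diag x a * diag_down (x + y) (a + 1) * diag_up y a
   = off_diag (x + y) a * diag_down x (a + 1)"
proof -
  have "br (- a - 1) \<noteq> 0" using assms br_minus [of "a + 1"] by simp
  hence "diag_up x (- a) * off_diag y (- a) + off_diag x (- a) * diag_up (x + y) (- (a + 1)) * diag_down y (- a)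
    = off_diag (x + y) (- a) * diag_up x (- (a + 1))"
    using entry_12 [of x y "- a"] nz assms by (simp add: br_minus)
  hence "- (diag_down x a * off_diag y a + off_diag x a * diag_down (x + y) (a + 1) * diag_up y a)
   = - (off_diag (x + y) a * diag_down x (a + 1))"
    unfolding diag_up_minus off_diag_minus diag_down_minus by simp
  thus ?thesis by (rule neg_equal_iff_equal [THEN iffD1])
qed

end

lemma entry_13: "off_diag x a * off_diag y b = off_diag y a * off_diag x b"
  by (simp add: off_diag_def mult_ac)

definition adj :: "nat \<Rightarrow> nat \<Rightarrow> bool" where
  "adj a b \<longleftrightarrow> b = Suc a \<or> a = Suc b"

lemma weight_adj: "weight z a b' b c \<noteq> 0 \<Longrightarrow> adj a b \<and> adj b c \<and> adj a b' \<and> adj b' c"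
  by (auto simp: weight_def adj_def split: if_splits)

text \<open>
  The reflection of the diagram exchanges up and down steps and the diagonal weights with them; the
  product under the square root is unchanged.
\<close>

lemma weight_reflect:
  assumes "a + a' = N" "b + b' = N" "c + c' = N" "d + d' = N"
  shows "weight z a' d' b' c' = weight z a d b c"
proof -
  have N: "of_nat a' = (of_nat N - of_nat a :: complex)"
    using assms(1) by (simp flip: assms(1))
  have "diag_up z (of_nat a') = diag_down z (of_nat a)"
    using br_reflect [of "of_nat a - z"] br_reflect [of "of_nat a"] unfolding N diag_up_def diag_down_def
    by (simp add: algebra_simps)
  moreover have "diag_down z (of_nat a') = diag_up z (of_nat a)"
    using br_reflect [of "of_nat a + z"] br_reflect [of "of_nat a"] unfolding N diag_up_def diag_down_def
    by (simp add: algebra_simps)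
  moreover have "off_diag z (of_nat a') = off_diag z (of_nat a)"
    using br_reflect [of "of_nat a + 1"] br_reflect [of "of_nat a - 1"] br_reflect [of "of_nat a"] unfolding N off_diag_def
    by (simp add: algebra_simps)
  moreover have "c' = a' \<longleftrightarrow> c = a" "d' = b' \<longleftrightarrow> d = b" "b' = Suc a' \<longleftrightarrow> a = Suc b" "a' = Suc b' \<longleftrightarrow> b = Suc a"
    "a' = Suc d' \<longleftrightarrow> d = Suc a" "d' = Suc a' \<longleftrightarrow> a = Suc d" "c' = Suc b' \<longleftrightarrow> b = Suc c" "b' = Suc c' \<longleftrightarrow> c = Suc b"
    using assms by auto
  ultimately show ?thesis unfolding weight_def by auto
qed

abbreviation "V \<equiv> {1..<N}"

text \<open>
  The weights for leaving the diagram at its ends vanish.  This is why the sums over the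
  vertices of the restricted model have all the terms that the three by three computation needs.
\<close>

lemma off_diag_boundary: "off_diag z 1 = 0" "off_diag z (of_nat (N - 1)) = 0"
proof -
  show "off_diag z 1 = 0" by (simp add: off_diag_def)
  have "of_nat (N - 1) + (1::complex) = of_nat N" using N_ge by (simp add: of_nat_diff)
  thus "off_diag z (of_nat (N - 1)) = 0"
    using br_reflect [of 0] by (simp add: off_diag_def)
qed

text \<open>
  Walks of total displacement three are unique and fixed.  For displacement one, each side is a sum
  over two middle vertices, and the nine combinations of initial and final walk are the nine entries.
\<close>

lemma star_triangle_up:
  assumes nz: "br (1 - x) \<noteq> 0" "br (1 - y) \<noteq> 0" "br (1 - (x + y)) \<noteq> 0"
    and V: "a0 \<in> V" "a1 \<in> V" "a2 \<in> V" "a3 \<in> V" "a1' \<in> V" "a2' \<in> V"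
    and adj: "adj a0 a1" "adj a1 a2" "adj a2 a3" "adj a0 a1'" "adj a1' a2'" "adj a2' a3"
    and up: "a0 < a3"
  shows "(\<Sum>b\<in>V. weight x a1' a2' b a3 * weight (x + y) a0 a1' a1 b * weight y a1 b a2 a3)
       = (\<Sum>b\<in>V. weight y a0 a1' b a2' * weight (x + y) b a2' a2 a3 * weight x a0 b a1 a2)"
    (is "sum ?f V = sum ?g V")
proof -
  have fV: "finite V" by simp
  consider "a3 = a0 + 3" | "a3 = Suc a0" using adj up unfolding adj_def by linarith
  thus ?thesis
  proof cases
    case 1
    hence e: "a1 = Suc a0" "a2 = Suc (Suc a0)" "a3 = Suc (Suc (Suc a0))" "a1' = Suc a0" "a2' = Suc (Suc a0)"
      using adj unfolding adj_def by auto
    have "sum ?f V = ?f (Suc (Suc a0)) + ?f a0"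
      by (rule sum_supported_on_pair [OF fV]) (use V in \<open>auto simp: e weight_def split: if_splits\<close>)
    moreover have "sum ?g V = ?g (Suc a0) + ?g a0"
      by (rule sum_supported_on_pair [OF fV]) (use V in \<open>auto simp: e weight_def split: if_splits\<close>)
    ultimately show ?thesis by (simp add: e weight_def)
  next
    case 2
    then obtain k where k: "a0 = Suc k" "a3 = Suc (Suc k)"
      using V by (cases a0) auto
    define A B :: complex where "A = of_nat (Suc k)" and "B = of_nat (Suc (Suc k))"
    have AB: "B - 1 = A" "A + 1 = B" by (simp_all add: A_def B_def)
    have nzA: "br A \<noteq> 0" "br B \<noteq> 0"
      unfolding A_def B_def by (rule br_nonzero; use V k in simp)+
    have "sum ?f V = ?f (Suc (Suc (Suc k))) + ?f (Suc k)"
    proof (rule sum_supported_on_pair [OF fV])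
      fix b assume "?f b \<noteq> 0"
      hence "adj b a3" using weight_adj by fastforce
      thus "b = Suc (Suc (Suc k)) \<or> b = Suc k" unfolding adj_def k by auto
    next
      assume "Suc (Suc (Suc k)) \<notin> V"
      hence N: "N = Suc (Suc (Suc k))" using V k by auto
      show "?f (Suc (Suc (Suc k))) = 0"
        using V(3) off_diag_boundary(2) [of y] by (auto simp: N weight_def k)
    qed (use V k in auto)
    moreover have "sum ?g V = ?g (Suc (Suc k)) + ?g k"
    proof (rule sum_supported_on_pair [OF fV])
      fix b assume "?g b \<noteq> 0"
      hence "adj a0 b" using weight_adj by fastforce
      thus "b = Suc (Suc k) \<or> b = k" unfolding adj_def k by auto
    next
      assume "k \<notin> V"
      hence "k = 0" using V k by auto
      thus "?g k = 0"
        using V(2) off_diag_boundary(1) [of x] by (auto simp: weight_def k)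
    qed (use V k in auto)
    moreover have "?f (Suc (Suc (Suc k))) + ?f (Suc k) = ?g (Suc (Suc k)) + ?g k"
    proof -
      note w = weight_def k A_def [symmetric] B_def [symmetric] 
      have s: "a1 = Suc (Suc k) \<and> a2 = Suc (Suc (Suc k)) \<or> a1 = Suc (Suc k) \<and> a2 = Suc k \<or> a1 = k \<and> a2 = Suc k"
        using adj(1-3) unfolding adj_def k by auto
      have s': "a1' = Suc (Suc k) \<and> a2' = Suc (Suc (Suc k)) \<or> a1' = Suc (Suc k) \<and> a2' = Suc k \<or> a1' = k \<and> a2' = Suc k"
        using adj(4-6) unfolding adj_def k by auto
      have nz': "br (1 - (y + x)) \<noteq> 0" using nz by (simp add: add.commute)
      have yx: "y + x = x + y" by simp
      note E11 = entry_11 [OF nz, of B, unfolded AB, OF nzA(2,1)]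
      note E12 = entry_12 [OF nz, of B, unfolded AB, OF nzA(2,1)]
      note E21 = entry_12 [OF nz(2,1) nz', of B, unfolded AB yx, OF nzA(2,1)]
      note E22 = entry_22 [OF nz, of B, unfolded AB, OF nzA(2,1)]
      note E33 = entry_33 [OF nz, of A, unfolded AB, OF nzA]
      note E23 = entry_23 [OF nz, of A, unfolded AB, OF nzA]
      note E32 = entry_23 [OF nz(2,1) nz', of A, unfolded AB yx, OF nzA]
      have c11: ?thesis if "a1' = Suc (Suc k) \<and> a2' = Suc (Suc (Suc k))" "a1 = Suc (Suc k) \<and> a2 = Suc (Suc (Suc k))"
        using that E11 by (simp add: w mult_ac add_ac del: of_nat_Suc)
      have c12: ?thesis if "a1' = Suc (Suc k) \<and> a2' = Suc (Suc (Suc k))" "a1 = Suc (Suc k) \<and> a2 = Suc k"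
        using that E12 by (simp add: w mult_ac add_ac del: of_nat_Suc)
      have c13: ?thesis if "a1' = Suc (Suc k) \<and> a2' = Suc (Suc (Suc k))" "a1 = k \<and> a2 = Suc k"
        using that entry_13 by (simp add: w mult_ac add_ac del: of_nat_Suc)
      have c21: ?thesis if "a1' = Suc (Suc k) \<and> a2' = Suc k" "a1 = Suc (Suc k) \<and> a2 = Suc (Suc (Suc k))"
        using that E21 by (simp add: w mult_ac add_ac del: of_nat_Suc)
      have c22: ?thesis if "a1' = Suc (Suc k) \<and> a2' = Suc k" "a1 = Suc (Suc k) \<and> a2 = Suc k"
        using that E22 by (simp add: w mult_ac add_ac del: of_nat_Suc)
      have c23: ?thesis if "a1' = Suc (Suc k) \<and> a2' = Suc k" "a1 = k \<and> a2 = Suc k"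
        using that E23 by (simp add: w mult_ac add_ac del: of_nat_Suc)
      have c31: ?thesis if "a1' = k \<and> a2' = Suc k" "a1 = Suc (Suc k) \<and> a2 = Suc (Suc (Suc k))"
        using that entry_13 by (simp add: w mult_ac add_ac del: of_nat_Suc)
      have c32: ?thesis if "a1' = k \<and> a2' = Suc k" "a1 = Suc (Suc k) \<and> a2 = Suc k"
        using that E32 by (simp add: w mult_ac add_ac del: of_nat_Suc)
      have c33: ?thesis if "a1' = k \<and> a2' = Suc k" "a1 = k \<and> a2 = Suc k"
        using that E33 by (simp add: w mult_ac add_ac del: of_nat_Suc)
      show ?thesis
        using s s' c11 c12 c13 c21 c22 c23 c31 c32 c33 by argo
    qed
    ultimately show ?thesis by simp
  qed
qed

lemma sum_reflect: "(\<Sum>b\<in>V. f b) = (\<Sum>b\<in>V. f (N - b))" for f :: "nat \<Rightarrow> complex"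
  by (rule sum.reindex_bij_witness [of _ "\<lambda>b. N - b" "\<lambda>b. N - b"]) auto

lemma weight_reflect':
  "\<lbrakk>a \<in> V; d \<in> V; b \<in> V; c \<in> V\<rbrakk> \<Longrightarrow> weight z (N - a) (N - d) (N - b) (N - c) = weight z a d b c"
  by (rule weight_reflect) auto

proposition star_triangle:
  assumes nz: "br (1 - x) \<noteq> 0" "br (1 - y) \<noteq> 0" "br (1 - (x + y)) \<noteq> 0"
    and V: "a0 \<in> V" "a1 \<in> V" "a2 \<in> V" "a3 \<in> V" "a1' \<in> V" "a2' \<in> V"
  shows "(\<Sum>b\<in>V. weight x a1' a2' b a3 * weight (x + y) a0 a1' a1 b * weight y a1 b a2 a3)
       = (\<Sum>b\<in>V. weight y a0 a1' b a2' * weight (x + y) b a2' a2 a3 * weight x a0 b a1 a2)"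
    (is "sum ?f V = sum ?g V")
proof (cases "adj a0 a1 \<and> adj a1 a2 \<and> adj a2 a3 \<and> adj a0 a1' \<and> adj a1' a2' \<and> adj a2' a3")
  case False
  have "?f b = 0" for b
    using False weight_adj [of x a1' a2' b a3] weight_adj [of "x + y" a0 a1' a1 b] weight_adj [of y a1 b a2 a3]
    by force
  hence "sum ?f V = 0" by (intro sum.neutral) blast
  have "?g b = 0" for b
    using False weight_adj [of y a0 a1' b a2'] weight_adj [of "x + y" b a2' a2 a3] weight_adj [of x a0 b a1 a2]
    by force
  hence "sum ?g V = 0" by (intro sum.neutral) blast
  with \<open>sum ?f V = 0\<close> show ?thesis by (rule trans [OF _ sym])
next
  case True
  hence "a0 < a3 \<or> a3 < a0" unfolding adj_def by linarith
  thus ?thesis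
  proof
    assume "a0 < a3"
    thus ?thesis using star_triangle_up [OF nz V] True by blast
  next
    assume down: "a3 < a0"
    have "adj (N - a) (N - b)" if "adj a b" "a \<in> V" "b \<in> V" for a b
      using that by (auto simp: adj_def)
    hence "(\<Sum>b\<in>V. weight x (N - a1') (N - a2') b (N - a3) * weight (x + y) (N - a0) (N - a1') (N - a1) b * weight y (N - a1) b (N - a2) (N - a3))
       = (\<Sum>b\<in>V. weight y (N - a0) (N - a1') b (N - a2') * weight (x + y) b (N - a2') (N - a2) (N - a3) * weight x (N - a0) b (N - a1) (N - a2))"
      using True V down by (intro star_triangle_up [OF nz]) auto
    moreover have "(\<Sum>b\<in>V. weight x (N - a1') (N - a2') b (N - a3) * weight (x + y) (N - a0) (N - a1') (N - a1) b * weight y (N - a1) b (N - a2) (N - a3))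
       = sum ?f V"
      by (subst sum_reflect) (use V in \<open>simp add: weight_reflect'\<close>)
    moreover have "(\<Sum>b\<in>V. weight y (N - a0) (N - a1') b (N - a2') * weight (x + y) b (N - a2') (N - a2) (N - a3) * weight x (N - a0) b (N - a1) (N - a2))
       = sum ?g V"
      by (subst sum_reflect) (use V in \<open>simp add: weight_reflect'\<close>)
    ultimately show ?thesis by simp
  qed
qed

proposition weight_unitary:
  assumes nz: "br (1 - z) \<noteq> 0" "br (1 + z) \<noteq> 0"
    and V: "a \<in> V" "b' \<in> V" "b \<in> V" "c \<in> V"
  shows "(\<Sum>d\<in>V. weight z a b' d c * weight (- z) a d b c) = (if b = b' \<and> adj a b \<and> adj b c then 1 else 0)"
    (is "sum ?f V = _")
proof (cases "adj a b' \<and> adj b' c \<and> adj a b \<and> adj b c")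
  case False
  have "?f d = 0" for d
    using False weight_adj [of z a b' d c] weight_adj [of "- z" a d b c] by force
  hence "sum ?f V = 0" by (intro sum.neutral) blast
  thus ?thesis using False by argo
next
  case True
  have fV: "finite V" by simp
  show ?thesis
  proof (cases "a = c")
    case False
    hence e: "b' = b" "Suc a = b \<and> Suc b = c \<or> a = Suc b \<and> b = Suc c"
      using True by (auto simp: adj_def)
    have "?f d = (if d = b then 1 else 0)" for d
      using e False by (auto simp: weight_def)
    thus ?thesis using V True e by simp
  next
    case ac: True
    obtain k where k: "a = Suc k" using V by (cases a) auto
    define A :: complex where "A = of_nat (Suc k)"
    have nzA: "br A \<noteq> 0"
      unfolding A_def by (rule br_nonzero; use V k in simp)
    have D: "br (A + z) * br (A - z) * br 1 ^ 2 - br (A - 1) * br (A + 1) * br z ^ 2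
        = br A ^ 2 * br (1 + z) * br (1 - z)" by (rule determinant_identity)
    have o: "off_diag z A * off_diag (- z) A = - (br (A - 1) * br (A + 1) * br z ^ 2) / (br A ^ 2 * br (1 + z) * br (1 - z))"
      unfolding off_diag_mult br_minus by (simp add: power2_eq_square mult_ac)
    have d1: "diag_up z A * diag_up (- z) A = br (A + z) * br (A - z) * br 1 ^ 2 / (br A ^ 2 * br (1 + z) * br (1 - z))"
      unfolding diag_up_def by (simp add: power2_eq_square mult_ac)
    have d2: "diag_down z A * diag_down (- z) A = br (A + z) * br (A - z) * br 1 ^ 2 / (br A ^ 2 * br (1 + z) * br (1 - z))"
      unfolding diag_down_def by (simp add: power2_eq_square mult_ac)
    have u1: "diag_up z A * diag_up (- z) A + off_diag z A * off_diag (- z) A = 1"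
      unfolding d1 o using D nz nzA by (simp add: field_simps)
    have u2: "diag_down z A * diag_down (- z) A + off_diag z A * off_diag (- z) A = 1"
      unfolding d2 o using D nz nzA by (simp add: field_simps)
    have u3: "diag_up z A * off_diag (- z) A + off_diag z A * diag_down (- z) A = 0"
      unfolding diag_up_def diag_down_def off_diag_def br_minus by (simp add: mult_ac)
    have u4: "diag_down z A * off_diag (- z) A + off_diag z A * diag_up (- z) A = 0"
      unfolding diag_up_def diag_down_def off_diag_def br_minus by (simp add: mult_ac)
    have "sum ?f V = ?f (Suc (Suc k)) + ?f k"
    proof (rule sum_supported_on_pair [OF fV])
      fix d assume "?f d \<noteq> 0"
      hence "adj a d" using weight_adj by fastforce
      thus "d = Suc (Suc k) \<or> d = k" unfolding adj_def k by auto
    next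
      assume "Suc (Suc k) \<notin> V"
      hence N: "N = Suc (Suc k)" using V k by auto
      show "?f (Suc (Suc k)) = 0"
        using V off_diag_boundary(2) [of z] by (auto simp: N weight_def k)
    next
      assume "k \<notin> V"
      hence "k = 0" using V k by auto
      thus "?f k = 0"
        using V off_diag_boundary(1) [of z] by (auto simp: weight_def k)
    qed auto
    also have "\<dots> = (if b = b' \<and> adj a b \<and> adj b c then 1 else 0)"
    proof -
      have "b = Suc (Suc k) \<or> b = k" "b' = Suc (Suc k) \<or> b' = k"
        using True unfolding adj_def k by auto
      thus ?thesis using u1 u2 u3 u4
        by (elim disjE) (simp_all add: weight_def adj_def k ac [symmetric] A_def [symmetric] add_ac mult_ac del: of_nat_Suc)
    qed
    finally show ?thesis .
  qed
qed

end

section \<open>Faces, cells and the transport of identities along an intertwiner\<close>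

definition mat_comp :: "'k set \<Rightarrow> ('i \<Rightarrow> 'k \<Rightarrow> complex) \<Rightarrow> ('k \<Rightarrow> 'j \<Rightarrow> complex) \<Rightarrow> 'i \<Rightarrow> 'j \<Rightarrow> complex" where
  "mat_comp B M N = (\<lambda>i j. \<Sum>k\<in>B. M i k * N k j)"

lemma mat_comp_assoc: "mat_comp B (mat_comp A M N) K = mat_comp A M (mat_comp B N K)"
  unfolding mat_comp_def sum_distrib_left sum_distrib_right
  by (subst sum.swap) (simp add: mult_ac)

lemma mat_comp_cong:
  "\<lbrakk>\<And>k. k \<in> B \<Longrightarrow> M i k = M' i k; \<And>k. k \<in> B \<Longrightarrow> N k j = N' k j\<rbrakk> \<Longrightarrow> mat_comp B M N i j = mat_comp B M' N' i j"
  unfolding mat_comp_def by (intro sum.cong) auto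

text \<open>
  \<open>M W = W M'\<close> as matrices with rows in \<open>A\<close> and columns in \<open>D\<close>.
\<close>

definition intertwines :: "'a set \<Rightarrow> 'd set \<Rightarrow> ('a \<Rightarrow> 'd \<Rightarrow> complex) \<Rightarrow> ('a \<Rightarrow> 'a \<Rightarrow> complex) \<Rightarrow> ('d \<Rightarrow> 'd \<Rightarrow> complex) \<Rightarrow> bool" where
  "intertwines A D W M M' \<longleftrightarrow> (\<forall>i\<in>A. \<forall>j\<in>D. mat_comp A M W i j = mat_comp D W M' i j)"

lemma intertwines_comp:
  assumes "intertwines A D W M M'" "intertwines A D W N N'"
  shows "intertwines A D W (mat_comp A M N) (mat_comp D M' N')"
  unfolding intertwines_def
proof (intro ballI)
  fix i j assume ij: "i \<in> A" "j \<in> D"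
  have "mat_comp A (mat_comp A M N) W i j = mat_comp A M (mat_comp A N W) i j"
    by (simp add: mat_comp_assoc)
  also have "\<dots> = mat_comp A M (mat_comp D W N') i j"
    using assms(2) ij by (intro mat_comp_cong) (auto simp: intertwines_def)
  also have "\<dots> = mat_comp D (mat_comp A M W) N' i j"
    by (simp add: mat_comp_assoc)
  also have "\<dots> = mat_comp D (mat_comp D W M') N' i j"
    using assms(1) ij by (intro mat_comp_cong) (auto simp: intertwines_def)
  also have "\<dots> = mat_comp D W (mat_comp D M' N') i j"
    by (simp add: mat_comp_assoc)
  finally show "mat_comp A (mat_comp A M N) W i j = mat_comp D W (mat_comp D M' N') i j" .
qed

text \<open>
  An equality of intertwined operators descends along \<open>W\<close> if the family \<open>W x\<close>, stacked over all \<open>x\<close>, has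
  orthonormal columns: then its transpose is a left inverse.  Orthonormality is only required for
  the indices in \<open>S\<close>, which is enough when the operators map into the span of these.
\<close>

lemma intertwines_eqI:
  assumes fin: "finite D"
    and inv: "\<And>i j. i \<in> D \<Longrightarrow> j \<in> D \<Longrightarrow> S i \<Longrightarrow> S j \<Longrightarrow> (\<Sum>x\<in>X. mat_comp A (\<lambda>i k. W x k i) (W x) i j) = (if i = j then 1 else 0)"
    and tw: "\<And>x. x \<in> X \<Longrightarrow> intertwines A D (W x) (M x) M'" "\<And>x. x \<in> X \<Longrightarrow> intertwines A D (W x) (N x) N'"
    and eq: "\<And>x k l. x \<in> X \<Longrightarrow> k \<in> A \<Longrightarrow> l \<in> A \<Longrightarrow> M x k l = N x k l"
    and sup: "\<And>i. i \<in> D \<Longrightarrow> \<not> S i \<Longrightarrow> M' i j = 0" "\<And>i. i \<in> D \<Longrightarrow> \<not> S i \<Longrightarrow> N' i j = 0"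
    and ij: "i \<in> D" "S i" "j \<in> D"
  shows "M' i j = N' i j"
proof -
  have *: "(\<Sum>x\<in>X. mat_comp A (\<lambda>i k. W x k i) (mat_comp D (W x) K) i j) = K i j"
    if K: "\<And>i. i \<in> D \<Longrightarrow> \<not> S i \<Longrightarrow> K i j = 0" for K
  proof -
    have "(\<Sum>x\<in>X. mat_comp A (\<lambda>i k. W x k i) (mat_comp D (W x) K) i j)
        = (\<Sum>x\<in>X. \<Sum>k\<in>D. mat_comp A (\<lambda>i k. W x k i) (W x) i k * K k j)"
      by (simp add: mat_comp_assoc [symmetric]) (simp add: mat_comp_def)
    also have "\<dots> = (\<Sum>k\<in>D. (\<Sum>x\<in>X. mat_comp A (\<lambda>i k. W x k i) (W x) i k) * K k j)"
      by (subst sum.swap) (simp add: sum_distrib_right)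
    also have "\<dots> = (\<Sum>k\<in>D. if k = i then K k j else 0)"
    proof (intro sum.cong refl)
      fix k assume k: "k \<in> D"
      show "(\<Sum>x\<in>X. mat_comp A (\<lambda>i k. W x k i) (W x) i k) * K k j = (if k = i then K k j else 0)"
        using ij(2) by (cases "S k") (auto simp: inv [OF ij(1) k ij(2)] K [OF k])
    qed
    also have "\<dots> = K i j" using fin ij by simp
    finally show ?thesis .
  qed
  have "M' i j = (\<Sum>x\<in>X. mat_comp A (\<lambda>i k. W x k i) (mat_comp D (W x) M') i j)"
    by (rule * [symmetric]) (rule sup)
  also have "\<dots> = (\<Sum>x\<in>X. mat_comp A (\<lambda>i k. W x k i) (mat_comp A (M x) (W x)) i j)"
    using tw(1) ij by (intro sum.cong mat_comp_cong) (auto simp: intertwines_def)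
  also have "\<dots> = (\<Sum>x\<in>X. mat_comp A (\<lambda>i k. W x k i) (mat_comp A (N x) (W x)) i j)"
    using eq by (intro sum.cong mat_comp_cong) (auto simp: intro!: mat_comp_cong)
  also have "\<dots> = (\<Sum>x\<in>X. mat_comp A (\<lambda>i k. W x k i) (mat_comp D (W x) N') i j)"
    using tw(2) ij by (intro sum.cong mat_comp_cong) (auto simp: intertwines_def)
  also have "\<dots> = N' i j"
    by (rule *) (rule sup)
  finally show ?thesis .
qed

type_synonym face = "nat \<Rightarrow> nat \<Rightarrow> nat \<Rightarrow> nat \<Rightarrow> complex"

text \<open>
  A walk \<open>a, i1, i2, c\<close> with fixed ends is encoded by the pair \<open>(i1, i2)\<close> of its inner vertices.
  \<open>face12\<close> changes \<open>i1\<close> and needs the initial vertex; \<open>face23\<close> changes \<open>i2\<close> and needs the final one.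
\<close>

definition face12 :: "face \<Rightarrow> nat \<Rightarrow> nat \<times> nat \<Rightarrow> nat \<times> nat \<Rightarrow> complex" where
  "face12 r a = (\<lambda>(i1, i2) (j1, j2). if i2 = j2 then r a i1 j1 j2 else 0)"

definition face23 :: "face \<Rightarrow> nat \<Rightarrow> nat \<times> nat \<Rightarrow> nat \<times> nat \<Rightarrow> complex" where
  "face23 r c = (\<lambda>(i1, i2) (j1, j2). if i1 = j1 then r j1 i2 j2 c else 0)"

context
  fixes V :: "nat set"
  assumes fin: "finite V"
begin

lemma face23_comp: "i \<in> V \<Longrightarrow> mat_comp (V \<times> V) (face23 r c) K (i, i') j = (\<Sum>k\<in>V. r i i' k c * K (i, k) j)"
proof -
  assume i: "i \<in> V"
  have "mat_comp (V \<times> V) (face23 r c) K (i, i') j = (\<Sum>l\<in>V. if l = i then (\<Sum>k\<in>V. r i i' k c * K (i, k) j) else 0)"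
    unfolding mat_comp_def face23_def sum.cartesian_product' by (intro sum.cong) auto
  thus ?thesis using i fin by simp
qed

lemma face12_comp: "i' \<in> V \<Longrightarrow> mat_comp (V \<times> V) (face12 r a) K (i, i') j = (\<Sum>k\<in>V. r a i k i' * K (k, i') j)"
proof -
  assume i: "i' \<in> V"
  have "mat_comp (V \<times> V) (face12 r a) K (i, i') j = (\<Sum>l\<in>V. if l = i' then (\<Sum>k\<in>V. r a i k i' * K (k, i') j) else 0)"
    unfolding mat_comp_def face12_def sum.cartesian_product' 
    by (subst sum.swap, intro sum.cong) auto
  thus ?thesis using i fin by simp
qed

lemma comp_face23: "j \<in> V \<Longrightarrow> mat_comp (V \<times> V) K (face23 r c) i (j, j') = (\<Sum>k\<in>V. K i (j, k) * r j k j' c)"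
proof -
  assume i: "j \<in> V"
  have "mat_comp (V \<times> V) K (face23 r c) i (j, j') = (\<Sum>l\<in>V. if l = j then (\<Sum>k\<in>V. K i (j, k) * r j k j' c) else 0)"
    unfolding mat_comp_def face23_def sum.cartesian_product' by (intro sum.cong) auto
  thus ?thesis using i fin by simp
qed

lemma comp_face12: "j' \<in> V \<Longrightarrow> mat_comp (V \<times> V) K (face12 r a) i (j, j') = (\<Sum>k\<in>V. K i (k, j') * r a k j j')"
proof -
  assume i: "j' \<in> V"
  have "mat_comp (V \<times> V) K (face12 r a) i (j, j') = (\<Sum>l\<in>V. if l = j' then (\<Sum>k\<in>V. K i (k, j') * r a k j j') else 0)"
    unfolding mat_comp_def face12_def sum.cartesian_product' 
    by (subst sum.swap, intro sum.cong) auto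
  thus ?thesis using i fin by simp
qed

text \<open>
  The two sides of the Yang--Baxter equation have a single free inner vertex.
\<close>

lemma hexagon_left:
  assumes "i1 \<in> V" "j1 \<in> V"
  shows "mat_comp (V \<times> V) (face23 r c) (mat_comp (V \<times> V) (face12 s a) (face23 t c)) (i1, i2) (j1, j2)
    = (\<Sum>k\<in>V. r i1 i2 k c * s a i1 j1 k * t j1 k j2 c)"
  unfolding face23_comp [OF assms(1)]
proof (intro sum.cong refl)
  fix k assume "k \<in> V"
  thus "r i1 i2 k c * mat_comp (V \<times> V) (face12 s a) (face23 t c) (i1, k) (j1, j2) = r i1 i2 k c * s a i1 j1 k * t j1 k j2 c"
    using assms by (simp add: comp_face23) (simp add: face12_def if_distrib [of "\<lambda>x. x * _"] fin cong: if_cong)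
qed

lemma hexagon_right:
  assumes "i2 \<in> V" "j2 \<in> V"
  shows "mat_comp (V \<times> V) (face12 r a) (mat_comp (V \<times> V) (face23 s c) (face12 t a)) (i1, i2) (j1, j2)
    = (\<Sum>k\<in>V. r a i1 k i2 * s k i2 j2 c * t a k j1 j2)"
  unfolding face12_comp [OF assms(1)]
proof (intro sum.cong refl)
  fix k assume "k \<in> V"
  thus "r a i1 k i2 * mat_comp (V \<times> V) (face23 s c) (face12 t a) (k, i2) (j1, j2) = r a i1 k i2 * s k i2 j2 c * t a k j1 j2"
    using assms by (simp add: comp_face12) (simp add: face23_def if_distrib [of "\<lambda>x. x * _"] fin cong: if_cong)
qed

end

definition face_on :: "(nat \<times> nat) set \<Rightarrow> face \<Rightarrow> bool" where
  "face_on E r \<longleftrightarrow> (\<forall>d e' e c. r d e' e c \<noteq> 0 \<longrightarrow> (d, e') \<in> E \<and> (e', c) \<in> E \<and> (d, e) \<in> E \<and> (e, c) \<in> E)"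

lemma face_onD:
  "\<lbrakk>face_on E r; r d e' e c \<noteq> 0\<rbrakk> \<Longrightarrow> (d, e') \<in> E \<and> (e', c) \<in> E \<and> (d, e) \<in> E \<and> (e, c) \<in> E"
  unfolding face_on_def by blast

text \<open>
  The cell \<open>C a b d e\<close> is the weight of a square with upper edge \<open>a, b\<close>, lower edge \<open>d, e\<close> and vertical
  arrows \<open>(a, d)\<close> and \<open>(b, e)\<close>.  An arrow is determined by its ends, so composing squares side by side
  involves no sum over the arrows in between.
\<close>

locale cell_system =
  fixes VA VD :: "nat set" and EA ED P :: "(nat \<times> nat) set"
    and C :: "nat \<Rightarrow> nat \<Rightarrow> nat \<Rightarrow> nat \<Rightarrow> complex"
  assumes finite_VA: "finite VA" and finite_VD: "finite VD"
    and cell_support: "C a b d e \<noteq> 0 \<Longrightarrow> (a, d) \<in> P \<and> (b, e) \<in> P \<and> (a, b) \<in> EA \<and> (d, e) \<in> ED"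
    and P_subset: "P \<subseteq> VA \<times> VD"
    and cell_unitary: "\<lbrakk>(a, d) \<in> P; (a, d') \<in> P; (d, e) \<in> ED; (d', e) \<in> ED\<rbrakk>
      \<Longrightarrow> (\<Sum>b\<in>VA. C a b d e * C a b d' e) = (if d = d' then 1 else 0)"
begin

definition cell2 :: "nat \<Rightarrow> nat \<Rightarrow> nat \<Rightarrow> nat \<Rightarrow> nat \<Rightarrow> nat \<Rightarrow> complex" where
  "cell2 a d c x b e = C a b d e * C b x e c"

definition cell3 :: "nat \<Rightarrow> nat \<Rightarrow> nat \<Rightarrow> nat \<Rightarrow> nat \<times> nat \<Rightarrow> nat \<times> nat \<Rightarrow> complex" where
  "cell3 a d c x = (\<lambda>(b1, b2) (e1, e2). C a b1 d e1 * C b1 b2 e1 e2 * C b2 x e2 c)"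

text \<open>
  Summing over the last upper vertex identifies the last inner lower vertices, after which the first
  square can be summed.
\<close>

lemma cell2_unitary:
  assumes "(a, d) \<in> P" "(a, d') \<in> P" "(d, e) \<in> ED" "(e, c) \<in> ED" "(d', e') \<in> ED" "(e', c) \<in> ED"
  shows "(\<Sum>x\<in>VA. \<Sum>b\<in>VA. cell2 a d c x b e * cell2 a d' c x b e') = (if d = d' \<and> e = e' then 1 else 0)"
proof -
  have "(\<Sum>x\<in>VA. \<Sum>b\<in>VA. cell2 a d c x b e * cell2 a d' c x b e')
      = (\<Sum>b\<in>VA. C a b d e * C a b d' e' * (\<Sum>x\<in>VA. C b x e c * C b x e' c))"
    unfolding cell2_def sum_distrib_left by (subst sum.swap) (simp add: mult_ac)
  also have "\<dots> = (\<Sum>b\<in>VA. C a b d e * C a b d' e' * (if e = e' then 1 else 0))"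
  proof (intro sum.cong refl)
    fix b
    show "C a b d e * C a b d' e' * (\<Sum>x\<in>VA. C b x e c * C b x e' c) = C a b d e * C a b d' e' * (if e = e' then 1 else 0)"
    proof (cases "C a b d e * C a b d' e' = 0")
      case False
      hence "(b, e) \<in> P" "(b, e') \<in> P" using cell_support by auto
      thus ?thesis using cell_unitary assms by simp
    qed simp
  qed
  also have "\<dots> = (if d = d' \<and> e = e' then 1 else 0)"
    using assms cell_unitary [OF assms(1,2), of e] by (cases "e = e'") auto
  finally show ?thesis .
qed

lemma cell3_unitary:
  assumes "(a, d) \<in> P" "(d, e1) \<in> ED" "(e1, e2) \<in> ED" "(e2, c) \<in> ED" "(d, f1) \<in> ED" "(f1, f2) \<in> ED" "(f2, c) \<in> ED"
  shows "(\<Sum>x\<in>VA. \<Sum>b\<in>VA \<times> VA. cell3 a d c x b (e1, e2) * cell3 a d c x b (f1, f2)) = (if e1 = f1 \<and> e2 = f2 then 1 else 0)"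
proof -
  have "(\<Sum>x\<in>VA. \<Sum>b\<in>VA \<times> VA. cell3 a d c x b (e1, e2) * cell3 a d c x b (f1, f2))
     = (\<Sum>b1\<in>VA. C a b1 d e1 * C a b1 d f1 * (\<Sum>x\<in>VA. \<Sum>b2\<in>VA. cell2 b1 e1 c x b2 e2 * cell2 b1 f1 c x b2 f2))"
    unfolding cell2_def cell3_def sum_distrib_left sum.cartesian_product' by (subst sum.swap) (simp add: mult_ac)
  also have "\<dots> = (\<Sum>b1\<in>VA. C a b1 d e1 * C a b1 d f1 * (if e1 = f1 \<and> e2 = f2 then 1 else 0))"
  proof (intro sum.cong refl)
    fix b
    show "C a b d e1 * C a b d f1 * (\<Sum>x\<in>VA. \<Sum>b2\<in>VA. cell2 b e1 c x b2 e2 * cell2 b f1 c x b2 f2)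
       = C a b d e1 * C a b d f1 * (if e1 = f1 \<and> e2 = f2 then 1 else 0)"
    proof (cases "C a b d e1 * C a b d f1 = 0")
      case False
      hence "(b, e1) \<in> P" "(b, f1) \<in> P" using cell_support by auto
      thus ?thesis using cell2_unitary assms by simp
    qed simp
  qed
  also have "\<dots> = (if e1 = f1 \<and> e2 = f2 then 1 else 0)"
    using cell_unitary assms by simp
  finally show ?thesis .
qed

definition cell_intertwines :: "face \<Rightarrow> face \<Rightarrow> bool" where
  "cell_intertwines r s \<longleftrightarrow> face_on ED s \<and>
     (\<forall>a\<in>VA. \<forall>d\<in>VD. \<forall>c\<in>VD. \<forall>x\<in>VA. intertwines VA VD (cell2 a d c x) (\<lambda>b' b. r a b' b x) (\<lambda>e' e. s d e' e c))"

lemma cell_intertwinesD: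
  assumes "cell_intertwines r s" "a \<in> VA" "d \<in> VD" "c \<in> VD" "x \<in> VA" "b' \<in> VA" "e \<in> VD"
  shows "(\<Sum>b\<in>VA. r a b' b x * (C a b d e * C b x e c)) = (\<Sum>e'\<in>VD. C a b' d e' * C b' x e' c * s d e' e c)"
  using assms unfolding cell_intertwines_def intertwines_def mat_comp_def cell2_def by blast

text \<open>
  The left-hand side is the twist at the arrows \<open>(a, d)\<close> and \<open>(a, d')\<close>.  After moving the cells through
  \<open>r\<close>, unitarity leaves \<open>s\<close> for equal arrows and nothing for distinct ones.
\<close>

lemma twisted_face:
  assumes rs: "cell_intertwines r s" and P: "(a, d) \<in> P" "(a, d') \<in> P"
    and E: "(d, e) \<in> ED" "(e, c) \<in> ED" "(d', e') \<in> ED" "(e', c) \<in> ED" and V: "c \<in> VD" "e \<in> VD" "e' \<in> VD"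
  shows "(\<Sum>x\<in>VA. \<Sum>b'\<in>VA. \<Sum>b\<in>VA. cell2 a d' c x b' e' * (r a b' b x * cell2 a d c x b e))
       = (if d = d' then s d e' e c else 0)"
proof -
  have ad: "a \<in> VA" "d \<in> VD" using P P_subset by auto
  have "(\<Sum>x\<in>VA. \<Sum>b'\<in>VA. \<Sum>b\<in>VA. cell2 a d' c x b' e' * (r a b' b x * cell2 a d c x b e))
      = (\<Sum>x\<in>VA. \<Sum>b'\<in>VA. \<Sum>f\<in>VD. (cell2 a d' c x b' e' * cell2 a d c x b' f) * s d f e c)"
  proof (rule sum.cong [OF refl], rule sum.cong [OF refl])
    fix x b' assume "x \<in> VA" "b' \<in> VA"
    have "(\<Sum>b\<in>VA. cell2 a d' c x b' e' * (r a b' b x * cell2 a d c x b e))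
        = cell2 a d' c x b' e' * (\<Sum>b\<in>VA. r a b' b x * (C a b d e * C b x e c))"
      by (simp add: sum_distrib_left cell2_def)
    also have "\<dots> = cell2 a d' c x b' e' * (\<Sum>f\<in>VD. C a b' d f * C b' x f c * s d f e c)"
      by (simp only: cell_intertwinesD [OF rs ad V(1) \<open>x \<in> VA\<close> \<open>b' \<in> VA\<close> V(2)])
    finally show "(\<Sum>b\<in>VA. cell2 a d' c x b' e' * (r a b' b x * cell2 a d c x b e))
       = (\<Sum>f\<in>VD. (cell2 a d' c x b' e' * cell2 a d c x b' f) * s d f e c)"
      by (simp add: sum_distrib_left cell2_def mult.assoc)
  qed
  also have "\<dots> = (\<Sum>f\<in>VD. (\<Sum>x\<in>VA. \<Sum>b'\<in>VA. cell2 a d' c x b' e' * cell2 a d c x b' f) * s d f e c)"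
    by (subst sum.swap [of _ VD], subst sum.swap [of _ VD]) (simp add: sum_distrib_right)
  also have "\<dots> = (\<Sum>f\<in>VD. (if d' = d \<and> e' = f then 1 else 0) * s d f e c)"
  proof (intro sum.cong refl)
    fix f
    show "(\<Sum>x\<in>VA. \<Sum>b'\<in>VA. cell2 a d' c x b' e' * cell2 a d c x b' f) * s d f e c = (if d' = d \<and> e' = f then 1 else 0) * s d f e c"
    proof (cases "s d f e c = 0")
      case False
      hence "(d, f) \<in> ED" "(f, c) \<in> ED"
        using rs unfolding cell_intertwines_def face_on_def by blast+
      thus ?thesis using cell2_unitary [OF P(2,1) E(3,4)] by simp
    qed simp
  qed
  also have "\<dots> = (if d = d' then s d e' e c else 0)"
    using V finite_VD by (auto simp: if_distrib [of "\<lambda>x. x * _"] cong: if_cong)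
  finally show ?thesis .
qed

lemma intertwines_face12:
  assumes rs: "cell_intertwines r s" and V: "a \<in> VA" "d \<in> VD" "c \<in> VD" "x \<in> VA"
  shows "intertwines (VA \<times> VA) (VD \<times> VD) (cell3 a d c x) (face12 r a) (face12 s d)"
  unfolding intertwines_def
proof (clarify)
  fix b1 b2 e1 e2 assume "b1 \<in> VA" "b2 \<in> VA" "e1 \<in> VD" "e2 \<in> VD"
  note * = this
  have "mat_comp (VA \<times> VA) (face12 r a) (cell3 a d c x) (b1, b2) (e1, e2)
     = (\<Sum>b\<in>VA. r a b1 b b2 * (C a b d e1 * C b b2 e1 e2)) * C b2 x e2 c"
    using * by (simp add: face12_comp finite_VA cell3_def sum_distrib_left mult_ac)
  also have "\<dots> = (\<Sum>e\<in>VD. C a b1 d e * C b1 b2 e e2 * s d e e1 e2) * C b2 x e2 c"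
    using * by (simp only: cell_intertwinesD [OF rs V(1,2)])
  also have "\<dots> = mat_comp (VD \<times> VD) (cell3 a d c x) (face12 s d) (b1, b2) (e1, e2)"
    using * by (simp add: comp_face12 finite_VD cell3_def sum_distrib_left mult_ac)
  finally show "mat_comp (VA \<times> VA) (face12 r a) (cell3 a d c x) (b1, b2) (e1, e2)
     = mat_comp (VD \<times> VD) (cell3 a d c x) (face12 s d) (b1, b2) (e1, e2)" .
qed

lemma intertwines_face23:
  assumes rs: "cell_intertwines r s" and V: "a \<in> VA" "d \<in> VD" "c \<in> VD" "x \<in> VA"
  shows "intertwines (VA \<times> VA) (VD \<times> VD) (cell3 a d c x) (face23 r x) (face23 s c)"
  unfolding intertwines_def
proof (clarify)
  fix b1 b2 e1 e2 assume "b1 \<in> VA" "b2 \<in> VA" "e1 \<in> VD" "e2 \<in> VD"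
  note * = this
  have "mat_comp (VA \<times> VA) (face23 r x) (cell3 a d c x) (b1, b2) (e1, e2)
     = C a b1 d e1 * (\<Sum>b\<in>VA. r b1 b2 b x * (C b1 b e1 e2 * C b x e2 c))"
    using * by (simp add: face23_comp finite_VA cell3_def sum_distrib_left mult_ac)
  also have "\<dots> = C a b1 d e1 * (\<Sum>e\<in>VD. C b1 b2 e1 e * C b2 x e c * s e1 e e2 c)"
    using * by (simp only: cell_intertwinesD [OF rs _ _ V(3,4)])
  also have "\<dots> = mat_comp (VD \<times> VD) (cell3 a d c x) (face23 s c) (b1, b2) (e1, e2)"
    using * by (simp add: comp_face23 finite_VD cell3_def sum_distrib_left mult_ac)
  finally show "mat_comp (VA \<times> VA) (face23 r x) (cell3 a d c x) (b1, b2) (e1, e2)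
     = mat_comp (VD \<times> VD) (cell3 a d c x) (face23 s c) (b1, b2) (e1, e2)" .
qed

text \<open>
  For every final upper vertex \<open>x\<close>, the triple cells intertwine both sides of the equation for \<open>r\<close> with the
  corresponding sides for \<open>s\<close>; their orthonormality over all \<open>x\<close> then allows the cells to be cancelled.
\<close>

proposition star_triangle_transfer:
  assumes rs: "cell_intertwines rx sx" "cell_intertwines ry sy" "cell_intertwines rz sz"
    and st: "\<And>a b1 b2 c b1' b2'. {a, b1, b2, c, b1', b2'} \<subseteq> VA \<Longrightarrow>
        (\<Sum>b\<in>VA. rx b1' b2' b c * rz a b1' b1 b * ry b1 b b2 c) = (\<Sum>b\<in>VA. ry a b1' b b2' * rz b b2' b2 c * rx a b b1 b2)"
    and V: "{d, e1, e2, c, e1', e2'} \<subseteq> VD" and walk: "(d, e1') \<in> ED" "(e1', e2') \<in> ED" "(e2', c) \<in> ED" 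
       "(d, e1) \<in> ED" "(e1, e2) \<in> ED" "(e2, c) \<in> ED"
    and a: "(a, d) \<in> P"
  shows "(\<Sum>e\<in>VD. sx e1' e2' e c * sz d e1' e1 e * sy e1 e e2 c) = (\<Sum>e\<in>VD. sy d e1' e e2' * sz e e2' e2 c * sx d e e1 e2)"
proof -
  let ?A = "VA \<times> VA" and ?D = "VD \<times> VD"
  define S where "S = (\<lambda>(e1, e2). (d, e1) \<in> ED \<and> (e1, e2) \<in> ED \<and> (e2, c) \<in> ED)"
  define L where "L = mat_comp ?D (face23 sx c) (mat_comp ?D (face12 sz d) (face23 sy c))"
  define R where "R = mat_comp ?D (face12 sy d) (mat_comp ?D (face23 sz c) (face12 sx d))"
  have L: "L (i1, i2) (j1, j2) = (\<Sum>e\<in>VD. sx i1 i2 e c * sz d i1 j1 e * sy j1 e j2 c)"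
    if "i1 \<in> VD" "j1 \<in> VD" for i1 i2 j1 j2
    unfolding L_def by (rule hexagon_left [OF finite_VD that])
  have R: "R (i1, i2) (j1, j2) = (\<Sum>e\<in>VD. sy d i1 e i2 * sz e i2 j2 c * sx d e j1 j2)"
    if "i2 \<in> VD" "j2 \<in> VD" for i1 i2 j1 j2
    unfolding R_def by (rule hexagon_right [OF finite_VD that])
  have ad: "a \<in> VA" "d \<in> VD" using a P_subset by auto
  have on: "face_on ED sx" "face_on ED sy" "face_on ED sz"
    using rs unfolding cell_intertwines_def by auto
  have "L (e1', e2') (e1, e2) = R (e1', e2') (e1, e2)"
  proof (rule intertwines_eqI [where X = VA and A = ?A and D = ?D and S = S and W = "cell3 a d c"
        and M = "\<lambda>x. mat_comp ?A (face23 rx x) (mat_comp ?A (face12 rz a) (face23 ry x))"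
        and N = "\<lambda>x. mat_comp ?A (face12 ry a) (mat_comp ?A (face23 rz x) (face12 rx a))"])
    fix i j assume "i \<in> ?D" "j \<in> ?D" "S i" "S j"
    thus "(\<Sum>x\<in>VA. mat_comp ?A (\<lambda>i k. cell3 a d c x k i) (cell3 a d c x) i j) = (if i = j then 1 else 0)"
      unfolding mat_comp_def S_def using cell3_unitary [OF a] by (cases i; cases j) simp
  next
    fix x assume x: "x \<in> VA"
    show "intertwines ?A ?D (cell3 a d c x) (mat_comp ?A (face23 rx x) (mat_comp ?A (face12 rz a) (face23 ry x))) L"
      unfolding L_def using V ad x
      by (intro intertwines_comp intertwines_face12 intertwines_face23 rs) auto
    show "intertwines ?A ?D (cell3 a d c x) (mat_comp ?A (face12 ry a) (mat_comp ?A (face23 rz x) (face12 rx a))) R"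
      unfolding R_def using V ad x
      by (intro intertwines_comp intertwines_face12 intertwines_face23 rs) auto
    fix k l assume "k \<in> ?A" "l \<in> ?A"
    thus "mat_comp ?A (face23 rx x) (mat_comp ?A (face12 rz a) (face23 ry x)) k l
        = mat_comp ?A (face12 ry a) (mat_comp ?A (face23 rz x) (face12 rx a)) k l"
      using x ad by (cases k; cases l) (simp add: hexagon_left hexagon_right finite_VA st)
  next
    fix i assume i: "i \<in> ?D" "\<not> S i"
    obtain i1 i2 where ii: "i = (i1, i2)" by (cases i)
    have "sx i1 i2 e c * sz d i1 e1 e * sy e1 e e2 c = 0" for e
      using i(2) face_onD [OF on(1), of i1 i2 e c] face_onD [OF on(3), of d i1 e1 e]
      by (auto simp: ii S_def)
    hence "(\<Sum>e\<in>VD. sx i1 i2 e c * sz d i1 e1 e * sy e1 e e2 c) = 0" by (intro sum.neutral) blast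
    thus "L i (e1, e2) = 0" using i V L [of i1 e1 i2 e2] by (simp add: ii)
    have "sy d i1 e i2 * sz e i2 e2 c * sx d e e1 e2 = 0" for e
      using i(2) face_onD [OF on(2), of d i1 e i2] face_onD [OF on(3), of e i2 e2 c]
      by (auto simp: ii S_def)
    hence "(\<Sum>e\<in>VD. sy d i1 e i2 * sz e i2 e2 c * sx d e e1 e2) = 0" by (intro sum.neutral) blast
    thus "R i (e1, e2) = 0" using i V R [of i2 e2 i1 e1] by (simp add: ii)
  next
    show "finite ?D" by (simp add: finite_VD)
    show "(e1', e2') \<in> ?D" "(e1, e2) \<in> ?D" using V by auto
    show "S (e1', e2')" using walk by (simp add: S_def)
  qed
  thus ?thesis using V by (simp add: L R)
qed

proposition unitarity_transfer:
  assumes rs: "cell_intertwines r s" "cell_intertwines r' s'"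
    and un: "\<And>a b' b c. {a, b', b, c} \<subseteq> VA \<Longrightarrow>
        (\<Sum>k\<in>VA. r a b' k c * r' a k b c) = (if b = b' \<and> (a, b) \<in> EA \<and> (b, c) \<in> EA then 1 else 0)"
    and V: "{d, e', e, c} \<subseteq> VD" and walk: "(d, e') \<in> ED" "(e', c) \<in> ED" "(d, e) \<in> ED" "(e, c) \<in> ED"
    and a: "(a, d) \<in> P"
  shows "(\<Sum>k\<in>VD. s d e' k c * s' d k e c) = (if e = e' then 1 else 0)"
proof -
  define S where "S = (\<lambda>e. (d, e) \<in> ED \<and> (e, c) \<in> ED)"
  define I where "I = (\<lambda>e' e. if e = e' \<and> (d, e) \<in> ED \<and> (e, c) \<in> ED then 1 else (0::complex))"
  have ad: "a \<in> VA" "d \<in> VD" using a P_subset by auto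
  have on: "face_on ED s" 
    using rs unfolding cell_intertwines_def by auto
  have "mat_comp VD (\<lambda>e' e. s d e' e c) (\<lambda>e' e. s' d e' e c) e' e = I e' e"
  proof (rule intertwines_eqI [where X = VA and A = VA and D = VD and S = S and W = "cell2 a d c"
        and M = "\<lambda>x. mat_comp VA (\<lambda>b' b. r a b' b x) (\<lambda>b' b. r' a b' b x)"
        and N = "\<lambda>x b' b. if b = b' \<and> (a, b) \<in> EA \<and> (b, x) \<in> EA then 1 else 0"])
    fix i j assume "i \<in> VD" "j \<in> VD" "S i" "S j"
    thus "(\<Sum>x\<in>VA. mat_comp VA (\<lambda>i k. cell2 a d c x k i) (cell2 a d c x) i j) = (if i = j then 1 else 0)"
      unfolding mat_comp_def S_def using cell2_unitary [OF a a] by simp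
  next
    fix x assume x: "x \<in> VA"
    show "intertwines VA VD (cell2 a d c x) (mat_comp VA (\<lambda>b' b. r a b' b x) (\<lambda>b' b. r' a b' b x))
      (mat_comp VD (\<lambda>e' e. s d e' e c) (\<lambda>e' e. s' d e' e c))"
      using V ad x rs by (intro intertwines_comp) (auto simp: cell_intertwines_def)
    show "intertwines VA VD (cell2 a d c x) (\<lambda>b' b. if b = b' \<and> (a, b) \<in> EA \<and> (b, x) \<in> EA then 1 else 0) I"
      unfolding intertwines_def
    proof (intro ballI)
      fix b e assume be: "b \<in> VA" "e \<in> VD"
      have "mat_comp VA (\<lambda>b' b. if b = b' \<and> (a, b) \<in> EA \<and> (b, x) \<in> EA then 1 else 0) (cell2 a d c x) b e
         = (\<Sum>k\<in>VA. if k = b then cell2 a d c x b e else 0)"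
        unfolding mat_comp_def cell2_def
        by (intro sum.cong refl) (use cell_support in auto)
      also have "\<dots> = (\<Sum>k\<in>VD. if k = e then cell2 a d c x b e else 0)"
        using be finite_VA finite_VD by simp
      also have "\<dots> = mat_comp VD (cell2 a d c x) I b e"
        unfolding mat_comp_def cell2_def I_def
        by (intro sum.cong refl) (use cell_support in auto)
      finally show "mat_comp VA (\<lambda>b' b. if b = b' \<and> (a, b) \<in> EA \<and> (b, x) \<in> EA then 1 else 0) (cell2 a d c x) b e
        = mat_comp VD (cell2 a d c x) I b e" .
    qed
    fix k l assume "k \<in> VA" "l \<in> VA"
    thus "mat_comp VA (\<lambda>b' b. r a b' b x) (\<lambda>b' b. r' a b' b x) k l = (if l = k \<and> (a, l) \<in> EA \<and> (l, x) \<in> EA then 1 else 0)"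
      unfolding mat_comp_def using un [of a k l x] x ad by simp
  next
    fix i assume i: "i \<in> VD" "\<not> S i"
    have "s d i k c * s' d k e c = 0" for k
      using i(2) face_onD [OF on, of d i k c] by (auto simp: S_def)
    thus "mat_comp VD (\<lambda>e' e. s d e' e c) (\<lambda>e' e. s' d e' e c) i e = 0" 
      unfolding mat_comp_def by (intro sum.neutral) blast
    show "I i e = 0" using i by (auto simp: I_def S_def)
  next
    show "finite VD" by (rule finite_VD)
    show "e' \<in> VD" "e \<in> VD" using V by auto
    show "S e'" using walk by (simp add: S_def)
  qed
  thus ?thesis using walk by (simp add: mat_comp_def I_def)
qed

end

section \<open>The cells between the A and D diagrams\<close>

lemma sum_supported_on_point:
  fixes f :: "nat \<Rightarrow> complex"
  assumes "finite V" "u \<in> V" "\<And>b. b \<in> V \<Longrightarrow> f b \<noteq> 0 \<Longrightarrow> b = u"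
  shows "sum f V = f u"
proof -
  have "sum f V = sum f {u}" using assms by (intro sum.mono_neutral_right) auto
  thus ?thesis by simp
qed

lemma sum_zero: "(\<And>b. b \<in> V \<Longrightarrow> f b = (0::complex)) \<Longrightarrow> sum f V = 0"
  by (rule sum.neutral) blast

lemma sum_pair:
  fixes f :: "nat \<Rightarrow> complex"
  assumes "finite V" "u \<in> V" "v \<in> V" "u \<noteq> v" "\<And>b. b \<in> V \<Longrightarrow> f b \<noteq> 0 \<Longrightarrow> b = u \<or> b = v"
  shows "sum f V = f u + f v"
  by (rule sum_supported_on_pair) (use assms in auto)

text \<open>
  From here on \<open>n = L - 3\<close>.  The A diagram has the vertices \<open>1, \<dots>, 2 n + 3\<close> with centre \<open>n + 2\<close>; the D diagram
  has the line \<open>1, \<dots>, n + 1\<close> with the leaves \<open>n + 2\<close> and \<open>n + 3\<close> attached to \<open>n + 1\<close>.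
\<close>

definition adjA :: "nat \<Rightarrow> nat \<Rightarrow> nat \<Rightarrow> bool" where
  "adjA n a b \<longleftrightarrow> (b = Suc a \<or> a = Suc b) \<and> 1 \<le> a \<and> 1 \<le> b \<and> a < 2 * n + 4 \<and> b < 2 * n + 4"

definition adjD :: "nat \<Rightarrow> nat \<Rightarrow> nat \<Rightarrow> bool" where
  "adjD n d e \<longleftrightarrow> 1 \<le> d \<and> 1 \<le> e \<and> ((d \<le> n + 1 \<and> e \<le> n + 1 \<and> (e = Suc d \<or> d = Suc e))
     \<or> (d = n + 1 \<and> (e = n + 2 \<or> e = n + 3)) \<or> (e = n + 1 \<and> (d = n + 2 \<or> d = n + 3)))"

definition connects :: "nat \<Rightarrow> nat \<Rightarrow> nat \<Rightarrow> bool" where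
  "connects n a d \<longleftrightarrow> (1 \<le> d \<and> d \<le> n + 1 \<and> (a = d \<or> a + d = 2 * n + 4)) \<or> (a = n + 2 \<and> (d = n + 2 \<or> d = n + 3))"

text \<open>
  The coefficients of \<open>C_tilde\<close> with \<open>h\<close> for \<open>1 / sqrt 2\<close>.  Squares over the line and squares ending in a leaf have
  absolute value \<open>1\<close>, those starting in a leaf \<open>\<bar>h\<bar>\<close>; the sign is negative exactly if \<open>n + 1\<close> occurs above
  and \<open>n + 3\<close> below.
\<close>

definition cell :: "complex \<Rightarrow> nat \<Rightarrow> nat \<Rightarrow> nat \<Rightarrow> nat \<Rightarrow> nat \<Rightarrow> complex" where
  "cell h n a b d e =
    (if d \<le> n + 1 \<and> e \<le> n + 1 then
       if adjA n a b \<and> connects n a d \<and> connects n b e then 1 else 0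
     else if d = n + 1 \<and> b = n + 2 then
       if a = n + 1 \<and> e = n + 2 \<or> a = n + 3 \<and> (e = n + 2 \<or> e = n + 3) then 1
       else if a = n + 1 \<and> e = n + 3 then - 1 else 0
     else if e = n + 1 \<and> a = n + 2 then
       if b = n + 1 \<and> d = n + 2 \<or> b = n + 3 \<and> (d = n + 2 \<or> d = n + 3) then h
       else if b = n + 1 \<and> d = n + 3 then - h else 0
     else 0)"

lemma parcs_A_graph: "(a, b) \<in> parcs (A_graph (2 * n + 3)) \<longleftrightarrow> adjA n a b"
  unfolding A_graph_def symmetric_arcs_def adjA_def by auto

lemma parcs_D_graph: "(d, e) \<in> parcs (D_graph (n + 3)) \<longleftrightarrow> adjD n d e"
  unfolding D_graph_def symmetric_arcs_def adjD_def by auto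

lemma conn_AD_iff: "(a, d) \<in> conn_AD (n + 3) \<longleftrightarrow> connects n a d"
proof -
  have "(\<exists>i. a = 2 * n + 4 - i \<and> d = i \<and> 1 \<le> i \<and> i \<le> n + 1) \<longleftrightarrow> a = 2 * n + 4 - d \<and> 1 \<le> d \<and> d \<le> n + 1"
    by auto
  thus ?thesis unfolding conn_AD_def connects_def by auto
qed

lemma connects_line: "d \<le> n + 1 \<Longrightarrow> connects n a d \<longleftrightarrow> 1 \<le> d \<and> (a = d \<or> a + d = 2 * n + 4)"
  by (auto simp: connects_def)

lemma connects_leaf: "n + 2 \<le> d \<Longrightarrow> connects n a d \<longleftrightarrow> a = n + 2 \<and> (d = n + 2 \<or> d = n + 3)"
  by (auto simp: connects_def)

lemma connects_center: "connects n (n + 2) d \<longleftrightarrow> d = n + 2 \<or> d = n + 3"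
  by (auto simp: connects_def)

lemma connects_off_center: "connects n a d \<Longrightarrow> a \<noteq> n + 2 \<Longrightarrow> 1 \<le> d \<and> d \<le> n + 1 \<and> (a = d \<or> a + d = 2 * n + 4)"
  by (simp add: connects_def)

lemma connects_unique: "\<lbrakk>connects n a d; connects n a e; a \<noteq> n + 2\<rbrakk> \<Longrightarrow> d = e"
  using connects_off_center [of n a d] connects_off_center [of n a e] by linarith

text \<open>
  The two vertices above \<open>d\<close> have a common neighbour only if they are \<open>n + 1\<close> and \<open>n + 3\<close>.
\<close>

lemma adj_connects_unique:
  assumes "adjA n x a" "adjA n x a'" "connects n a d" "connects n a' d" "d \<le> n + 1" "d \<noteq> n + 1 \<or> x \<noteq> n + 2"
  shows "a = a'"
proof -
  have "a = d \<or> a + d = 2 * n + 4" "a' = d \<or> a' + d = 2 * n + 4" "a = Suc x \<or> x = Suc a" "a' = Suc x \<or> x = Suc a'"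
    using assms connects_line by (auto simp: adjA_def)
  thus ?thesis using assms(5,6) by (elim disjE) linarith+
qed

lemma C_coeff_eq_cell: "C_coeff sq (n + 3) a b d e = cell (1 / sq 2) n a b d e"
proof -
  have bulk: "(\<exists>i. 1 \<le> i \<and> i \<le> n \<and> (a, b, d, e) \<in> {(i + 1, i, i + 1, i), (i, i + 1, i, i + 1),
                (2 * (n + 3) - 3 - i, 2 * (n + 3) - 2 - i, i + 1, i),
                (2 * (n + 3) - 2 - i, 2 * (n + 3) - 3 - i, i, i + 1)})
     \<longleftrightarrow> d \<le> n + 1 \<and> e \<le> n + 1 \<and> adjA n a b \<and> connects n a d \<and> connects n b e"
    (is "?L \<longleftrightarrow> ?R")
  proof
    assume ?L
    then obtain i where i: "1 \<le> i" "i \<le> n"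
      and "a = i + 1 \<and> b = i \<and> d = i + 1 \<and> e = i \<or> a = i \<and> b = i + 1 \<and> d = i \<and> e = i + 1
        \<or> a = 2 * (n + 3) - 3 - i \<and> b = 2 * (n + 3) - 2 - i \<and> d = i + 1 \<and> e = i
        \<or> a = 2 * (n + 3) - 2 - i \<and> b = 2 * (n + 3) - 3 - i \<and> d = i \<and> e = i + 1" (is "?c1 \<or> ?c2 \<or> ?c3 \<or> ?c4")
      by auto
    then consider ?c1 | ?c2 | ?c3 | ?c4 by blast
    thus ?R
    proof cases
      assume c: ?c3
      hence "a + d = 2 * n + 4" "b + e = 2 * n + 4" "d = Suc e" "e = i" using i by simp_all
      thus ?R using i by (simp add: adjA_def connects_line)
    next
      assume c: ?c4
      hence "a + d = 2 * n + 4" "b + e = 2 * n + 4" "e = Suc d" "d = i" using i by simp_all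
      thus ?R using i by (simp add: adjA_def connects_line)
    qed (use i in \<open>simp_all add: adjA_def connects_line\<close>)
  next
    assume R: ?R
    have a: "a = d \<or> a + d = 2 * n + 4" "1 \<le> d" "d \<le> n + 1" using R connects_line [of d n a] by blast+
    have b: "b = e \<or> b + e = 2 * n + 4" "1 \<le> e" "e \<le> n + 1" using R connects_line [of e n b] by blast+
    have ab: "b = Suc a \<or> a = Suc b" using R by (simp add: adjA_def)
    have s: "a = d \<and> b = e \<or> a + d = 2 * n + 4 \<and> b + e = 2 * n + 4"
      using a(1) b(1)
    proof (elim disjE)
      assume "a = d" "b + e = 2 * n + 4" thus ?thesis using ab a(3) b(3) by linarith
    next
      assume "a + d = 2 * n + 4" "b = e" thus ?thesis using ab a(3) b(3) by linarith
    qed auto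
    have "e = Suc d \<or> d = Suc e" using s ab by linarith
    thus ?L
    proof
      assume e: "e = Suc d"
      have "2 * (n + 3) - 2 - d = a \<and> 2 * (n + 3) - 3 - d = b" if "a + d = 2 * n + 4" "b + e = 2 * n + 4"
      proof -
        have "2 * (n + 3) - 2 = a + d" "2 * (n + 3) - 3 = b + d" using that e by simp_all
        thus ?thesis by (metis diff_add_inverse2)
      qed
      hence "(a, b, d, e) \<in> {(d + 1, d, d + 1, d), (d, d + 1, d, d + 1),
                (2 * (n + 3) - 3 - d, 2 * (n + 3) - 2 - d, d + 1, d),
                (2 * (n + 3) - 2 - d, 2 * (n + 3) - 3 - d, d, d + 1)}"
        using s e by (elim disjE) simp_all
      moreover have "d \<le> n" using e b(3) by simp
      ultimately show ?L using a(2) by blast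
    next
      assume d: "d = Suc e"
      have "2 * (n + 3) - 3 - e = a \<and> 2 * (n + 3) - 2 - e = b" if "a + d = 2 * n + 4" "b + e = 2 * n + 4"
      proof -
        have "2 * (n + 3) - 3 = a + e" "2 * (n + 3) - 2 = b + e" using that d by simp_all
        thus ?thesis by (metis diff_add_inverse2)
      qed
      hence "(a, b, d, e) \<in> {(e + 1, e, e + 1, e), (e, e + 1, e, e + 1),
                (2 * (n + 3) - 3 - e, 2 * (n + 3) - 2 - e, e + 1, e),
                (2 * (n + 3) - 2 - e, 2 * (n + 3) - 3 - e, e, e + 1)}"
        using s d by (elim disjE) simp_all
      moreover have "e \<le> n" using d a(3) by simp
      ultimately show ?L using b(2) by blast
    qed
  qed
  show ?thesis
  proof (cases "d \<le> n + 1 \<and> e \<le> n + 1")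
    case True
    thus ?thesis unfolding C_coeff_def Let_def cell_def using bulk by simp
  next
    case False
    hence "\<not> (\<exists>i. 1 \<le> i \<and> i \<le> n \<and> (a, b, d, e) \<in> {(i + 1, i, i + 1, i), (i, i + 1, i, i + 1),
                (2 * (n + 3) - 3 - i, 2 * (n + 3) - 2 - i, i + 1, i),
                (2 * (n + 3) - 2 - i, 2 * (n + 3) - 3 - i, i, i + 1)})" 
      unfolding bulk by blast
    moreover have n: "n + 3 - 3 = n" "n + 3 - 1 = n + 2" "n + 3 - 2 = n + 1" by auto
    ultimately have C: "C_coeff sq (n + 3) a b d e =
     (if (a, b, d, e) = (n + 2, n + 1, n + 2, n + 1) then 1 / sq 2
      else if (a, b, d, e) = (n + 2, n + 1, n + 3, n + 1) then - 1 / sq 2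
      else if (a, b, d, e) = (n + 2, n + 3, n + 2, n + 1) then 1 / sq 2
      else if (a, b, d, e) = (n + 2, n + 3, n + 3, n + 1) then 1 / sq 2
      else if (a, b, d, e) = (n + 1, n + 2, n + 1, n + 2) then 1
      else if (a, b, d, e) = (n + 1, n + 2, n + 1, n + 3) then - 1
      else if (a, b, d, e) = (n + 3, n + 2, n + 1, n + 2) then 1
      else if (a, b, d, e) = (n + 3, n + 2, n + 1, n + 3) then 1
      else 0)"
      unfolding C_coeff_def Let_def n by (simp only: if_False)
    show ?thesis
    proof (cases "d = n + 1")
      case True
      hence "\<not> e \<le> n + 1" using False by simp
      thus ?thesis unfolding C using True
        by (cases "b = n + 2"; cases "a = n + 1"; cases "a = n + 3") (simp_all add: cell_def)
    next
      case d: False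
      show ?thesis
      proof (cases "e = n + 1")
        case True
        hence "\<not> d \<le> n + 1" using False by simp
        thus ?thesis unfolding C using True d
          by (cases "a = n + 2"; cases "b = n + 1"; cases "b = n + 3") (simp_all add: cell_def)
      next
        case e: False
        thus ?thesis unfolding C cell_def if_not_P [OF False] using d by simp
      qed
    qed
  qed
qed

lemma cell_nonzero:
  "cell h n a b d e \<noteq> 0 \<Longrightarrow> connects n a d \<and> connects n b e \<and> adjA n a b \<and> adjD n d e"
proof -
  assume "cell h n a b d e \<noteq> 0"
  hence "d \<le> n + 1 \<and> e \<le> n + 1 \<and> adjA n a b \<and> connects n a d \<and> connects n b e
     \<or> d = n + 1 \<and> b = n + 2 \<and> (a = n + 1 \<or> a = n + 3) \<and> (e = n + 2 \<or> e = n + 3)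
     \<or> e = n + 1 \<and> a = n + 2 \<and> (b = n + 1 \<or> b = n + 3) \<and> (d = n + 2 \<or> d = n + 3)"
    unfolding cell_def by (auto split: if_splits)
  thus ?thesis
  proof (elim disjE conjE)
    assume "d \<le> n + 1" "e \<le> n + 1" "adjA n a b" "connects n a d" "connects n b e"
    thus ?thesis by (auto simp: adjA_def adjD_def connects_def)
  qed (auto simp: adjA_def adjD_def connects_def)
qed

context
  fixes h :: complex and n :: nat
  assumes h: "h * h = 1 / 2"
begin

text \<open>
  The sum has one term, except over an edge that starts in a leaf.  There the terms for the two
  middle vertices \<open>n + 1\<close> and \<open>n + 3\<close> are the scalar products of \<open>(1, 1) h\<close> and \<open>(- 1, 1) h\<close>.
\<close>

lemma cell_unitary_target:
  assumes "connects n a d" "connects n a d'" "adjD n d e" "adjD n d' e"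
  shows "(\<Sum>b = 1..<2 * n + 4. cell h n a b d e * cell h n a b d' e) = (if d = d' then 1 else 0)"
    (is "sum ?f ?V = _")
proof (cases "d \<le> n + 1")
  case True
  have f: "d' = d" "1 \<le> d" "a = d \<or> a + d = 2 * n + 4" using assms(1,2) True unfolding connects_def by auto
  show ?thesis
  proof (cases "e \<le> n + 1")
    case e: True
    hence de: "1 \<le> e" "e = Suc d \<or> d = Suc e" using assms(3) True unfolding adjD_def by auto
    obtain b where b: "b \<in> ?V" "connects n b e" "adjA n a b"
    proof (cases "a = d")
      case True
      thus ?thesis using that [of e] f de e \<open>d \<le> n + 1\<close> by (auto simp: connects_def adjA_def)
    next
      case False
      then obtain b where "b + e = 2 * n + 4" "a + d = 2 * n + 4" using f e le_Suc_ex [of e "2 * n + 4"] by auto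
      hence "b \<in> ?V" "connects n b e" using de e by (auto simp: connects_def)
      moreover have "b = Suc a \<or> a = Suc b" using de \<open>b + e = _\<close> \<open>a + d = _\<close> by linarith
      hence "adjA n a b" using \<open>b \<in> ?V\<close> \<open>a + d = _\<close> f \<open>d \<le> n + 1\<close> unfolding adjA_def by simp
      ultimately show ?thesis by (rule that)
    qed
    have "sum ?f ?V = ?f b"
    proof (rule sum_supported_on_point)
      fix b' assume "b' \<in> ?V" "?f b' \<noteq> 0"
      hence "connects n b' e" "adjA n a b'" using cell_nonzero [of h n a b' d e] by auto
      moreover have "e \<noteq> n + 1 \<or> a \<noteq> n + 2" using True f by linarith
      ultimately show "b' = b" using adj_connects_unique b e by blast
    qed (use b in auto)
    also have "?f b = 1" using True e f b assms(1) by (simp add: cell_def)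
    finally show ?thesis using f by simp
  next
    case e: False
    hence e': "e = n + 2 \<or> e = n + 3" "d = n + 1" using assms(3) True unfolding adjD_def by auto
    hence a: "a = n + 1 \<or> a = n + 3" using f by auto
    have "sum ?f ?V = ?f (n + 2)"
    proof (rule sum_supported_on_point)
      fix b' assume "b' \<in> ?V" "?f b' \<noteq> 0"
      thus "b' = n + 2" using e' cell_nonzero [of h n a b' d e] connects_leaf [of n e b'] by auto
    qed auto
    also have "\<dots> = 1" using e'(1) a by (elim disjE) (simp_all add: cell_def e'(2) f)
    finally show ?thesis using f by simp
  qed
next
  case False
  have d: "d = n + 2 \<or> d = n + 3" "e = n + 1" "a = n + 2" "d' = n + 2 \<or> d' = n + 3"
  proof -
    show a: "a = n + 2" and d: "d = n + 2 \<or> d = n + 3"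
      using False assms(1) connects_leaf [of n d a] by auto
    show "e = n + 1" using d assms(3) by (auto simp: adjD_def)
    show "d' = n + 2 \<or> d' = n + 3" using assms(2) connects_center a by blast
  qed
  have "sum ?f ?V = ?f (n + 1) + ?f (n + 3)"
  proof (rule sum_pair)
    fix b' assume "b' \<in> ?V" "?f b' \<noteq> 0"
    hence "connects n b' (n + 1)" using d cell_nonzero [of h n a b' d e] by auto
    thus "b' = n + 1 \<or> b' = n + 3" using connects_line [of "n + 1" n b'] by linarith
  qed auto
  also have "\<dots> = (if d = d' then 1 else 0)" using d(1,4) by (elim disjE) (simp_all add: cell_def d(2,3) h)
  finally show ?thesis .
qed

lemma cell_unitary_source:
  assumes "connects n a d" "connects n a' d" "adjA n x a" "adjA n x a'"
  shows "(\<Sum>d' = 1..n + 3. cell h n x a d' d * cell h n x a' d' d) = (if a = a' then 1 else 0)"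
    (is "sum ?f ?V = _")
proof -
  consider "n + 2 \<le> d" | "d \<le> n" | "d = n + 1" "x = n + 2" | "d = n + 1" "x \<noteq> n + 2" by linarith
  thus ?thesis
  proof cases
    case 1
    hence c: "a = n + 2" "a' = n + 2" "d = n + 2 \<or> d = n + 3"
      using assms by (auto simp: connects_leaf)
    have x: "x = n + 1 \<or> x = n + 3" using assms(3) c(1) unfolding adjA_def by linarith
    have "sum ?f ?V = ?f (n + 1)"
    proof (rule sum_supported_on_point)
      fix d' assume "d' \<in> ?V" "?f d' \<noteq> 0"
      hence "connects n x d'" using cell_nonzero [of h n x a d' d] by auto
      moreover have "connects n x (n + 1)" using x by (auto simp: connects_def)
      ultimately show "d' = n + 1" using x connects_unique by force
    qed auto
    also have "\<dots> = 1" using c(3) x by (elim disjE) (simp_all add: cell_def c)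
    finally show ?thesis using c by simp
  next
    case 2
    have c: "a = a'" by (rule adj_connects_unique [OF assms(3,4,1,2)]) (use 2 in auto)
    have "x \<noteq> n + 2"
      using 2 connects_line [of d n a] assms(1,3) unfolding adjA_def by linarith
    hence "1 \<le> x \<and> x \<le> n + 1 \<or> n + 3 \<le> x \<and> x < 2 * n + 4"
      using assms(3) unfolding adjA_def by linarith
    then obtain e where e: "connects n x e" "1 \<le> e" "e \<le> n + 1"
      using that [of x] that [of "2 * n + 4 - x"] by (auto simp: connects_line)
    have "sum ?f ?V = ?f e"
    proof (rule sum_supported_on_point)
      fix d' assume "d' \<in> ?V" "?f d' \<noteq> 0"
      hence "connects n x d'" using cell_nonzero [of h n x a d' d] by auto
      thus "d' = e" using e \<open>x \<noteq> n + 2\<close> connects_unique by blast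
    qed (use e in auto)
    also have "\<dots> = 1" using c e assms(1,3) 2 by (simp add: cell_def)
    finally show ?thesis using c by simp
  next
    case 3
    have c: "a = n + 1 \<or> a = n + 3" "a' = n + 1 \<or> a' = n + 3"
      using assms 3 unfolding adjA_def by linarith+
    have "sum ?f ?V = ?f (n + 2) + ?f (n + 3)"
    proof (rule sum_pair)
      fix d' assume "d' \<in> ?V" "?f d' \<noteq> 0"
      hence "connects n x d'" using cell_nonzero [of h n x a d' d] by auto
      thus "d' = n + 2 \<or> d' = n + 3" using connects_center 3 by blast
    qed auto
    also have "\<dots> = (if a = a' then 1 else 0)" using c by (elim disjE) (simp_all add: cell_def 3 h)
    finally show ?thesis .
  next
    case 4
    have c: "a = a'" by (rule adj_connects_unique [OF assms(3,4,1,2)]) (use 4 in auto)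
    have "1 \<le> x \<and> x \<le> n + 1 \<or> n + 3 \<le> x \<and> x < 2 * n + 4"
      using assms(3) 4(2) unfolding adjA_def by linarith
    then obtain e where e: "connects n x e" "1 \<le> e" "e \<le> n + 1"
      using that [of x] that [of "2 * n + 4 - x"] by (auto simp: connects_line)
    have "sum ?f ?V = ?f e"
    proof (rule sum_supported_on_point)
      fix d' assume "d' \<in> ?V" "?f d' \<noteq> 0"
      hence "connects n x d'" using cell_nonzero [of h n x a d' d] by auto
      thus "d' = e" using e 4(2) connects_unique by blast
    qed (use e in auto)
    also have "\<dots> = 1" using c e assms(1,3) 4 by (simp add: cell_def)
    finally show ?thesis using c by simp
  qed
qed

end

text \<open>
  The reflection of the A diagram preserves the cells up to the sign of the automorphism that
  fixes the leaf \<open>n + 2\<close> and negates the leaf \<open>n + 3\<close>.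
\<close>

definition reflect_sign :: "nat \<Rightarrow> nat \<Rightarrow> nat \<Rightarrow> complex" where
  "reflect_sign n d e = (if d = n + 3 \<or> e = n + 3 then - 1 else 1)"

lemma cell_reflect:
  assumes "a + a' = 2 * n + 4" "b + b' = 2 * n + 4" "1 \<le> a" "1 \<le> b" "1 \<le> a'" "1 \<le> b'"
  shows "cell h n a' b' d e = reflect_sign n d e * cell h n a b d e"
proof -
  have "a' = d \<longleftrightarrow> a + d = 2 * n + 4" "a' + d = 2 * n + 4 \<longleftrightarrow> a = d"
    "b' = e \<longleftrightarrow> b + e = 2 * n + 4" "b' + e = 2 * n + 4 \<longleftrightarrow> b = e"
    using assms by linarith+
  hence f: "connects n a' d \<longleftrightarrow> connects n a d" "connects n b' e \<longleftrightarrow> connects n b e" if "d \<le> n + 1" "e \<le> n + 1"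
    using that by (auto simp: connects_line)
  have "b' = Suc a' \<longleftrightarrow> a = Suc b" "a' = Suc b' \<longleftrightarrow> b = Suc a"
    "a < 2 * n + 4" "b < 2 * n + 4" "a' < 2 * n + 4" "b' < 2 * n + 4"
    using assms by linarith+
  hence g: "adjA n a' b' \<longleftrightarrow> adjA n a b"
    using assms unfolding adjA_def by blast
  have e: "a' = n + 1 \<longleftrightarrow> a = n + 3" "a' = n + 2 \<longleftrightarrow> a = n + 2" "a' = n + 3 \<longleftrightarrow> a = n + 1"
     "b' = n + 1 \<longleftrightarrow> b = n + 3" "b' = n + 2 \<longleftrightarrow> b = n + 2" "b' = n + 3 \<longleftrightarrow> b = n + 1"
    using assms by auto
  show ?thesis
  proof (cases "d \<le> n + 1 \<and> e \<le> n + 1")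
    case True
    thus ?thesis by (simp add: cell_def reflect_sign_def f g)
  next
    case False
    note leaf = this
    show ?thesis
    proof (cases "d = n + 1")
      case True
      hence "\<not> e \<le> n + 1" using leaf by simp
      consider "b \<noteq> n + 2" "b' \<noteq> n + 2" | "b = n + 2" "b' = n + 2" "a = n + 1" "a' = n + 3"
        | "b = n + 2" "b' = n + 2" "a = n + 3" "a' = n + 1"
        | "a \<noteq> n + 1" "a \<noteq> n + 3" "a' \<noteq> n + 1" "a' \<noteq> n + 3"
        using e by argo
      thus ?thesis
      proof cases
        case 1 thus ?thesis using True \<open>\<not> e \<le> n + 1\<close> by (simp add: cell_def reflect_sign_def)
      next
        case 2 thus ?thesis using True \<open>\<not> e \<le> n + 1\<close> by (simp add: cell_def reflect_sign_def)
      next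
        case 3 thus ?thesis using True \<open>\<not> e \<le> n + 1\<close> by (simp add: cell_def reflect_sign_def)
      next
        case 4 thus ?thesis using True \<open>\<not> e \<le> n + 1\<close> by (simp add: cell_def reflect_sign_def)
      qed
    next
      case False
      show ?thesis
      proof (cases "e = n + 1")
        case True
        hence "\<not> d \<le> n + 1" using leaf by simp
        consider "a \<noteq> n + 2" "a' \<noteq> n + 2" | "a = n + 2" "a' = n + 2" "b = n + 1" "b' = n + 3"
          | "a = n + 2" "a' = n + 2" "b = n + 3" "b' = n + 1"
          | "b \<noteq> n + 1" "b \<noteq> n + 3" "b' \<noteq> n + 1" "b' \<noteq> n + 3"
          using e by argo
        thus ?thesis
        proof cases
          case 1 thus ?thesis using False True \<open>\<not> d \<le> n + 1\<close> by (simp add: cell_def reflect_sign_def)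
        next
          case 2 thus ?thesis using False True \<open>\<not> d \<le> n + 1\<close> by (simp add: cell_def reflect_sign_def)
        next
          case 3 thus ?thesis using False True \<open>\<not> d \<le> n + 1\<close> by (simp add: cell_def reflect_sign_def)
        next
          case 4 thus ?thesis using False True \<open>\<not> d \<le> n + 1\<close> by (simp add: cell_def reflect_sign_def)
        qed
      next
        case e: False
        thus ?thesis unfolding cell_def if_not_P [OF leaf] using False by simp
      qed
    qed
  qed
qed

lemma cell_reflect':
  "\<lbrakk>a \<in> {1..<2 * n + 4}; b \<in> {1..<2 * n + 4}\<rbrakk> \<Longrightarrow>
     cell h n (2 * n + 4 - a) (2 * n + 4 - b) d e = reflect_sign n d e * cell h n a b d e"
  by (rule cell_reflect) auto

section \<open>The D-type face weights and their intertwining relation\<close>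

text \<open>
  With \<open>N = 2 n + 4\<close> the vertices \<open>1, \<dots>, N - 1\<close> are those of the A diagram, and \<open>h\<close> is one of the two
  values of \<open>1 / sqrt 2\<close>.
\<close>

locale D_cells = sos_bracket br "2 * n + 4" sq for br :: "complex \<Rightarrow> complex" and n :: nat and sq +
  fixes h :: complex
  assumes h: "h * h = 1 / 2"
begin

text \<open>
  The operator on the D diagram, in the argument order of \<open>weight\<close>.  A walk from leaf
  to leaf has as its coefficient an eigenvalue of the block at the centre of the A diagram: that of \<open>(1, 1)\<close>
  if the leaves agree and that of \<open>(- 1, 1)\<close> otherwise.  For loops at \<open>n + 1\<close>, the block at \<open>n + 1\<close> acts on the vertex \<open>n\<close> and
  the normalised sum of the two leaves, and the identity acts on their difference.
\<close>

definition weightD :: "complex \<Rightarrow> nat \<Rightarrow> nat \<Rightarrow> nat \<Rightarrow> nat \<Rightarrow> complex" where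
  "weightD z d e' e c =
    (let K = of_nat (n + 1); M = of_nat (n + 2) in
     if \<not> (adjD n d e' \<and> adjD n e' c \<and> adjD n d e \<and> adjD n e c) then 0
     else if n + 2 \<le> d \<and> n + 2 \<le> c then
       if d = c then diag_up z M + off_diag z M else diag_up z M - off_diag z M
     else if d \<noteq> c then 1
     else if d \<le> n then weight z d e' e d
     else if e \<le> n \<and> e' \<le> n then diag_down z K
     else if e \<le> n \<or> e' \<le> n then h * off_diag z K
     else if e = e' then (diag_up z K + 1) / 2 else (diag_up z K - 1) / 2)"

text \<open>
  The centre is fixed by the reflection, which exchanges \<open>diag_up\<close> and \<open>diag_down\<close>.
\<close>

lemma diag_center: "diag_down z (of_nat (n + 2)) = diag_up z (of_nat (n + 2))"
proof -
  have eq: "of_nat (2 * n + 4) - (of_nat (n + 2) - z) = of_nat (n + 2) + z" by simp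
  have "br (of_nat (n + 2) + z) = br (of_nat (n + 2) - z)"
    using br_reflect [of "of_nat (n + 2) - z"] unfolding eq .
  thus ?thesis unfolding diag_up_def diag_down_def by (simp only:)
qed

lemma weightD_adj: "weightD z d e' e c \<noteq> 0 \<Longrightarrow> adjD n d e' \<and> adjD n e' c \<and> adjD n d e \<and> adjD n e c"
  unfolding weightD_def Let_def by presburger

text \<open>
  The two sides of the intertwining relation between the A operator and \<open>weightD\<close>.
\<close>

definition face_then_cell where "face_then_cell z a d c x b' e = (\<Sum>b\<in>V. weight z a b' b x * (cell h n a b d e * cell h n b x e c))"
definition cell_then_face where "cell_then_face z a d c x b' e = (\<Sum>e'=1..n + 3. cell h n a b' d e' * cell h n b' x e' c * weightD z d e' e c)"

lemma face_cell_commute_trivial: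
  assumes "\<not> (connects n a d \<and> connects n x c \<and> adjD n d e \<and> adjD n e c \<and> adj a b' \<and> adj b' x)"
  shows "face_then_cell z a d c x b' e = cell_then_face z a d c x b' e"
proof -
  have "face_then_cell z a d c x b' e = 0" unfolding face_then_cell_def
  proof (rule sum_zero, rule ccontr)
    fix b assume "weight z a b' b x * (cell h n a b d e * cell h n b x e c) \<noteq> 0"
    thus False
      using assms cell_nonzero [of h n a b d e] cell_nonzero [of h n b x e c] weight_adj [of z a b' b x] by auto
  qed
  moreover have "cell_then_face z a d c x b' e = 0" unfolding cell_then_face_def
  proof (rule sum_zero, rule ccontr)
    fix e' assume "cell h n a b' d e' * cell h n b' x e' c * weightD z d e' e c \<noteq> 0"
    thus False
      using assms cell_nonzero [of h n a b' d e'] cell_nonzero [of h n b' x e' c] weightD_adj [of z d e' e c]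
      by (auto simp: adjA_def adj_def)
  qed
  ultimately show ?thesis by simp
qed

lemma cell_bulk: "\<lbrakk>adjA n a b; connects n a d; connects n b e; d \<le> n + 1; e \<le> n + 1\<rbrakk> \<Longrightarrow> cell h n a b d e = 1"
  by (simp add: cell_def)

lemma weightD_bulk:
  assumes "d \<le> n + 1" "c \<le> n + 1" "e \<le> n + 1" "e' \<le> n + 1"
    and "adjD n d e'" "adjD n e' c" "adjD n d e" "adjD n e c"
  shows "weightD z d e' e c = weight z d e' e c"
proof -
  have n: "e = Suc d \<or> d = Suc e" "c = Suc e \<or> e = Suc c" "e' = Suc d \<or> d = Suc e'" "c = Suc e' \<or> e' = Suc c"
    using assms by (auto simp: adjD_def)
  show ?thesis
  proof (cases "d = c")
    case False
    hence "e' = e \<and> (e = Suc d \<and> c = Suc e \<or> d = Suc e \<and> e = Suc c)" using n by linarith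
    thus ?thesis using False assms by (auto simp: weightD_def weight_def)
  next
    case True
    show ?thesis
    proof (cases "d \<le> n")
      case le: True
      thus ?thesis using True assms by (simp add: weightD_def)
    next
      case False
      hence "d = n + 1" "e = n" "e' = n" using assms n by linarith+
      thus ?thesis using True assms by (simp add: weightD_def weight_def)
    qed
  qed
qed

text \<open>
  For a walk that starts in a leaf, the upper walk starts in the centre and two upper middle
  vertices contribute.  If it also ends in a leaf, the relation says that \<open>(1, 1)\<close> and \<open>(- 1, 1)\<close> are
  eigenvectors of the block at the centre.
\<close>

lemma face_cell_commute_leaf_start:
  assumes d: "d = n + 2 \<or> d = n + 3"
    and c: "connects n x c" "adjD n d e" "adjD n e c" "adj (n + 2) b'" "adj b' x"
  shows "face_then_cell z (n + 2) d c x b' e = cell_then_face z (n + 2) d c x b' e"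
proof -
  let ?f = "\<lambda>b. weight z (n + 2) b' b x * (cell h n (n + 2) b d e * cell h n b x e c)"
  let ?g = "\<lambda>e'. cell h n (n + 2) b' d e' * cell h n b' x e' c * weightD z d e' e c"
  have e: "e = n + 1" using d c(2) by (auto simp: adjD_def)
  have b': "b' = n + 1 \<or> b' = n + 3" using c(4) by (auto simp: adj_def)
  have l: "face_then_cell z (n + 2) d c x b' e = ?f (n + 1) + ?f (n + 3)"
    unfolding face_then_cell_def
  proof (rule sum_pair)
    fix b assume "?f b \<noteq> 0"
    hence "connects n b (n + 1)" using e cell_nonzero [of h n "n + 2" b d e] by auto
    thus "b = n + 1 \<or> b = n + 3" using connects_line [of "n + 1" n b] by linarith
  qed auto
  have r: "cell_then_face z (n + 2) d c x b' e = ?g (n + 1)"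
    unfolding cell_then_face_def
  proof (rule sum_supported_on_point)
    fix e' assume "?g e' \<noteq> 0"
    hence "adjD n d e'" using weightD_adj [of z d e' e c] by auto
    thus "e' = n + 1" using d by (auto simp: adjD_def)
  qed auto
  show ?thesis
  proof (cases "c = n")
    case True
    have n: "1 \<le> n" using c(3) True by (simp add: adjD_def)
    have "x = n \<or> x = n + 4" using c(1) connects_line [of n n x] True by auto
    hence "x = n \<and> b' = n + 1 \<or> x = n + 4 \<and> b' = n + 3" using b' c(5) by (auto simp: adj_def)
    thus ?thesis unfolding l r using d
      by (elim disjE conjE) (simp_all add: e True n cell_def weight_def weightD_def adjA_def adjD_def connects_def)
  next
    case False
    hence c': "c = n + 2 \<or> c = n + 3" using c(3) e by (auto simp: adjD_def)
    hence "x = n + 2" using c(1) connects_leaf [of n c x] by auto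
    thus ?thesis unfolding l r using d b' c' diag_center [of z]
      by (elim disjE) (simp_all add: e cell_def weight_def weightD_def adjD_def Let_def algebra_simps)
  qed
qed

text \<open>
  For a loop at the branch vertex that visits a leaf, the upper walk passes through the centre.  If the
  upper walk returns, the sum of the two leaves is seen; if it goes straight through, their difference.
\<close>

lemma face_cell_commute_leaf_middle:
  assumes V: "x \<in> V" "b' \<in> V" and e: "e = n + 2 \<or> e = n + 3"
    and c: "connects n x (n + 1)" "adj (n + 1) b'" "adj b' x"
  shows "face_then_cell z (n + 1) (n + 1) (n + 1) x b' e = cell_then_face z (n + 1) (n + 1) (n + 1) x b' e"
proof -
  let ?f = "\<lambda>b. weight z (n + 1) b' b x * (cell h n (n + 1) b (n + 1) e * cell h n b x e (n + 1))"
  let ?g = "\<lambda>e'. cell h n (n + 1) b' (n + 1) e' * cell h n b' x e' (n + 1) * weightD z (n + 1) e' e (n + 1)"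
  have l: "face_then_cell z (n + 1) (n + 1) (n + 1) x b' e = ?f (n + 2)"
    unfolding face_then_cell_def
  proof (rule sum_supported_on_point)
    fix b assume "?f b \<noteq> 0"
    hence "connects n b e" using e cell_nonzero [of h n "n + 1" b "n + 1" e] by auto
    thus "b = n + 2" using e connects_leaf [of n e b] by auto
  qed auto
  have x: "x = n + 1 \<or> x = n + 3" using c(1) connects_line [of "n + 1" n x] by linarith
  have b': "b' = n \<and> x = n + 1 \<or> b' = n + 2" using x c(2,3) by (auto simp: adj_def)
  show ?thesis
  proof (cases "b' = n")
    case True
    hence n: "1 \<le> n" and x: "x = n + 1" using V b' by auto
    have r: "cell_then_face z (n + 1) (n + 1) (n + 1) x b' e = ?g n"
      unfolding cell_then_face_def
    proof (rule sum_supported_on_point)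
      fix e' assume "?g e' \<noteq> 0"
      hence "connects n n e'" using True cell_nonzero [of h n "n + 1" b' "n + 1" e'] by auto
      moreover have "connects n n n" using n by (simp add: connects_def)
      ultimately show "e' = n" using connects_unique [of n n e' n] by simp
    qed (use n in auto)
    show ?thesis unfolding l r using e n
      by (elim disjE) (simp_all add: True x cell_def weight_def weightD_def adjA_def adjD_def connects_def)
  next
    case False
    hence b'': "b' = n + 2" using b' by blast
    have r: "cell_then_face z (n + 1) (n + 1) (n + 1) x b' e = ?g (n + 2) + ?g (n + 3)"
      unfolding cell_then_face_def
    proof (rule sum_pair)
      fix e' assume "?g e' \<noteq> 0"
      hence "connects n (n + 2) e'" using b'' cell_nonzero [of h n "n + 1" b' "n + 1" e'] by auto
      thus "e' = n + 2 \<or> e' = n + 3" using connects_center by blast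
    qed auto
    show ?thesis unfolding l r using e x
      by (elim disjE) (simp_all add: b'' cell_def weight_def weightD_def adjD_def Let_def field_simps)
  qed
qed

text \<open>
  If the lower walk starts on the line and does not turn in a leaf, its lift is unique.  Two leaves can occur
  on the right-hand side only for a loop at the branch vertex, if the upper image passes through the centre.
\<close>

lemma face_cell_commute_line_start:
  assumes V: "x \<in> V" "b' \<in> V" and de: "d \<le> n + 1" "e \<le> n + 1"
    and c: "connects n x c" "adjD n d e" "adjD n e c" "adj d b'" "adj b' x"
  shows "face_then_cell z d d c x b' e = cell_then_face z d d c x b' e"
proof -
  let ?f = "\<lambda>b. weight z d b' b x * (cell h n d b d e * cell h n b x e c)"
  let ?g = "\<lambda>e'. cell h n d b' d e' * cell h n b' x e' c * weightD z d e' e c"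
  have e1: "1 \<le> d" "1 \<le> e" "e = Suc d \<or> d = Suc e" using c(2) de by (auto simp: adjD_def)
  have conn: "connects n d d" "connects n e e" using e1 de by (simp_all add: connects_def)
  have adj_de: "adjA n d e" using e1 de by (auto simp: adjA_def)
  have l: "face_then_cell z d d c x b' e = ?f e"
    unfolding face_then_cell_def
  proof (rule sum_supported_on_point)
    fix b assume "?f b \<noteq> 0"
    hence "connects n b e" "adjA n d b" using cell_nonzero [of h n d b d e] by auto
    thus "b = e" using adj_connects_unique [of n d b e e] adj_de conn de by linarith
  qed (use e1 de in auto)
  have lf: "?f e = weight z d b' e x * cell h n e x e c"
    using cell_bulk [OF adj_de conn de] by simp
  show ?thesis
  proof (cases "b' = n + 2")
    case True
    hence d: "d = n + 1" and e: "e = n" using c(4) de e1 by (auto simp: adj_def)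
    have c': "c \<le> n + 1" using c(3) e by (auto simp: adjD_def)
    have x: "x = n + 1 \<or> x = n + 3" using c(5) True by (auto simp: adj_def)
    have cc: "c = n + 1" using x c(1) connects_line [OF c', of x] c(3) e by (auto simp: adjD_def)
    have r: "cell_then_face z d d c x b' e = ?g (n + 2) + ?g (n + 3)"
      unfolding cell_then_face_def
    proof (rule sum_pair)
      fix e' assume "?g e' \<noteq> 0"
      hence "connects n (n + 2) e'" using True cell_nonzero [of h n d b' d e'] by auto
      thus "e' = n + 2 \<or> e' = n + 3" using connects_center by blast
    qed auto
    show ?thesis unfolding l r lf using x e1
      by (elim disjE) (simp_all add: d e cc True cell_def weight_def weightD_def adjA_def adjD_def connects_def h)
  next
    case False
    hence b': "b' \<le> n + 1" "1 \<le> b'" "b' = Suc d \<or> d = Suc b'"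
      using c(4) V(2) de(1) unfolding adj_def by auto
    have conn': "connects n b' b'" using b' by (simp add: connects_def)
    have adj': "adjA n d b'" using b' e1 de by (auto simp: adjA_def)
    have r: "cell_then_face z d d c x b' e = ?g b'"
      unfolding cell_then_face_def
    proof (rule sum_supported_on_point)
      fix e' assume "?g e' \<noteq> 0"
      hence "connects n b' e'" using cell_nonzero [of h n d b' d e'] by auto
      thus "e' = b'" using conn' connects_unique [of n b' e' b'] False by simp
    qed (use b' in auto)
    have rf: "?g b' = cell h n b' x b' c * weightD z d b' e c"
      using cell_bulk [OF adj' conn(1) conn' de(1) b'(1)] by simp
    have x: "x \<le> n + 2" using c(5) b' unfolding adj_def by linarith
    show ?thesis
    proof (cases "c \<le> n + 1")
      case True
      have xc: "x = c" using x True c(1) connects_line [OF True, of x] by linarith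
      have c1: "1 \<le> c" using c(3) by (simp add: adjD_def)
      have "cell h n e x e c = 1"
      proof (rule cell_bulk [OF _ conn(2) c(1) de(2) True])
        have "e = Suc c \<or> c = Suc e" using c(3) True de by (auto simp: adjD_def)
        thus "adjA n e x" using xc c1 e1 de True by (auto simp: adjA_def)
      qed
      moreover have "cell h n b' x b' c = 1"
        by (rule cell_bulk [OF _ conn' c(1) b'(1) True])
          (use c(5) xc c1 b' True in \<open>auto simp: adjA_def adj_def\<close>)
      moreover have "weightD z d b' e c = weight z d b' e c"
      proof (rule weightD_bulk [OF de(1) True de(2) b'(1)])
        show "adjD n d b'" using b' e1 de by (auto simp: adjD_def)
        show "adjD n b' c" using c(5) xc c1 b' True by (auto simp: adjD_def adj_def)
      qed (rule c)+
      ultimately show ?thesis unfolding l r lf rf by (simp add: xc)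
    next
      case False
      hence c': "c = n + 2 \<or> c = n + 3" "e = n + 1" using c(3) de by (auto simp: adjD_def)
      have x2: "x = n + 2" using c(1) False connects_leaf [of n c x] by auto
      have d: "d = n" using e1 c' de by auto
      have b2: "b' = n + 1" using c(5) x2 b' unfolding adj_def by linarith
      show ?thesis unfolding l r lf rf using c'(1) e1
        by (elim disjE) (simp_all add: c'(2) d b2 x2 weight_def weightD_def adjD_def)
    qed
  qed
qed

lemma face_cell_commute_left:
  assumes V: "a \<in> V" "x \<in> V" "b' \<in> V" and a: "a \<le> n + 2"
    and c: "connects n a d" "connects n x c" "adjD n d e" "adjD n e c" "adj a b'" "adj b' x"
  shows "face_then_cell z a d c x b' e = cell_then_face z a d c x b' e"
proof (cases "n + 2 \<le> d")
  case True
  hence "a = n + 2" "d = n + 2 \<or> d = n + 3" using c(1) connects_leaf [of n d a] by auto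
  thus ?thesis using face_cell_commute_leaf_start c by blast
next
  case False
  hence ad: "a = d" "d \<le> n + 1" using c(1) a connects_line [of d n a] by linarith+
  show ?thesis
  proof (cases "e \<le> n + 1")
    case True
    thus ?thesis using face_cell_commute_line_start [OF V(2,3) ad(2) True] c ad by blast
  next
    case False
    hence "d = n + 1" "c = n + 1" "e = n + 2 \<or> e = n + 3" using c(3,4) ad by (auto simp: adjD_def)
    thus ?thesis using face_cell_commute_leaf_middle V c ad by blast
  qed
qed

text \<open>
  The reflection multiplies both sides by the same sign, hence the upper walk may be assumed to
  start at a vertex up to the centre of the A diagram.
\<close>

lemma face_cell_commute:
  assumes V: "a \<in> V" "x \<in> V" "b' \<in> V"
  shows "face_then_cell z a d c x b' e = cell_then_face z a d c x b' e"
proof (cases "a \<le> n + 2")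
  case True
  show ?thesis
  proof (cases "connects n a d \<and> connects n x c \<and> adjD n d e \<and> adjD n e c \<and> adj a b' \<and> adj b' x")
    case c: True
    show ?thesis by (rule face_cell_commute_left [OF V True]) (use c in simp_all)
  qed (rule face_cell_commute_trivial)
next
  case False
  define r where "r a = 2 * n + 4 - a" for a
  have rV: "r a \<in> V" "r (r a) = a" if "a \<in> V" for a using that by (auto simp: r_def)
  have "face_then_cell z (r a) d c (r x) (r b') e = cell_then_face z (r a) d c (r x) (r b') e"
  proof (cases "connects n (r a) d \<and> connects n (r x) c \<and> adjD n d e \<and> adjD n e c \<and> adj (r a) (r b') \<and> adj (r b') (r x)")
    case True
    have "r a \<le> n + 2" using False by (auto simp: r_def)
    show ?thesis by (rule face_cell_commute_left [OF rV(1) [OF V(1)] rV(1) [OF V(2)] rV(1) [OF V(3)] \<open>r a \<le> n + 2\<close>]) (use True in simp_all)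
  qed (rule face_cell_commute_trivial)
  moreover have "face_then_cell z (r a) d c (r x) (r b') e = reflect_sign n d e * reflect_sign n e c * face_then_cell z a d c x b' e"
    unfolding face_then_cell_def
  proof (subst sum_reflect, unfold sum_distrib_left, rule sum.cong [OF refl])
    fix b assume b: "b \<in> V"
    show "weight z (r a) (r b') (2 * n + 4 - b) (r x) * (cell h n (r a) (2 * n + 4 - b) d e * cell h n (2 * n + 4 - b) (r x) e c)
       = reflect_sign n d e * reflect_sign n e c * (weight z a b' b x * (cell h n a b d e * cell h n b x e c))"
      unfolding r_def weight_reflect' [OF V(1,3) b V(2)] cell_reflect' [OF V(1) b] cell_reflect' [OF b V(2)]
      by (simp only: mult_ac)
  qed
  moreover have "cell_then_face z (r a) d c (r x) (r b') e = reflect_sign n d e * reflect_sign n e c * cell_then_face z a d c x b' e"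
    unfolding cell_then_face_def sum_distrib_left
  proof (rule sum.cong [OF refl])
    fix e'
    show "cell h n (r a) (r b') d e' * cell h n (r b') (r x) e' c * weightD z d e' e c =
       reflect_sign n d e * reflect_sign n e c * (cell h n a b' d e' * cell h n b' x e' c * weightD z d e' e c)"
    proof (cases "weightD z d e' e c = 0")
      case False
      have "reflect_sign n d e' * reflect_sign n e' c = reflect_sign n d e * reflect_sign n e c"
      proof (cases "d = n + 3 \<or> c = n + 3")
        case True
        have "adjD n x y \<Longrightarrow> x = n + 3 \<Longrightarrow> y = n + 1" "adjD n x y \<Longrightarrow> y = n + 3 \<Longrightarrow> x = n + 1" for x y
          by (auto simp: adjD_def)
        hence "e' = e" using True weightD_adj [OF False] by blast
        thus ?thesis by simp
      next
        case False
        thus ?thesis by (simp add: reflect_sign_def)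
      qed
      note sign = this
      have "cell h n (r a) (r b') d e' * cell h n (r b') (r x) e' c * weightD z d e' e c
        = (reflect_sign n d e' * reflect_sign n e' c) * (cell h n a b' d e' * cell h n b' x e' c * weightD z d e' e c)"
        unfolding r_def cell_reflect' [OF V(1,3)] cell_reflect' [OF V(3,2)] by (simp only: mult_ac)
      thus ?thesis unfolding sign .
    qed simp
  qed
  moreover have "reflect_sign n d e * reflect_sign n e c \<noteq> 0" by (simp add: reflect_sign_def)
  ultimately show ?thesis by simp
qed

end

section \<open>Operators on walks of length two and three\<close>

definition wf_graph :: "nat pair_pre_digraph \<Rightarrow> bool" where
  "wf_graph K \<longleftrightarrow> finite (pverts K) \<and> parcs K \<subseteq> pverts K \<times> pverts K"

context
  fixes K :: "nat pair_pre_digraph"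
  assumes K: "wf_graph K"
begin

lemma arc_verts: "(x, y) \<in> parcs K \<Longrightarrow> x \<in> pverts K" "(x, y) \<in> parcs K \<Longrightarrow> y \<in> pverts K"
  using K by (auto simp: wf_graph_def)

lemma mem_walks: "p \<in> walks K m x y \<longleftrightarrow> x \<in> pverts K \<and> set p \<subseteq> parcs K \<and> pcas x p y \<and> length p = m"
  by (simp add: walks_def pre_digraph.awalk_def cas_with_proj_eq)

lemma walks_1: "p \<in> walks K 1 x y \<longleftrightarrow> p = [(x, y)] \<and> (x, y) \<in> parcs K"
  unfolding mem_walks using arc_verts by (auto simp: length_Suc_conv)

lemma walks_2: "p \<in> walks K 2 x y \<longleftrightarrow> (\<exists>b. p = [(x, b), (b, y)] \<and> (x, b) \<in> parcs K \<and> (b, y) \<in> parcs K)"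
  unfolding mem_walks using arc_verts by (auto simp: length_Suc_conv numeral_2_eq_2)

lemma walks_3: "p \<in> walks K 3 x y \<longleftrightarrow>
    (\<exists>b c. p = [(x, b), (b, c), (c, y)] \<and> (x, b) \<in> parcs K \<and> (b, c) \<in> parcs K \<and> (c, y) \<in> parcs K)"
  unfolding mem_walks using arc_verts by (auto simp: length_Suc_conv numeral_3_eq_3)

lemma all_walks_1: "p \<in> all_walks K 1 \<longleftrightarrow> (\<exists>x y. p = [(x, y)] \<and> (x, y) \<in> parcs K)"
  unfolding all_walks_def using arc_verts by (auto simp: walks_1 simp del: One_nat_def)

lemma all_walks_2: "p \<in> all_walks K 2 \<longleftrightarrow>
    (\<exists>x b y. p = [(x, b), (b, y)] \<and> (x, b) \<in> parcs K \<and> (b, y) \<in> parcs K)"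
  unfolding all_walks_def using arc_verts by (auto simp: walks_2)

lemma all_walks_3: "p \<in> all_walks K 3 \<longleftrightarrow>
    (\<exists>x b c y. p = [(x, b), (b, c), (c, y)] \<and> (x, b) \<in> parcs K \<and> (b, c) \<in> parcs K \<and> (c, y) \<in> parcs K)"
  unfolding all_walks_def using arc_verts by (auto simp: walks_3)

lemma finite_parcs: "finite (parcs K)"
  using K finite_subset unfolding wf_graph_def by fastforce

lemma finite_all_walks: "finite (all_walks K m)"
proof (rule finite_subset)
  show "all_walks K m \<subseteq> {p. set p \<subseteq> parcs K \<and> length p = m}"
    unfolding all_walks_def by (auto simp: mem_walks)
  show "finite {p. set p \<subseteq> parcs K \<and> length p = m}"
    by (rule finite_lists_length_eq [OF finite_parcs])
qed

lemma sum_all_walks_1: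
  assumes "\<And>p. p \<noteq> [(x, y)] \<Longrightarrow> F p = 0" and "(x, y) \<notin> parcs K \<Longrightarrow> F [(x, y)] = (0::complex)"
  shows "(\<Sum>p\<in>all_walks K 1. F p) = F [(x, y)]"
proof -
  have "(\<Sum>p\<in>all_walks K 1. F p) = (\<Sum>p\<in>{[(x, y)]}. F p)"
    by (rule sum.mono_neutral_cong) (use assms finite_all_walks all_walks_1 in auto)
  thus ?thesis by simp
qed

lemma sum_all_walks_2:
  assumes "\<And>u b v. (u, v) \<noteq> (x, y) \<Longrightarrow> F [(u, b), (b, v)] = 0"
    and "\<And>b. \<not> ((x, b) \<in> parcs K \<and> (b, y) \<in> parcs K) \<Longrightarrow> F [(x, b), (b, y)] = (0::complex)"
  shows "(\<Sum>p\<in>all_walks K 2. F p) = (\<Sum>b\<in>pverts K. F [(x, b), (b, y)])"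
proof -
  have "(\<Sum>p\<in>all_walks K 2. F p) = (\<Sum>p\<in>(\<lambda>b. [(x, b), (b, y)]) ` pverts K. F p)"
  proof (rule sum.mono_neutral_cong)
    show "finite (all_walks K 2)" by (rule finite_all_walks)
    show "finite ((\<lambda>b. [(x, b), (b, y)]) ` pverts K)" using K by (simp add: wf_graph_def)
    fix p assume p: "p \<in> all_walks K 2 - (\<lambda>b. [(x, b), (b, y)]) ` pverts K"
    then obtain u b v where p': "p = [(u, b), (b, v)]" "(u, b) \<in> parcs K" "(b, v) \<in> parcs K" by (auto simp: all_walks_2)
    hence "(u, v) \<noteq> (x, y)" using p arc_verts(2) [OF p'(2)] by auto
    thus "F p = 0" using assms(1) p'(1) by simp
  next
    fix p assume p: "p \<in> (\<lambda>b. [(x, b), (b, y)]) ` pverts K - all_walks K 2"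
    then obtain b where "p = [(x, b), (b, y)]" by auto
    thus "F p = 0" using p assms(2) by (auto simp: all_walks_2)
  qed auto
  also have "\<dots> = (\<Sum>b\<in>pverts K. F [(x, b), (b, y)])"
    by (subst sum.reindex) (auto simp: inj_on_def)
  finally show ?thesis .
qed

definition walk3 :: "nat \<Rightarrow> nat \<Rightarrow> nat \<times> nat \<Rightarrow> (nat \<times> nat) list" where
  "walk3 x y i = [(x, fst i), i, (snd i, y)]"

definition is_walk3 :: "nat \<Rightarrow> nat \<Rightarrow> nat \<times> nat \<Rightarrow> bool" where
  "is_walk3 x y i \<longleftrightarrow> (x, fst i) \<in> parcs K \<and> i \<in> parcs K \<and> (snd i, y) \<in> parcs K"

lemma all_walks_3': "p \<in> all_walks K 3 \<longleftrightarrow> (\<exists>x y i. p = walk3 x y i \<and> is_walk3 x y i)"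
  unfolding all_walks_3 walk3_def is_walk3_def by (auto; metis)

lemma walk3_eq_iff [simp]: "walk3 x y i = walk3 x' y' i' \<longleftrightarrow> x = x' \<and> y = y' \<and> i = i'"
  by (auto simp: walk3_def)

lemma sum_all_walks_3:
  assumes "\<And>u v i. (u, v) \<noteq> (x, y) \<Longrightarrow> is_walk3 u v i \<Longrightarrow> F (walk3 u v i) = 0"
  shows "(\<Sum>p\<in>all_walks K 3. F p) = (\<Sum>i\<in>pverts K \<times> pverts K. if is_walk3 x y i then F (walk3 x y i) else (0::complex))"
proof -
  have fin: "finite (pverts K \<times> pverts K)" using K by (simp add: wf_graph_def)
  have "(\<Sum>p\<in>all_walks K 3. F p) = (\<Sum>p\<in>walk3 x y ` {i \<in> pverts K \<times> pverts K. is_walk3 x y i}. F p)"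
  proof (rule sum.mono_neutral_right)
    show "finite (all_walks K 3)" by (rule finite_all_walks)
    show "walk3 x y ` {i \<in> pverts K \<times> pverts K. is_walk3 x y i} \<subseteq> all_walks K 3"
      by (auto simp: all_walks_3')
    show "\<forall>p\<in>all_walks K 3 - walk3 x y ` {i \<in> pverts K \<times> pverts K. is_walk3 x y i}. F p = 0"
    proof
      fix p assume p: "p \<in> all_walks K 3 - walk3 x y ` {i \<in> pverts K \<times> pverts K. is_walk3 x y i}"
      then obtain u v i where p': "p = walk3 u v i" "is_walk3 u v i" by (auto simp: all_walks_3')
      have "i \<in> pverts K \<times> pverts K" using p'(2) arc_verts unfolding is_walk3_def by (cases i) auto
      hence "(u, v) \<noteq> (x, y)" using p p' by auto
      thus "F p = 0" using assms p' by simp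
    qed
  qed
  also have "\<dots> = (\<Sum>i\<in>{i \<in> pverts K \<times> pverts K. is_walk3 x y i}. F (walk3 x y i))"
    by (subst sum.reindex) (auto simp: inj_on_def)
  also have "\<dots> = (\<Sum>i\<in>pverts K \<times> pverts K. if is_walk3 x y i then F (walk3 x y i) else 0)"
    by (rule sum.inter_filter [OF fin])
  finally show ?thesis .
qed

text \<open>
  \<open>M\<close> is block diagonal with respect to the end points, and its block between \<open>x\<close> and \<open>y\<close> is the matrix
  \<open>T x y\<close> in the coordinates given by the two inner vertices.  The second condition allows sums over all
  pairs of vertices to replace sums over walks.
\<close>

definition represents :: "linmap \<Rightarrow> (nat \<Rightarrow> nat \<Rightarrow> nat \<times> nat \<Rightarrow> nat \<times> nat \<Rightarrow> complex) \<Rightarrow> bool" where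
  "represents M T \<longleftrightarrow>
    (\<forall>x y i u v j. is_walk3 u v i \<longrightarrow> is_walk3 x y j \<longrightarrow>
        M (walk3 u v i) (walk3 x y j) = (if (u, v) = (x, y) then T x y i j else 0))
  \<and> (\<forall>x y i j. is_walk3 x y j \<longrightarrow> \<not> is_walk3 x y i \<longrightarrow> T x y i j = 0)"

lemma representsD:
  assumes "represents M T"
  shows "\<lbrakk>is_walk3 u v i; is_walk3 x y j\<rbrakk> \<Longrightarrow> M (walk3 u v i) (walk3 x y j) = (if (u, v) = (x, y) then T x y i j else 0)"
    and "\<lbrakk>is_walk3 x y j; \<not> is_walk3 x y i\<rbrakk> \<Longrightarrow> T x y i j = 0"
  using assms unfolding represents_def by blast+

lemma represents_comp:
  assumes M: "represents M S" and N: "represents N T"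
  shows "represents (comp_map (all_walks K 3) M N) (\<lambda>x y. mat_comp (pverts K \<times> pverts K) (S x y) (T x y))"
  unfolding represents_def
proof (intro conjI allI impI)
  fix x y i u v j assume w: "is_walk3 u v i" "is_walk3 x y j"
  have "comp_map (all_walks K 3) M N (walk3 u v i) (walk3 x y j)
     = (\<Sum>k\<in>pverts K \<times> pverts K. if is_walk3 x y k then M (walk3 u v i) (walk3 x y k) * N (walk3 x y k) (walk3 x y j) else 0)"
    unfolding comp_map_def by (rule sum_all_walks_3) (auto simp: representsD(1) [OF N] w)
  also have "\<dots> = (\<Sum>k\<in>pverts K \<times> pverts K. if (u, v) = (x, y) then S x y i k * T x y k j else 0)"
    by (intro sum.cong refl) (use w in \<open>auto simp: representsD [OF M] representsD [OF N]\<close>)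
  also have "\<dots> = (if (u, v) = (x, y) then mat_comp (pverts K \<times> pverts K) (S x y) (T x y) i j else 0)"
    by (auto simp: mat_comp_def)
  finally show "comp_map (all_walks K 3) M N (walk3 u v i) (walk3 x y j)
     = (if (u, v) = (x, y) then mat_comp (pverts K \<times> pverts K) (S x y) (T x y) i j else 0)" .
next
  fix x y i j assume w: "is_walk3 x y j" "\<not> is_walk3 x y i"
  have "S x y i k * T x y k j = 0" for k
    using representsD(2) [OF M] representsD(2) [OF N] w by (cases "is_walk3 x y k") auto
  thus "mat_comp (pverts K \<times> pverts K) (S x y) (T x y) i j = 0"
    unfolding mat_comp_def by (intro sum.neutral) blast
qed

definition represents2 :: "linmap \<Rightarrow> face \<Rightarrow> bool" where
  "represents2 M s \<longleftrightarrow> face_on (parcs K) s \<and>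
    (\<forall>x b y u c v. (u, c) \<in> parcs K \<longrightarrow> (c, v) \<in> parcs K \<longrightarrow> (x, b) \<in> parcs K \<longrightarrow> (b, y) \<in> parcs K \<longrightarrow>
      M [(u, c), (c, v)] [(x, b), (b, y)] = (if (u, v) = (x, y) then s x c b y else 0))"

lemma represents_map12:
  assumes "represents2 M s"
  shows "represents (map12 M) (\<lambda>x y. face12 s x)"
  unfolding represents_def
proof (intro conjI allI impI)
  fix x y i u v j assume w: "is_walk3 u v i" "is_walk3 x y j"
  obtain i1 i2 j1 j2 where ij: "i = (i1, i2)" "j = (j1, j2)" by (cases i, cases j)
  have "M [(u, i1), (i1, i2)] [(x, j1), (j1, j2)] = (if (u, i2) = (x, j2) then s x i1 j1 j2 else 0)"
    using assms w unfolding represents2_def is_walk3_def ij by auto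
  thus "map12 M (walk3 u v i) (walk3 x y j) = (if (u, v) = (x, y) then face12 s x i j else 0)"
    by (auto simp: map12_def tensor_map_def id_map_def walk3_def ij face12_def)
next
  fix x y i j assume w: "is_walk3 x y j" "\<not> is_walk3 x y i"
  obtain i1 i2 j1 j2 where ij: "i = (i1, i2)" "j = (j1, j2)" by (cases i, cases j)
  have "face_on (parcs K) s" using assms by (simp add: represents2_def)
  from face_onD [OF this, of x i1 j1 j2] show "face12 s x i j = 0"
    using w by (cases "s x i1 j1 j2 = 0") (auto simp: face12_def is_walk3_def ij)
qed

lemma represents_map23:
  assumes "represents2 M s"
  shows "represents (map23 M) (\<lambda>x y. face23 s y)"
  unfolding represents_def
proof (intro conjI allI impI)
  fix x y i u v j assume w: "is_walk3 u v i" "is_walk3 x y j"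
  obtain i1 i2 j1 j2 where ij: "i = (i1, i2)" "j = (j1, j2)" by (cases i, cases j)
  have "M [(i1, i2), (i2, v)] [(j1, j2), (j2, y)] = (if (i1, v) = (j1, y) then s j1 i2 j2 y else 0)"
    using assms w unfolding represents2_def is_walk3_def ij by auto
  thus "map23 M (walk3 u v i) (walk3 x y j) = (if (u, v) = (x, y) then face23 s y i j else 0)"
    by (auto simp: map23_def tensor_map_def id_map_def walk3_def ij face23_def)
next
  fix x y i j assume w: "is_walk3 x y j" "\<not> is_walk3 x y i"
  obtain i1 i2 j1 j2 where ij: "i = (i1, i2)" "j = (j1, j2)" by (cases i, cases j)
  have "face_on (parcs K) s" using assms by (simp add: represents2_def)
  from face_onD [OF this, of j1 i2 j2 y] show "face23 s y i j = 0"
    using w by (cases "s j1 i2 j2 y = 0") (auto simp: face23_def is_walk3_def ij)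
qed

end

text \<open>
  A transfer operator of degree one whose matrix entries are the cells, together with the transposed
  operator.
\<close>

locale graph_cells = cell_system VA VD EA ED P C
  for VA VD :: "nat set" and EA ED P :: "(nat \<times> nat) set" and C :: "nat \<Rightarrow> nat \<Rightarrow> nat \<Rightarrow> nat \<Rightarrow> complex" +
  fixes G H :: "nat pair_pre_digraph" and f g :: transfer
  assumes G: "pverts G = VA" "parcs G = EA" "wf_graph G"
    and H: "pverts H = VD" "parcs H = ED" "wf_graph H"
    and f_def: "f \<beta>1 \<beta>2 q p = (if p = [(fst \<beta>2, fst \<beta>1)] \<and> q = [(snd \<beta>2, snd \<beta>1)]
       then C (fst \<beta>2) (fst \<beta>1) (snd \<beta>2) (snd \<beta>1) else 0)"
    and g_def: "g \<beta>2 \<beta>1 q p = (if p = [(snd \<beta>2, snd \<beta>1)] \<and> q = [(fst \<beta>2, fst \<beta>1)]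
       then C (fst \<beta>2) (fst \<beta>1) (snd \<beta>2) (snd \<beta>1) else 0)"
    and cell_counitary: "\<lbrakk>(a, d) \<in> P; (a', d) \<in> P; (x, a) \<in> EA; (x, a') \<in> EA\<rbrakk>
      \<Longrightarrow> (\<Sum>d'\<in>VD. C x a d' d * C x a' d' d) = (if a = a' then 1 else 0)"
begin

lemma finite_P: "finite P"
  using P_subset finite_VA finite_VD by (meson finite_SigmaI finite_subset)

lemma sum_arrows_from:
  assumes "\<And>d. (x, d) \<notin> P \<Longrightarrow> F (x, d) = (0::complex)"
  shows "(\<Sum>\<beta> | \<beta> \<in> P \<and> fst \<beta> = x. F \<beta>) = (\<Sum>d\<in>VD. F (x, d))"
proof -
  have "(\<Sum>\<beta> | \<beta> \<in> P \<and> fst \<beta> = x. F \<beta>) = (\<Sum>\<beta>\<in>Pair x ` VD. F \<beta>)"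
    by (rule sum.mono_neutral_left) (use assms P_subset finite_VD in auto)
  also have "\<dots> = (\<Sum>d\<in>VD. F (x, d))" by (subst sum.reindex) (auto simp: inj_on_def)
  finally show ?thesis .
qed

lemma sum_arrows_to:
  assumes "\<And>a. (a, c) \<notin> P \<Longrightarrow> F (a, c) = (0::complex)"
  shows "(\<Sum>\<beta> | \<beta> \<in> P \<and> snd \<beta> = c. F \<beta>) = (\<Sum>a\<in>VA. F (a, c))"
proof -
  have "(\<Sum>\<beta> | \<beta> \<in> P \<and> snd \<beta> = c. F \<beta>) = (\<Sum>\<beta>\<in>(\<lambda>a. (a, c)) ` VA. F \<beta>)"
    by (rule sum.mono_neutral_left) (use assms P_subset finite_VA in auto)
  also have "\<dots> = (\<Sum>a\<in>VA. F (a, c))" by (subst sum.reindex) (auto simp: inj_on_def)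
  finally show ?thesis .
qed

proposition transfer_inverse: "is_transfer_inverse G H P 1 f g"
  unfolding is_transfer_inverse_def
proof (intro conjI ballI impI)
  show "f \<in> transfer_sections G H P 1"
    unfolding transfer_sections_def using cell_support G H
    by (auto simp: f_def walks_1 simp del: One_nat_def split: if_splits)
  show "g \<in> cotransfer_sections G H P 1"
    unfolding cotransfer_sections_def using cell_support G H
    by (auto simp: g_def walks_1 simp del: One_nat_def split: if_splits)
next
  fix \<beta>1 \<beta>2 x p q assume b: "\<beta>1 \<in> P" "\<beta>2 \<in> P" "tgt \<beta>1 = tgt \<beta>2" "x \<in> pverts G"
    "p \<in> walks G 1 x (src \<beta>1)" "q \<in> walks G 1 x (src \<beta>2)"
  obtain a1 a2 d where bb: "\<beta>1 = (a1, d)" "\<beta>2 = (a2, d)" using b(3) by (cases \<beta>1; cases \<beta>2) auto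
  have pq: "p = [(x, a1)]" "q = [(x, a2)]" "(x, a1) \<in> EA" "(x, a2) \<in> EA"
    using b(5,6) G by (auto simp: walks_1 bb simp del: One_nat_def)
  have "comp_map (all_walks H 1) (g (x, d') \<beta>2) (f \<beta>1 (x, d')) q p = C x a1 d' d * C x a2 d' d" for d'
  proof -
    have "comp_map (all_walks H 1) (g (x, d') \<beta>2) (f \<beta>1 (x, d')) q p
        = g (x, d') \<beta>2 q [(d', d)] * f \<beta>1 (x, d') [(d', d)] p"
      unfolding comp_map_def
      by (rule sum_all_walks_1 [OF H(3)]) (use cell_support H in \<open>auto simp: f_def g_def bb\<close>)
    thus ?thesis by (simp add: f_def g_def bb pq)
  qed
  moreover have "C x a1 d' d = 0" if "(x, d') \<notin> P" for d' using cell_support that by blast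
  ultimately have "(\<Sum>\<beta> | \<beta> \<in> P \<and> src \<beta> = x. comp_map (all_walks H 1) (g \<beta> \<beta>2) (f \<beta>1 \<beta>) q p)
      = (\<Sum>d'\<in>VD. C x a1 d' d * C x a2 d' d)"
    by (subst sum_arrows_from) auto
  also have "\<dots> = (if a1 = a2 then 1 else 0)"
    using cell_counitary b pq by (simp add: bb)
  finally show "(\<Sum>\<beta> | \<beta> \<in> P \<and> src \<beta> = x. comp_map (all_walks H 1) (g \<beta> \<beta>2) (f \<beta>1 \<beta>) q p)
      = (if \<beta>1 = \<beta>2 then id_map q p else 0)"
    by (simp add: bb pq id_map_def)
next
  fix \<beta>1 \<beta>2 c p q assume b: "\<beta>1 \<in> P" "\<beta>2 \<in> P" "src \<beta>1 = src \<beta>2" "c \<in> pverts H"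
    "p \<in> walks H 1 (tgt \<beta>1) c" "q \<in> walks H 1 (tgt \<beta>2) c"
  obtain d1 d2 a where bb: "\<beta>1 = (a, d1)" "\<beta>2 = (a, d2)" using b(3) by (cases \<beta>1; cases \<beta>2) auto
  have pq: "p = [(d1, c)]" "q = [(d2, c)]" "(d1, c) \<in> ED" "(d2, c) \<in> ED"
    using b(5,6) H by (auto simp: walks_1 bb simp del: One_nat_def)
  have "comp_map (all_walks G 1) (f (x, c) \<beta>2) (g \<beta>1 (x, c)) q p = C a x d1 c * C a x d2 c" for x
  proof -
    have "comp_map (all_walks G 1) (f (x, c) \<beta>2) (g \<beta>1 (x, c)) q p
        = f (x, c) \<beta>2 q [(a, x)] * g \<beta>1 (x, c) [(a, x)] p"
      unfolding comp_map_def
      by (rule sum_all_walks_1 [OF G(3)]) (use cell_support G in \<open>auto simp: f_def g_def bb\<close>)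
    thus ?thesis by (simp add: f_def g_def bb pq)
  qed
  moreover have "C a x d1 c = 0" if "(x, c) \<notin> P" for x using cell_support that by blast
  ultimately have "(\<Sum>\<beta> | \<beta> \<in> P \<and> tgt \<beta> = c. comp_map (all_walks G 1) (f \<beta> \<beta>2) (g \<beta>1 \<beta>) q p)
      = (\<Sum>x\<in>VA. C a x d1 c * C a x d2 c)"
    by (subst sum_arrows_to) auto
  also have "\<dots> = (if d1 = d2 then 1 else 0)"
    using cell_unitary b pq by (simp add: bb)
  finally show "(\<Sum>\<beta> | \<beta> \<in> P \<and> tgt \<beta> = c. comp_map (all_walks G 1) (f \<beta> \<beta>2) (g \<beta>1 \<beta>) q p)
      = (if \<beta>1 = \<beta>2 then id_map q p else 0)"
    by (simp add: bb pq id_map_def)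
qed

text \<open>
  Only the arrow \<open>(b, e)\<close> fits between the two squares, so the sum over middle arrows collapses.
\<close>

lemma fuse_eq:
  "fuse P 1 f f (x, c) (a, d) [(s, e), (e, t)] [(u, b), (b, v)]
     = (if s = d \<and> t = c \<and> u = a \<and> v = x then cell2 a d c x b e else 0)"
proof -
  have "fuse P 1 f f (x, c) (a, d) [(s, e), (e, t)] [(u, b), (b, v)]
     = (\<Sum>\<gamma>\<in>P. if \<gamma> = (b, e) then (if s = d \<and> t = c \<and> u = a \<and> v = x then cell2 a d c x b e else 0) else 0)"
    unfolding fuse_def by (intro sum.cong refl) (auto simp: tensor_map_def f_def cell2_def)
  also have "\<dots> = (if s = d \<and> t = c \<and> u = a \<and> v = x then cell2 a d c x b e else 0)"
    using finite_P cell_support by (auto simp: cell2_def)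
  finally show ?thesis .
qed

lemma cofuse_eq:
  "cofuse P 1 g g (a, d) (x, c) [(u, b), (b, v)] [(d, e), (e, c)]
     = (if u = a \<and> v = x then cell2 a d c x b e else 0)"
proof -
  have "cofuse P 1 g g (a, d) (x, c) [(u, b), (b, v)] [(d, e), (e, c)]
     = (\<Sum>\<gamma>\<in>P. if \<gamma> = (b, e) then (if u = a \<and> v = x then cell2 a d c x b e else 0) else 0)"
    unfolding cofuse_def by (intro sum.cong refl) (auto simp: tensor_map_def g_def cell2_def)
  also have "\<dots> = (if u = a \<and> v = x then cell2 a d c x b e else 0)"
    using finite_P cell_support by (auto simp: cell2_def)
  finally show ?thesis .
qed

lemma cell2_support: "cell2 a d c x b e \<noteq> 0 \<Longrightarrow> (a, b) \<in> EA \<and> (b, x) \<in> EA \<and> (x, c) \<in> P"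
  using cell_support by (auto simp: cell2_def)

lemma twist_eq:
  assumes R: "\<And>a b' b x. \<lbrakk>(a, b') \<in> EA; (b', x) \<in> EA; (a, b) \<in> EA; (b, x) \<in> EA\<rbrakk>
     \<Longrightarrow> R z [(a, b'), (b', x)] [(a, b), (b, x)] = r a b' b x"
  shows "twist G P f g R (a, d) (a, d') c z [(s, e'), (e', t)] [(d, e), (e, c)]
    = (if s = d' \<and> t = c then \<Sum>x\<in>VA. \<Sum>b'\<in>VA. \<Sum>b\<in>VA. cell2 a d' c x b' e' * (r a b' b x * cell2 a d c x b e) else 0)"
proof -
  let ?q = "[(s, e'), (e', t)]" and ?p = "[(d, e), (e, c)]"
  define T where "T = (\<lambda>\<beta>. comp_map (all_walks G 2) (fuse P 1 f f \<beta> (a, d'))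
       (comp_map (all_walks G 2) (R z) (cofuse P 1 g g (a, d) \<beta>)) ?q ?p)"
  have inner: "comp_map (all_walks G 2) (R z) (cofuse P 1 g g (a, d) (x, c)) [(a, b'), (b', x)] ?p
     = (\<Sum>b\<in>VA. r a b' b x * cell2 a d c x b e)" if "(a, b') \<in> EA" "(b', x) \<in> EA" for x b'
  proof -
    have "comp_map (all_walks G 2) (R z) (cofuse P 1 g g (a, d) (x, c)) [(a, b'), (b', x)] ?p
      = (\<Sum>b\<in>VA. R z [(a, b'), (b', x)] [(a, b), (b, x)] * cell2 a d c x b e)"
      unfolding comp_map_def G(1) [symmetric]
      by (subst sum_all_walks_2 [OF G(3), of a x])
         (use cell2_support G(2) in \<open>auto simp: cofuse_eq simp del: One_nat_def\<close>)
    also have "\<dots> = (\<Sum>b\<in>VA. r a b' b x * cell2 a d c x b e)"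
    proof (intro sum.cong refl)
      fix b show "R z [(a, b'), (b', x)] [(a, b), (b, x)] * cell2 a d c x b e = r a b' b x * cell2 a d c x b e"
        using R that cell2_support by (cases "cell2 a d c x b e = 0") auto
    qed
    finally show ?thesis .
  qed
  have T: "T (x, c) = (if s = d' \<and> t = c then \<Sum>b'\<in>VA. \<Sum>b\<in>VA. cell2 a d' c x b' e' * (r a b' b x * cell2 a d c x b e) else 0)" for x
  proof -
    have "T (x, c) = (\<Sum>b'\<in>VA. fuse P 1 f f (x, c) (a, d') ?q [(a, b'), (b', x)] *
        comp_map (all_walks G 2) (R z) (cofuse P 1 g g (a, d) (x, c)) [(a, b'), (b', x)] ?p)"
      unfolding T_def comp_map_def [of _ "fuse P 1 f f (x, c) (a, d')"] G(1) [symmetric]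
      by (rule sum_all_walks_2 [OF G(3)])
         (use cell2_support [of a d' c x _ e'] G(2) in \<open>auto simp: fuse_eq simp del: One_nat_def\<close>)
    also have "\<dots> = (\<Sum>b'\<in>VA. if s = d' \<and> t = c then cell2 a d' c x b' e' * (\<Sum>b\<in>VA. r a b' b x * cell2 a d c x b e) else 0)"
    proof (intro sum.cong refl)
      fix b'
      show "fuse P 1 f f (x, c) (a, d') ?q [(a, b'), (b', x)] *
          comp_map (all_walks G 2) (R z) (cofuse P 1 g g (a, d) (x, c)) [(a, b'), (b', x)] ?p
        = (if s = d' \<and> t = c then cell2 a d' c x b' e' * (\<Sum>b\<in>VA. r a b' b x * cell2 a d c x b e) else 0)"
        unfolding fuse_eq using inner cell2_support by (cases "cell2 a d' c x b' e' = 0") auto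
    qed
    finally have T: "T (x, c) = \<dots>" .
    show ?thesis
    proof (cases "s = d' \<and> t = c")
      case True
      show ?thesis unfolding T if_P [OF True] by (simp add: sum_distrib_left)
    next
      case False
      show ?thesis unfolding T if_not_P [OF False] by simp
    qed
  qed
  have "twist G P f g R (a, d) (a, d') c z ?q ?p = (\<Sum>\<beta> | \<beta> \<in> P \<and> tgt \<beta> = c. T \<beta>)"
    by (simp add: twist_def T_def)
  also have "\<dots> = (\<Sum>x\<in>VA. T (x, c))"
  proof (rule sum_arrows_to)
    fix x assume "(x, c) \<notin> P"
    hence "cell2 a d' c x b' e' = 0" for b' using cell2_support by blast
    thus "T (x, c) = 0" by (simp add: T)
  qed
  finally have *: "twist G P f g R (a, d) (a, d') c z ?q ?p = (\<Sum>x\<in>VA. T (x, c))" .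
  show ?thesis
  proof (cases "s = d' \<and> t = c")
    case True
    show ?thesis unfolding * T if_P [OF True] ..
  next
    case False
    show ?thesis unfolding * T if_not_P [OF False] by simp
  qed
qed

end

section \<open>The elliptic operator on the D diagram\<close>

lemma bracket_eq_theta:
  "bracket (n + 3) \<tau> z = theta (z / of_nat (2 * n + 4)) \<tau> / (deriv (\<lambda>u. theta u \<tau>) 0 / of_nat (2 * n + 4))"
proof -
  have "2 * of_nat (n + 3) - 2 = (of_nat (2 * n + 4) :: complex)" by simp
  thus ?thesis unfolding bracket_def by (simp only:)
qed

text \<open>
  The denominator in the bracket does not vanish, so its zeros are those of the theta function.
\<close>

lemma bracket_eq_0_imp_lattice:
  assumes "Im \<tau> > 0" "bracket (n + 3) \<tau> z = 0"
  obtains k l :: int where "z = of_nat (2 * n + 4) * (of_int k + of_int l * \<tau>)"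
proof -
  have N: "of_nat (2 * n + 4) \<noteq> (0::complex)" by (simp only: of_nat_eq_0_iff)
  have "theta (z / of_nat (2 * n + 4)) \<tau> = 0"
    using assms(2) deriv_theta_0_nonzero [OF assms(1)] N unfolding bracket_eq_theta
    by (simp only: divide_eq_0_iff) simp
  then obtain k l :: int where "z / of_nat (2 * n + 4) = of_int k + of_int l * \<tau>"
    by (rule theta_eq_0_imp_lattice [OF assms(1)])
  hence "z = of_nat (2 * n + 4) * (of_int k + of_int l * \<tau>)"
    using N by (metis nonzero_mult_div_cancel_left times_divide_eq_right)
  thus ?thesis by (rule that)
qed

lemma lattice_real_imp_int:
  assumes "Im \<tau> > 0" "of_real x = of_int k + of_int l * \<tau>"
  shows "x = of_int k"
proof -
  have "Im (of_real x) = Im (of_int k + of_int l * \<tau>)" using assms(2) by simp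
  hence "l = 0" using assms(1) by simp
  hence "complex_of_real x = complex_of_real (of_int k)" using assms(2) by simp
  thus ?thesis by (simp only: of_real_eq_iff)
qed

lemma holomorphic_bracket:
  assumes "Im \<tau> > 0" "f holomorphic_on S"
  shows "(\<lambda>z. bracket (n + 3) \<tau> (f z)) holomorphic_on S"
proof -
  have "of_nat (2 * n + 4) \<noteq> (0::complex)" by (simp only: of_nat_eq_0_iff)
  thus ?thesis unfolding bracket_eq_theta using assms deriv_theta_0_nonzero [OF assms(1)]
    by (intro holomorphic_intros) simp_all
qed

lemma D_cells_bracket:
  assumes t: "Im \<tau> > 0" and sq: "\<And>u. (sq u)\<^sup>2 = (u::complex)"
  shows "D_cells (bracket (n + 3) \<tau>) n sq (1 / sq 2)"
proof unfold_locales
  define N :: complex where "N = of_nat (2 * n + 4)"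
  have N: "N \<noteq> 0" unfolding N_def by (simp only: of_nat_eq_0_iff)
  define \<kappa> where "\<kappa> = deriv (\<lambda>u. theta u \<tau>) 0 / N"
  have br: "bracket (n + 3) \<tau> z = theta (z / N) \<tau> / \<kappa>" for z
    unfolding bracket_eq_theta N_def \<kappa>_def ..
  show "bracket (n + 3) \<tau> (- z) = - bracket (n + 3) \<tau> z" for z
    using theta_minus [OF t, of "z / N"] by (simp add: br)
  show "bracket (n + 3) \<tau> (x + y) * bracket (n + 3) \<tau> (x - y) * bracket (n + 3) \<tau> (u + v) * bracket (n + 3) \<tau> (u - v)
      = bracket (n + 3) \<tau> (x + u) * bracket (n + 3) \<tau> (x - u) * bracket (n + 3) \<tau> (y + v) * bracket (n + 3) \<tau> (y - v)
      - bracket (n + 3) \<tau> (x + v) * bracket (n + 3) \<tau> (x - v) * bracket (n + 3) \<tau> (y + u) * bracket (n + 3) \<tau> (y - u)"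
    for x y u v
    using theta_three_term [OF t, of "x / N" "y / N" "u / N" "v / N"]
    by (simp add: br add_divide_distrib diff_divide_distrib)
  show "bracket (n + 3) \<tau> (of_nat (2 * n + 4) - z) = bracket (n + 3) \<tau> z" for z
  proof -
    have "(N - z) / N = - (z / N) + 1" using N by (simp add: field_simps)
    thus ?thesis unfolding br N_def [symmetric] by (simp only: theta_add_1 [OF t] theta_minus [OF t] minus_minus)
  qed
  show "bracket (n + 3) \<tau> (of_nat a) \<noteq> 0" if a: "0 < a" "a < 2 * n + 4" for a
  proof
    assume "bracket (n + 3) \<tau> (of_nat a) = 0"
    then obtain k l :: int where kl: "of_nat a = of_nat (2 * n + 4) * (of_int k + of_int l * \<tau>)"
      by (rule bracket_eq_0_imp_lattice [OF t])
    have "of_nat a / N = of_int k + of_int l * \<tau>"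
      unfolding kl N_def [symmetric] by (rule nonzero_mult_div_cancel_left [OF N])
    hence "of_real (real a / real (2 * n + 4)) = of_int k + of_int l * \<tau>"
      unfolding N_def by (simp only: of_real_divide of_real_of_nat_eq)
    hence "real a / real (2 * n + 4) = of_int k" by (rule lattice_real_imp_int [OF t])
    moreover have "0 < real a / real (2 * n + 4)" "real a / real (2 * n + 4) < 1" using a by simp_all
    ultimately show False by simp
  qed
  show "4 \<le> 2 * n + 4" by simp
  show "(sq z)\<^sup>2 = z" for z by (rule sq)
  show "1 / sq 2 * (1 / sq 2) = 1 / 2"
    using sq [of 2] by (simp add: power2_eq_square)
qed

locale elliptic_D_twist =
  fixes n :: nat and \<tau> :: complex and sq :: "complex \<Rightarrow> complex"
  assumes Im_tau: "Im \<tau> > 0" and sq: "(sq u)\<^sup>2 = u"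
begin

sublocale D_cells "bracket (n + 3) \<tau>" n sq "1 / sq 2"
  by (rule D_cells_bracket [OF Im_tau sq])

abbreviation "br \<equiv> bracket (n + 3) \<tau>"
abbreviation "h \<equiv> 1 / sq 2"
abbreviation "GA \<equiv> A_graph (2 * n + 3)"
abbreviation "GD \<equiv> D_graph (n + 3)"
abbreviation "VD \<equiv> {1..n + 3}"
abbreviation "EA \<equiv> {(a, b). adjA n a b}"
abbreviation "ED \<equiv> {(d, e). adjD n d e}"
abbreviation "P \<equiv> {(a, d). connects n a d}"

lemma conn_AD_eq: "conn_AD (n + 3) = P"
  using conn_AD_iff by auto

sublocale cells: graph_cells V VD EA ED P "cell h n" GA GD "C_tilde sq (n + 3)" "C_tilde_inv sq (n + 3)"
proof unfold_locales
  have A: "pverts GA = V" "parcs GA = EA" and D: "pverts GD = VD" "parcs GD = ED"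
    using parcs_A_graph parcs_D_graph by (auto simp: A_graph_def D_graph_def)
  show "pverts GA = V" "parcs GA = EA" "pverts GD = VD" "parcs GD = ED" by (fact A D)+
  show "wf_graph GA" unfolding wf_graph_def A by (auto simp: adjA_def)
  show "wf_graph GD" unfolding wf_graph_def D by (auto simp: adjD_def)
  show "cell h n a b d e \<noteq> 0 \<Longrightarrow> (a, d) \<in> P \<and> (b, e) \<in> P \<and> (a, b) \<in> EA \<and> (d, e) \<in> ED" for a b d e
    using cell_nonzero by blast
  show "P \<subseteq> V \<times> VD" by (auto simp: connects_def)
  show "(\<Sum>b\<in>V. cell h n a b d e * cell h n a b d' e) = (if d = d' then 1 else 0)"
    if "(a, d) \<in> P" "(a, d') \<in> P" "(d, e) \<in> ED" "(d', e) \<in> ED" for a d d' e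
    using cell_unitary_target [OF h] that by simp
  show "(\<Sum>d'\<in>VD. cell h n x a d' d * cell h n x a' d' d) = (if a = a' then 1 else 0)"
    if "(a, d) \<in> P" "(a', d) \<in> P" "(x, a) \<in> EA" "(x, a') \<in> EA" for a d a' x
    using cell_unitary_source [OF h] that by simp
qed (auto simp: C_tilde_def C_tilde_inv_def C_coeff_eq_cell)

lemma ED_VD: "(d, e) \<in> ED \<Longrightarrow> d \<in> VD" "(d, e) \<in> ED \<Longrightarrow> e \<in> VD"
  by (auto simp: adjD_def)

lemma cell_intertwines_weight: "cells.cell_intertwines (weight z) (weightD z)"
  unfolding cells.cell_intertwines_def intertwines_def mat_comp_def cells.cell2_def face_on_def
  using face_cell_commute weightD_adj unfolding face_then_cell_def cell_then_face_def by (auto simp del: atLeastLessThan_iff)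

lemma RA_ell_eq_weight:
  assumes "(a, b') \<in> EA" "(b', x) \<in> EA" "(a, b) \<in> EA" "(b, x) \<in> EA"
  shows "RA_ell sq (n + 3) \<tau> z [(a, b'), (b', x)] [(a, b), (b, x)] = weight z a b' b x"
proof -
  have a: "b' = Suc a \<or> a = Suc b'" "b = Suc a \<or> a = Suc b" "x = Suc b \<or> b = Suc x" "x = Suc b' \<or> b' = Suc x"
    using assms by (auto simp: adjA_def)
  show ?thesis
  proof (cases "x = a")
    case True
    thus ?thesis using a(1,2)
      by (elim disjE) (auto simp: RA_ell_def weight_def diag_up_def diag_down_def off_diag_def)
  next
    case False
    hence "b' = b" "b = Suc a \<and> x = Suc b \<or> a = Suc b \<and> b = Suc x" using a by linarith+
    thus ?thesis using False by (auto simp: RA_ell_def weight_def)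
  qed
qed

lemmas twist_eq_sum = cells.twist_eq [where R = "RA_ell sq (n + 3) \<tau>" and r = "weight z" and z = z for z, OF RA_ell_eq_weight]

lemma twist_eq_weightD:
  assumes P: "(a, d) \<in> P" "(a, d') \<in> P" and E: "(d, e) \<in> ED" "(e, c) \<in> ED" "(s, e') \<in> ED" "(e', t) \<in> ED"
  shows "twist GA P (C_tilde sq (n + 3)) (C_tilde_inv sq (n + 3)) (RA_ell sq (n + 3) \<tau>) (a, d) (a, d') c z
      [(s, e'), (e', t)] [(d, e), (e, c)] = (if s = d' \<and> t = c \<and> d = d' then weightD z d e' e c else 0)"
proof (cases "s = d' \<and> t = c")
  case True
  note VD = ED_VD(2) [OF E(2)] ED_VD(2) [OF E(1)] ED_VD(2) [OF E(3)]
  thus ?thesis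
    using cells.twisted_face [OF cell_intertwines_weight P E(1,2) _ _ VD, of z] E True
    by (subst twist_eq_sum) simp_all
next
  case False
  thus ?thesis by (subst twist_eq_sum) auto
qed

text \<open>
  The twist at an arrow with target \<open>d\<close> is \<open>weightD\<close>, which depends on \<open>d\<close> only; the twist between distinct
  arrows with the same source is zero.
\<close>

theorem C_tilde_cell_twist: "cell_twist GA GD P (RA_ell sq (n + 3) \<tau>) (C_tilde sq (n + 3))"
  unfolding cell_twist_def
proof (intro exI [of _ "C_tilde_inv sq (n + 3)"] conjI allI impI ballI)
  show "is_transfer_inverse GA GD P 1 (C_tilde sq (n + 3)) (C_tilde_inv sq (n + 3))"
    by (rule cells.transfer_inverse)
next
  fix z \<beta>1 \<beta>1' c p q
  assume b: "\<beta>1 \<in> P" "\<beta>1' \<in> P" "tgt \<beta>1 = tgt \<beta>1'" and "c \<in> pverts GD"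
    and pq: "p \<in> walks GD 2 (tgt \<beta>1) c" "q \<in> walks GD 2 (tgt \<beta>1) c"
  obtain a a' d where bb: "\<beta>1 = (a, d)" "\<beta>1' = (a', d)" using b(3) by (cases \<beta>1; cases \<beta>1') auto
  obtain e e' where "p = [(d, e), (e, c)]" "(d, e) \<in> ED" "(e, c) \<in> ED" "q = [(d, e'), (e', c)]" "(d, e') \<in> ED" "(e', c) \<in> ED"
    using pq unfolding walks_2 [OF cells.H(3)] bb cells.H(2) by auto
  thus "twist GA P (C_tilde sq (n + 3)) (C_tilde_inv sq (n + 3)) (RA_ell sq (n + 3) \<tau>) \<beta>1 \<beta>1 c z q p
      = twist GA P (C_tilde sq (n + 3)) (C_tilde_inv sq (n + 3)) (RA_ell sq (n + 3) \<tau>) \<beta>1' \<beta>1' c z q p"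
    using b(1,2) unfolding bb by (simp only: twist_eq_weightD)
next
  fix z \<beta>1 \<beta>2 c p q
  assume b: "\<beta>1 \<in> P" "\<beta>2 \<in> P" "\<beta>2 \<noteq> \<beta>1" "src \<beta>2 = src \<beta>1" and "c \<in> pverts GD"
    and pq: "p \<in> walks GD 2 (tgt \<beta>1) c" "q \<in> walks GD 2 (tgt \<beta>2) c"
  obtain a d d' where bb: "\<beta>1 = (a, d)" "\<beta>2 = (a, d')" "d \<noteq> d'" using b(3,4) by (cases \<beta>1; cases \<beta>2) auto
  obtain e e' where "p = [(d, e), (e, c)]" "(d, e) \<in> ED" "(e, c) \<in> ED" "q = [(d', e'), (e', c)]" "(d', e') \<in> ED" "(e', c) \<in> ED"
    using pq unfolding walks_2 [OF cells.H(3)] bb cells.H(2) by auto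
  thus "twist GA P (C_tilde sq (n + 3)) (C_tilde_inv sq (n + 3)) (RA_ell sq (n + 3) \<tau>) \<beta>1 \<beta>2 c z q p = 0"
    using b(1,2) bb(3) unfolding bb(1,2) by (simp add: twist_eq_weightD)
qed

context
  fixes \<beta>s :: "nat \<Rightarrow> arrow"
  assumes \<beta>s: "connecting_system (n + 3) \<beta>s"
begin

abbreviation "RD \<equiv> RD_ell sq (n + 3) \<tau> \<beta>s"

lemma connecting_arrow:
  assumes "d \<in> VD"
  obtains a where "\<beta>s d = (a, d)" "(a, d) \<in> P"
proof -
  have "\<forall>c\<in>VD. \<beta>s c \<in> P \<and> tgt (\<beta>s c) = c"
    using \<beta>s unfolding connecting_system_def conn_AD_eq cells.H(1) by (rule conjunct1)
  from bspec [OF this assms] show ?thesis using that by (cases "\<beta>s d") simp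
qed

lemma RD_eq_weightD:
  assumes E: "(d, e) \<in> ED" "(e, c) \<in> ED" "(s, e') \<in> ED" "(e', t) \<in> ED"
  shows "RD z [(s, e'), (e', t)] [(d, e), (e, c)] = (if (s, t) = (d, c) then weightD z d e' e c else 0)"
proof -
  obtain a where a: "\<beta>s d = (a, d)" "(a, d) \<in> P"
    using connecting_arrow ED_VD(1) [OF E(1)] by blast
  have eq: "2 * (n + 3) - 3 = 2 * n + 3" "fst (hd [(d, e), (e, c)]) = d" "snd (last [(d, e), (e, c)]) = c" by simp_all
  have "RD z [(s, e'), (e', t)] [(d, e), (e, c)]
     = twist GA P (C_tilde sq (n + 3)) (C_tilde_inv sq (n + 3)) (RA_ell sq (n + 3) \<tau>) (a, d) (a, d) c z
      [(s, e'), (e', t)] [(d, e), (e, c)]"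
    unfolding RD_ell_def twisted_operator_def Let_def conn_AD_eq eq a(1) ..
  also have "\<dots> = (if (s, t) = (d, c) then weightD z d e' e c else 0)"
    by (subst twist_eq_weightD [OF a(2) a(2) E]) auto
  finally show ?thesis .
qed

lemma meromorphic_if:
  "(b \<Longrightarrow> f meromorphic_on S) \<Longrightarrow> (\<not> b \<Longrightarrow> g meromorphic_on S) \<Longrightarrow> (\<lambda>z. if b then f z else g z) meromorphic_on S"
  by (cases b) auto

lemma meromorphic_bracket: "f holomorphic_on UNIV \<Longrightarrow> (\<lambda>z. br (f z)) meromorphic_on UNIV"
  by (intro analytic_on_imp_meromorphic_on) (simp add: analytic_on_open holomorphic_bracket [OF Im_tau])

lemma meromorphic_weightD: "(\<lambda>z. weightD z d e' e c) meromorphic_on UNIV"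
proof -
  have 1: "(\<lambda>z. diag_up z a) meromorphic_on UNIV" "(\<lambda>z. diag_down z a) meromorphic_on UNIV"
    "(\<lambda>z. off_diag z a) meromorphic_on UNIV" for a
    unfolding diag_up_def diag_down_def off_diag_def
    by (intro meromorphic_intros meromorphic_bracket holomorphic_intros)+
  show ?thesis
    unfolding weightD_def weight_def Let_def
    by (intro meromorphic_if meromorphic_intros 1)
qed

text \<open>
  The coefficient of the walk \<open>1, 2, 1\<close> is an affine function of \<open>[1 + u] / [1 - u]\<close>.  Analyticity at a zero
  of \<open>[1 - u]\<close> would force \<open>[1 + u]\<close> to vanish there too, and then \<open>2\<close> would lie in the lattice spanned by
  \<open>2 n + 4\<close> and \<open>(2 n + 4) \<tau>\<close>.
\<close>

lemma regular_at_RD: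
  assumes "regular_at GD RD z"
  shows "br (1 - z) \<noteq> 0"
proof
  assume z: "br (1 - z) = 0"
  have E: "(1, 2) \<in> ED" "(2, 1) \<in> ED" by (auto simp: adjD_def)
  hence "[(1, 2), (2, 1)] \<in> all_walks GD 2"
    unfolding all_walks_2 [OF cells.H(3)] cells.H(2) by blast
  hence "(\<lambda>u. RD u [(1, 2), (2, 1)] [(1, 2), (2, 1)]) analytic_on {z}"
    using assms unfolding regular_at_def by blast
  hence an: "(\<lambda>u. weightD u 1 2 2 1) analytic_on {z}"
    using E by (simp add: RD_eq_weightD)
  \<comment> \<open>for \<open>n = 0\<close> the vertex \<open>1\<close> is the branch vertex and \<open>2\<close> is a leaf\<close>
  have "(\<lambda>u. diag_up u 1) analytic_on {z}"
  proof (cases "n = 0")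
    case True
    have n: "(1 \<le> n) = False" "(2 \<le> n) = False" "(n + 2 \<le> 1) = False" "of_nat (n + 1) = (1::complex)"
      using True by simp_all
    have w: "weightD u 1 2 2 1 = (diag_up u 1 + 1) / 2" for u
      unfolding weightD_def Let_def n using E by simp
    have "diag_up u 1 = 2 * weightD u 1 2 2 1 - 1" for u unfolding w by (simp add: field_simps)
    thus ?thesis using an by (auto intro!: analytic_intros)
  next
    case False
    have "diag_up u 1 = weightD u 1 2 2 1" for u
      using E False by (simp add: weightD_def weight_def)
    thus ?thesis using an by simp
  qed
  hence "isCont (\<lambda>u. diag_up u 1) z"
    using analytic_at_imp_isCont by blast
  moreover have hol: "(\<lambda>u. br (1 - u)) holomorphic_on UNIV" "(\<lambda>u. br (1 + u)) holomorphic_on UNIV"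
    by (intro holomorphic_bracket [OF Im_tau] holomorphic_intros)+
  hence cont: "isCont (\<lambda>u. br (1 - u)) z" "isCont (\<lambda>u. br (1 + u)) z"
    using holomorphic_on_imp_continuous_on continuous_on_eq_continuous_at open_UNIV by blast+
  ultimately have "isCont (\<lambda>u. diag_up u 1 * br (1 - u)) z" by (intro continuous_intros)
  hence lim0: "((\<lambda>u. diag_up u 1 * br (1 - u)) \<longlongrightarrow> 0) (at z)"
    unfolding isCont_def using z by simp
  have "\<forall>\<^sub>F u in at z. br (1 - u) \<noteq> 0 \<and> u \<in> UNIV"
    by (rule non_zero_neighbour_alt [OF hol(1), of _ 0]) auto
  hence "\<forall>\<^sub>F u in at z. diag_up u 1 * br (1 - u) = br (1 + u)"
    by eventually_elim (simp add: diag_up_def)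
  hence "((\<lambda>u. br (1 + u)) \<longlongrightarrow> 0) (at z)"
    using lim0 tendsto_cong by fastforce
  moreover have "((\<lambda>u. br (1 + u)) \<longlongrightarrow> br (1 + z)) (at z)" using cont(2) by (simp add: isCont_def)
  ultimately have z': "br (1 + z) = 0"
    using tendsto_unique [OF trivial_limit_at] by blast
  obtain k l :: int where kl: "1 - z = of_nat (2 * n + 4) * (of_int k + of_int l * \<tau>)"
    using bracket_eq_0_imp_lattice [OF Im_tau z] by blast
  obtain k' l' :: int where kl': "1 + z = of_nat (2 * n + 4) * (of_int k' + of_int l' * \<tau>)"
    using bracket_eq_0_imp_lattice [OF Im_tau z'] by blast
  have N: "of_nat (2 * n + 4) \<noteq> (0::complex)" by (simp only: of_nat_eq_0_iff)
  have "of_nat (2 * n + 4) * (of_int (k + k') + of_int (l + l') * \<tau>) = (1 - z) + (1 + z)"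
    unfolding kl kl' by (simp add: algebra_simps)
  hence "of_nat (2 * n + 4) * (of_int (k + k') + of_int (l + l') * \<tau>) = 2" by simp
  hence "of_real (2 / real (2 * n + 4)) = of_int (k + k') + of_int (l + l') * \<tau>"
    using N by (simp add: field_simps)
  hence *: "2 / real (2 * n + 4) = of_int (k + k')" by (rule lattice_real_imp_int [OF Im_tau])
  moreover have "0 < 2 / real (2 * n + 4)" "2 / real (2 * n + 4) < 1" by simp_all
  ultimately have "0 < k + k'" "k + k' < 1" by (simp_all only: of_int_0_less_iff of_int_less_1_iff)
  thus False by simp
qed

lemma represents2_RD: "represents2 GD (RD z) (weightD z)"
  unfolding represents2_def [OF cells.H(3)] cells.H(2)
  using RD_eq_weightD weightD_adj by (simp add: face_on_def)

text \<open>
  Both equations hold for the A weights at all points where their denominators do not vanish, in particular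
  at regular points of the D operator, and descend along the cells.
\<close>

theorem yang_baxter_RD: "yang_baxter_operator GD RD"
  unfolding yang_baxter_operator_def
proof (intro conjI allI ballI impI)
  fix p q assume "p \<in> all_walks GD 2" "q \<in> all_walks GD 2"
  then obtain d e c s e' t where pq: "p = [(d, e), (e, c)]" "q = [(s, e'), (e', t)]"
    and E: "(d, e) \<in> ED" "(e, c) \<in> ED" "(s, e') \<in> ED" "(e', t) \<in> ED"
    unfolding all_walks_2 [OF cells.H(3)] cells.H(2) by blast
  show "(\<lambda>z. RD z q p) meromorphic_on UNIV"
    unfolding pq RD_eq_weightD [OF E] by (intro meromorphic_if meromorphic_weightD meromorphic_intros)
next
  fix z x y x' y' p q assume "(x, y) \<noteq> (x', y')" "p \<in> walks GD 2 x y" "q \<in> walks GD 2 x' y'"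
  thus "RD z q p = 0"
    unfolding walks_2 [OF cells.H(3)] cells.H(2) using RD_eq_weightD by auto
next
  fix z w p q
  assume reg: "regular_at GD RD z" "regular_at GD RD w" "regular_at GD RD (z - w)"
    and "p \<in> all_walks GD 3" "q \<in> all_walks GD 3"
  then obtain d c i s t j where pq: "p = walk3 d c i" "q = walk3 s t j" "is_walk3 GD d c i" "is_walk3 GD s t j"
    unfolding all_walks_3' [OF cells.H(3)] by blast
  let ?W = "all_walks GD 3" and ?D = "VD \<times> VD"
  note rep = represents_comp [OF cells.H(3)] represents_map12 [OF cells.H(3) represents2_RD]
    represents_map23 [OF cells.H(3) represents2_RD]
  have L: "represents GD (comp_map ?W (map23 (RD (z - w))) (comp_map ?W (map12 (RD z)) (map23 (RD w))))
     (\<lambda>x y. mat_comp ?D (face23 (weightD (z - w)) y) (mat_comp ?D (face12 (weightD z) x) (face23 (weightD w) y)))"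
    unfolding cells.H(1) [symmetric] by (intro rep)
  have R: "represents GD (comp_map ?W (map12 (RD w)) (comp_map ?W (map23 (RD z)) (map12 (RD (z - w)))))
     (\<lambda>x y. mat_comp ?D (face12 (weightD w) x) (mat_comp ?D (face23 (weightD z) y) (face12 (weightD (z - w)) x)))"
    unfolding cells.H(1) [symmetric] by (intro rep)
  show "comp_map ?W (map23 (RD (z - w))) (comp_map ?W (map12 (RD z)) (map23 (RD w))) q p
     = comp_map ?W (map12 (RD w)) (comp_map ?W (map23 (RD z)) (map12 (RD (z - w)))) q p"
  proof (cases "(s, t) = (d, c)")
    case False
    show ?thesis
      unfolding pq(1,2) representsD(1) [OF cells.H(3) L pq(4,3)] representsD(1) [OF cells.H(3) R pq(4,3)] if_not_P [OF False] ..
  next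
    case True
    obtain i1 i2 j1 j2 where ij: "i = (i1, i2)" "j = (j1, j2)" by (cases i, cases j)
    have E: "(d, j1) \<in> ED" "(j1, j2) \<in> ED" "(j2, c) \<in> ED" "(d, i1) \<in> ED" "(i1, i2) \<in> ED" "(i2, c) \<in> ED"
      using pq(3,4) True unfolding is_walk3_def [OF cells.H(3)] cells.H(2) ij by simp_all
    hence V4: "j1 \<in> VD" "i1 \<in> VD" "j2 \<in> VD" "i2 \<in> VD" and "d \<in> VD" "c \<in> VD"
      using ED_VD by blast+
    hence VD: "{d, i1, i2, c, j1, j2} \<subseteq> VD" by blast
    obtain a where a: "(a, d) \<in> P" using connecting_arrow [of d] VD by blast
    have nz: "br (1 - (z - w)) \<noteq> 0" "br (1 - w) \<noteq> 0" "br (1 - (z - w + w)) \<noteq> 0"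
      using regular_at_RD reg by auto
    have st: "(\<Sum>b\<in>V. weight (z - w) b1' b2' b c * weight z a b1' b1 b * weight w b1 b b2 c)
        = (\<Sum>b\<in>V. weight w a b1' b b2' * weight z b b2' b2 c * weight (z - w) a b b1 b2)"
      if "{a, b1, b2, c, b1', b2'} \<subseteq> V" for a b1 b2 c b1' b2'
      using star_triangle [OF nz, of a b1 b2 c b1' b2'] that by simp
    show ?thesis
      unfolding pq(1,2) representsD(1) [OF cells.H(3) L pq(4,3)] representsD(1) [OF cells.H(3) R pq(4,3)] if_P [OF True]
      unfolding ij hexagon_left [OF cells.finite_VD V4(1,2)] hexagon_right [OF cells.finite_VD V4(3,4)]
      by (rule cells.star_triangle_transfer [OF cell_intertwines_weight cell_intertwines_weight
            cell_intertwines_weight st VD E a])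
  qed
next
  fix z p q
  assume reg: "regular_at GD RD z" "regular_at GD RD (- z)"
    and "p \<in> all_walks GD 2" "q \<in> all_walks GD 2"
  then obtain d e c s e' t where pq: "p = [(d, e), (e, c)]" "q = [(s, e'), (e', t)]"
    and E: "(d, e) \<in> ED" "(e, c) \<in> ED" "(s, e') \<in> ED" "(e', t) \<in> ED"
    unfolding all_walks_2 [OF cells.H(3)] cells.H(2) by blast
  have nz: "br (1 - z) \<noteq> 0" "br (1 + z) \<noteq> 0"
    using regular_at_RD [OF reg(1)] regular_at_RD [OF reg(2)] by auto
  have un: "(\<Sum>k\<in>V. weight z a b' k c * weight (- z) a k b c) = (if b = b' \<and> (a, b) \<in> EA \<and> (b, c) \<in> EA then 1 else 0)"
    if "{a, b', b, c} \<subseteq> V" for a b' b c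
  proof -
    have "adjA n a b \<and> adjA n b c \<longleftrightarrow> adj a b \<and> adj b c" using that by (auto simp: adjA_def adj_def)
    thus ?thesis using weight_unitary [OF nz, of a b' b c] that by simp
  qed
  let ?s = "\<lambda>k. if s = d \<and> t = c then weightD z d e' k c * weightD (- z) d k e c else 0"
  have prod: "RD z q [(u, k), (k, v)] * RD (- z) [(u, k), (k, v)] p = (if (u, v) = (d, c) then ?s k else 0)"
    if "(u, k) \<in> ED" "(k, v) \<in> ED" for u k v
    unfolding pq using that E by (auto simp: RD_eq_weightD)
  have "comp_map (all_walks GD 2) (RD z) (RD (- z)) q p = (\<Sum>r\<in>all_walks GD 2.
      case r of [(u, k), (k', v)] \<Rightarrow> if (u, v) = (d, c) then ?s k else 0 | _ \<Rightarrow> 0)"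
    unfolding comp_map_def
    by (intro sum.cong refl) (auto simp: all_walks_2 [OF cells.H(3)] cells.H(2) prod)
  also have "\<dots> = (\<Sum>k\<in>VD. ?s k)"
  proof -
    have "?s k = 0" if "\<not> ((d, k) \<in> ED \<and> (k, c) \<in> ED)" for k
      using weightD_adj [of "- z" d k e c] that by auto
    thus ?thesis
      unfolding cells.H(1) [symmetric]
      by (subst sum_all_walks_2 [OF cells.H(3), of d c]) (auto simp: cells.H(2))
  qed
  also have "\<dots> = id_map q p"
  proof (cases "s = d \<and> t = c")
    case True
    have VD: "{d, e', e, c} \<subseteq> VD" using ED_VD E by blast
    obtain a where a: "(a, d) \<in> P" using connecting_arrow [of d] VD by blast
    have "(\<Sum>k\<in>VD. weightD z d e' k c * weightD (- z) d k e c) = (if e = e' then 1 else 0)"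
      using E True
      by (intro cells.unitarity_transfer [OF cell_intertwines_weight cell_intertwines_weight un VD _ _ _ _ a]) auto
    thus ?thesis using True by (auto simp: pq id_map_def)
  next
    case False
    show ?thesis unfolding if_not_P [OF False] using False by (auto simp: pq id_map_def)
  qed
  finally show "comp_map (all_walks GD 2) (RD z) (RD (- z)) q p = id_map q p" .
qed

end

end

theorem proposition7p7:
  fixes L :: nat and \<tau> :: complex and sq :: "complex \<Rightarrow> complex" and \<beta>s :: "nat \<Rightarrow> arrow"
  assumes "L \<ge> 3" and "Im \<tau> > 0"
    and "\<And>u. (sq u)\<^sup>2 = u"
    and "connecting_system L \<beta>s"
  shows "cell_twist (A_graph (2 * L - 3)) (D_graph L) (conn_AD L) (RA_ell sq L \<tau>) (C_tilde sq L)
    \<and> is_transfer_inverse (A_graph (2 * L - 3)) (D_graph L) (conn_AD L) 1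
         (C_tilde sq L) (C_tilde_inv sq L)
    \<and> yang_baxter_operator (D_graph L) (RD_ell sq L \<tau> \<beta>s)"
proof -
  obtain n where L: "L = n + 3" using assms(1) by (metis add.commute le_Suc_ex)
  interpret elliptic_D_twist n \<tau> sq using assms(2,3) by unfold_locales
  have eq: "2 * (n + 3) - 3 = 2 * n + 3" by simp
  show ?thesis
    unfolding L eq conn_AD_eq
    by (intro conjI C_tilde_cell_twist cells.transfer_inverse yang_baxter_RD assms(4) [unfolded L])
qed

end
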